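(* Let $(\mathcal{E},\mathcal{S})$ be a realized limit sketch. Then, for any cocomplete category $\mathcal{C}$ there is a natural equivalence of categories $$\mathrm{Hom}_{\mathrm{wc}}(\mathrm{Mod}^{\mathrm{s}}(\mathcal{S}),\mathcal{C}) \simeq \mathrm{Mod}_{\mathcal{C}}(\mathcal{S}^{\mathrm{op}}),$$ given by $F\mapsto F\circ Y$, with inverse $N\mapsto N\otimes_{\mathcal{S}}-$.
   Context: Conventions: categories are locally small unless otherwise stated; limits, colimits, cones and cocones are indexed by small categories. A limit sketch $(\mathcal{E},\mathcal{S})$ consists of a (possibly large) category $\mathcal{E}$ and a (possibly large) class $\mathcal{S}$ of distinguished cones in $\mathcal{E}$. A model is a functor $\mathcal{E}\to\mathsf{Set}$ mapping every distinguished cone to a limit cone; $\mathrm{Mod}(\mathcal{S})$ is the (not necessarily locally small) category of models and natural transformations. The sketch is realized if each $\mathrm{Hom}(A,-)$, $A\in\mathcal{E}$, is a model (a representable model). A model is small if it is a (small) colimit, taken inside $\mathrm{Mod}(\mathcal{S})$, of representable models; $\mathrm{Mod}^{\mathrm{s}}(\mathcal{S})\subseteq\mathrm{Mod}(\mathcal{S})$ is the full subcategory of small models (it is locally small). $\mathrm{Mod}_{\mathcal{C}}(\mathcal{S}^{\mathrm{op}})$ is the category of functors $N:\mathcal{E}^{\mathrm{op}}\to\mathcal{C}$ mapping the (opposites of the) distinguished cones to colimit cocones. A functor $\mathrm{Mod}^{\mathrm{s}}(\mathcal{S})\to\mathcal{C}$ is weakly cocontinuous if it preserves all colimits that are preserved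 by the inclusion $\mathrm{Mod}^{\mathrm{s}}(\mathcal{S})\hookrightarrow\mathrm{Mod}(\mathcal{S})$; $\mathrm{Hom}_{\mathrm{wc}}$ denotes the category of weakly cocontinuous functors and natural transformations. $Y:\mathcal{E}^{\mathrm{op}}\to\mathrm{Mod}^{\mathrm{s}}(\mathcal{S})$ is the Yoneda model $A\mapsto\mathrm{Hom}(A,-)$. For a small model $M$ and $N\in\mathrm{Mod}_{\mathcal{C}}(\mathcal{S}^{\mathrm{op}})$, the tensor product $N\otimes_{\mathcal{S}}M\in\mathcal{C}$ is the object determined by natural isomorphisms $\mathrm{Hom}(N\otimes_{\mathcal{S}}M,T)\cong\mathrm{Hom}(M,\mathrm{Hom}(N(-),T))$ for $T\in\mathcal{C}$, where $\mathrm{Hom}(N(-),T):\mathcal{E}\to\mathsf{Set}$; it exists for cocomplete $\mathcal{C}$ and is functorial in $M$ and $N$. *)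

theory Defs
  imports "HOL-Library.FuncSet" "HOL-Library.Equipollence"
begin

section \<open>Smallness\<close>

text \<open>
  The type \<open>'u\<close> plays the role of a universe: a set (over any type) is small if its cardinality
  is strictly below that of \<open>'u\<close>.  The predicate \<open>universe\<close> says that \<open>|'u|\<close> is infinite,
  a strong limit and regular.  Every Grothendieck universe gives such a type.  Uncountability is
  not required, which only admits the further instance "small = finite".
\<close>

definition small :: "'u itself \<Rightarrow> 'x set \<Rightarrow> bool" where
  "small _ X \<longleftrightarrow> X \<prec> (UNIV :: 'u set)"

definition universe :: "'u itself \<Rightarrow> bool" where
  "universe U \<longleftrightarrow>
     infinite (UNIV :: 'u set) \<and>
     (\<forall>X :: 'u set. small U X \<longrightarrow> small U (Pow X)) \<and>
     (\<forall>(I :: 'u set) (X :: 'u \<Rightarrow> 'u set).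
        small U I \<and> (\<forall>i\<in>I. small U (X i)) \<longrightarrow> small U (\<Union>i\<in>I. X i))"

section \<open>Categories, functors and natural transformations\<close>

record ('o, 'm) cat =
  Obj :: "'o set"
  Arr :: "'m set"
  Dom :: "'m \<Rightarrow> 'o"
  Cod :: "'m \<Rightarrow> 'o"
  Ident :: "'o \<Rightarrow> 'm"
  Comp :: "'m \<Rightarrow> 'm \<Rightarrow> 'm"   \<comment> \<open>\<open>Comp C g f\<close> is \<open>g\<close> after \<open>f\<close>\<close>

definition hom :: "('o, 'm) cat \<Rightarrow> 'o \<Rightarrow> 'o \<Rightarrow> 'm set" where
  "hom C A B = {f \<in> Arr C. Dom C f = A \<and> Cod C f = B}"

locale category =
  fixes C :: "('o, 'm) cat"
  assumes Dom_Obj: "f \<in> Arr C \<Longrightarrow> Dom C f \<in> Obj C"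
    and Cod_Obj: "f \<in> Arr C \<Longrightarrow> Cod C f \<in> Obj C"
    and Ident_hom: "A \<in> Obj C \<Longrightarrow> Ident C A \<in> hom C A A"
    and Comp_hom: "f \<in> hom C X Y \<Longrightarrow> g \<in> hom C Y Z \<Longrightarrow> Comp C g f \<in> hom C X Z"
    and Comp_Ident: "f \<in> hom C X Y \<Longrightarrow> Comp C f (Ident C X) = f"
    and Ident_Comp: "f \<in> hom C X Y \<Longrightarrow> Comp C (Ident C Y) f = f"
    and Comp_assoc: "f \<in> hom C W X \<Longrightarrow> g \<in> hom C X Y \<Longrightarrow> h \<in> hom C Y Z \<Longrightarrow>
      Comp C h (Comp C g f) = Comp C (Comp C h g) f"

definition op :: "('o, 'm) cat \<Rightarrow> ('o, 'm) cat" where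
  "op C = \<lparr>Obj = Obj C, Arr = Arr C, Dom = Cod C, Cod = Dom C, Ident = Ident C,
           Comp = (\<lambda>g f. Comp C f g)\<rparr>"

definition full_sub :: "('o, 'm) cat \<Rightarrow> 'o set \<Rightarrow> ('o, 'm) cat" where
  "full_sub C K =
     C\<lparr>Obj := Obj C \<inter> K, Arr := {f \<in> Arr C. Dom C f \<in> K \<and> Cod C f \<in> K}\<rparr>"

definition locally_small :: "'u itself \<Rightarrow> ('o, 'm) cat \<Rightarrow> bool" where
  "locally_small U C \<longleftrightarrow> (\<forall>A\<in>Obj C. \<forall>B\<in>Obj C. small U (hom C A B))"

text \<open>
  Up to isomorphism of categories, every small category has its objects and arrows in \<open>'u\<close>,
  so only those are used as index categories.
\<close>

definition small_category :: "('u, 'u) cat \<Rightarrow> bool" where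
  "small_category J \<longleftrightarrow> category J \<and> small TYPE('u) (Obj J) \<and> small TYPE('u) (Arr J)"

text \<open>
  Object and arrow maps are undefined outside the source category, so that functors
  (and natural transformations) that agree on it are equal.
\<close>

record ('o1, 'm1, 'o2, 'm2) ftr =
  fobj :: "'o1 \<Rightarrow> 'o2"
  farr :: "'m1 \<Rightarrow> 'm2"

definition is_functor ::
  "('o1, 'm1) cat \<Rightarrow> ('o2, 'm2) cat \<Rightarrow> ('o1, 'm1, 'o2, 'm2) ftr \<Rightarrow> bool" where
  "is_functor C D F \<longleftrightarrow>
     fobj F \<in> Obj C \<rightarrow>\<^sub>E Obj D \<and>
     farr F \<in> extensional (Arr C) \<and>
     (\<forall>f\<in>Arr C. farr F f \<in> hom D (fobj F (Dom C f)) (fobj F (Cod C f))) \<and>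
     (\<forall>A\<in>Obj C. farr F (Ident C A) = Ident D (fobj F A)) \<and>
     (\<forall>f\<in>Arr C. \<forall>g\<in>Arr C. Dom C g = Cod C f \<longrightarrow>
        farr F (Comp C g f) = Comp D (farr F g) (farr F f))"

definition id_ftr :: "('o, 'm) cat \<Rightarrow> ('o, 'm, 'o, 'm) ftr" where
  "id_ftr C = \<lparr>fobj = (\<lambda>A\<in>Obj C. A), farr = (\<lambda>f\<in>Arr C. f)\<rparr>"

text \<open>\<open>comp_ftr C G F\<close> is \<open>G \<circ> F\<close>, where \<open>C\<close> is the source of \<open>F\<close>.\<close>

definition comp_ftr ::
  "('o1, 'm1) cat \<Rightarrow> ('o2, 'm2, 'o3, 'm3) ftr \<Rightarrow> ('o1, 'm1, 'o2, 'm2) ftr \<Rightarrow>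
   ('o1, 'm1, 'o3, 'm3) ftr" where
  "comp_ftr C G F =
     \<lparr>fobj = (\<lambda>A\<in>Obj C. fobj G (fobj F A)), farr = (\<lambda>f\<in>Arr C. farr G (farr F f))\<rparr>"

type_synonym ('o1, 'm1, 'o2, 'm2) nat_trans =
  "('o1, 'm1, 'o2, 'm2) ftr \<times> ('o1, 'm1, 'o2, 'm2) ftr \<times> ('o1 \<Rightarrow> 'm2)"

definition nat_transs ::
  "('o1, 'm1) cat \<Rightarrow> ('o2, 'm2) cat \<Rightarrow> ('o1, 'm1, 'o2, 'm2) nat_trans set" where
  "nat_transs C D = {(F, G, \<alpha>).
     is_functor C D F \<and> is_functor C D G \<and>
     \<alpha> \<in> extensional (Obj C) \<and>
     (\<forall>A\<in>Obj C. \<alpha> A \<in> hom D (fobj F A) (fobj G A)) \<and>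
     (\<forall>f\<in>Arr C. Comp D (\<alpha> (Cod C f)) (farr F f) = Comp D (farr G f) (\<alpha> (Dom C f)))}"

definition fun_cat ::
  "('o1, 'm1) cat \<Rightarrow> ('o2, 'm2) cat \<Rightarrow>
   (('o1, 'm1, 'o2, 'm2) ftr, ('o1, 'm1, 'o2, 'm2) nat_trans) cat" where
  "fun_cat C D =
     \<lparr>Obj = {F. is_functor C D F},
      Arr = nat_transs C D,
      Dom = (\<lambda>(F, G, \<alpha>). F),
      Cod = (\<lambda>(F, G, \<alpha>). G),
      Ident = (\<lambda>F. (F, F, \<lambda>A\<in>Obj C. Ident D (fobj F A))),
      Comp = (\<lambda>(G, H, \<beta>) (F, G', \<alpha>). (F, H, \<lambda>A\<in>Obj C. Comp D (\<beta> A) (\<alpha> A)))\<rparr>"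

definition isomorphic :: "('o, 'm) cat \<Rightarrow> 'o \<Rightarrow> 'o \<Rightarrow> bool" where
  "isomorphic C A B \<longleftrightarrow>
     (\<exists>f\<in>hom C A B. \<exists>g\<in>hom C B A. Comp C g f = Ident C A \<and> Comp C f g = Ident C B)"

definition inverse_equivalences ::
  "('o1, 'm1) cat \<Rightarrow> ('o2, 'm2) cat \<Rightarrow>
   ('o1, 'm1, 'o2, 'm2) ftr \<Rightarrow> ('o2, 'm2, 'o1, 'm1) ftr \<Rightarrow> bool" where
  "inverse_equivalences A B F G \<longleftrightarrow>
     category A \<and> category B \<and> is_functor A B F \<and> is_functor B A G \<and>
     isomorphic (fun_cat A A) (comp_ftr A G F) (id_ftr A) \<and>
     isomorphic (fun_cat B B) (comp_ftr B F G) (id_ftr B)"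

text \<open>Precomposition with \<open>K\<close> (with source \<open>A\<close>) and postcomposition with \<open>G\<close>, as functors defined
  on a category \<open>X\<close> of functors (with source \<open>B\<close>, in the second case).\<close>

definition precomp ::
  "('o1, 'm1) cat \<Rightarrow> ('o1, 'm1, 'o2, 'm2) ftr \<Rightarrow>
   (('o2, 'm2, 'o3, 'm3) ftr, ('o2, 'm2, 'o3, 'm3) nat_trans) cat \<Rightarrow>
   (('o2, 'm2, 'o3, 'm3) ftr, ('o2, 'm2, 'o3, 'm3) nat_trans,
    ('o1, 'm1, 'o3, 'm3) ftr, ('o1, 'm1, 'o3, 'm3) nat_trans) ftr" where
  "precomp A K X =
     \<lparr>fobj = (\<lambda>F\<in>Obj X. comp_ftr A F K),
      farr = (\<lambda>(F, F', \<alpha>)\<in>Arr X.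
        (comp_ftr A F K, comp_ftr A F' K, \<lambda>a\<in>Obj A. \<alpha> (fobj K a)))\<rparr>"

definition postcomp ::
  "('o1, 'm1) cat \<Rightarrow> ('o2, 'm2, 'o3, 'm3) ftr \<Rightarrow>
   (('o1, 'm1, 'o2, 'm2) ftr, ('o1, 'm1, 'o2, 'm2) nat_trans) cat \<Rightarrow>
   (('o1, 'm1, 'o2, 'm2) ftr, ('o1, 'm1, 'o2, 'm2) nat_trans,
    ('o1, 'm1, 'o3, 'm3) ftr, ('o1, 'm1, 'o3, 'm3) nat_trans) ftr" where
  "postcomp B G X =
     \<lparr>fobj = (\<lambda>F\<in>Obj X. comp_ftr B G F),
      farr = (\<lambda>(F, F', \<alpha>)\<in>Arr X.
        (comp_ftr B G F, comp_ftr B G F', \<lambda>b\<in>Obj B. farr G (\<alpha> b)))\<rparr>"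

section \<open>Limits and colimits\<close>

definition is_cone ::
  "('o, 'm) cat \<Rightarrow> ('i, 'j) cat \<Rightarrow> ('i, 'j, 'o, 'm) ftr \<Rightarrow> 'o \<Rightarrow> ('i \<Rightarrow> 'm) \<Rightarrow> bool" where
  "is_cone C J D A l \<longleftrightarrow>
     is_functor J C D \<and> A \<in> Obj C \<and>
     (\<forall>i\<in>Obj J. l i \<in> hom C A (fobj D i)) \<and>
     (\<forall>u\<in>Arr J. Comp C (farr D u) (l (Dom J u)) = l (Cod J u))"

definition is_limit ::
  "('o, 'm) cat \<Rightarrow> ('i, 'j) cat \<Rightarrow> ('i, 'j, 'o, 'm) ftr \<Rightarrow> 'o \<Rightarrow> ('i \<Rightarrow> 'm) \<Rightarrow> bool" where
  "is_limit C J D A l \<longleftrightarrow>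
     is_cone C J D A l \<and>
     (\<forall>B k. is_cone C J D B k \<longrightarrow> (\<exists>!h. h \<in> hom C B A \<and> (\<forall>i\<in>Obj J. Comp C (l i) h = k i)))"

definition is_cocone ::
  "('o, 'm) cat \<Rightarrow> ('i, 'j) cat \<Rightarrow> ('i, 'j, 'o, 'm) ftr \<Rightarrow> 'o \<Rightarrow> ('i \<Rightarrow> 'm) \<Rightarrow> bool" where
  "is_cocone C J D A l \<longleftrightarrow>
     is_functor J C D \<and> A \<in> Obj C \<and>
     (\<forall>i\<in>Obj J. l i \<in> hom C (fobj D i) A) \<and>
     (\<forall>u\<in>Arr J. Comp C (l (Cod J u)) (farr D u) = l (Dom J u))"

definition is_colimit ::
  "('o, 'm) cat \<Rightarrow> ('i, 'j) cat \<Rightarrow> ('i, 'j, 'o, 'm) ftr \<Rightarrow> 'o \<Rightarrow> ('i \<Rightarrow> 'm) \<Rightarrow> bool" where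
  "is_colimit C J D A l \<longleftrightarrow>
     is_cocone C J D A l \<and>
     (\<forall>B k. is_cocone C J D B k \<longrightarrow> (\<exists>!h. h \<in> hom C A B \<and> (\<forall>i\<in>Obj J. Comp C h (l i) = k i)))"

definition cocomplete :: "'u itself \<Rightarrow> ('o, 'm) cat \<Rightarrow> bool" where
  "cocomplete _ C \<longleftrightarrow>
     (\<forall>(J :: ('u, 'u) cat) D. small_category J \<and> is_functor J C D \<longrightarrow> (\<exists>A l. is_colimit C J D A l))"

definition cocontinuous ::
  "'u itself \<Rightarrow> ('o1, 'm1) cat \<Rightarrow> ('o2, 'm2) cat \<Rightarrow> ('o1, 'm1, 'o2, 'm2) ftr \<Rightarrow> bool" where
  "cocontinuous _ C D G \<longleftrightarrow>
     is_functor C D G \<and>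
     (\<forall>(J :: ('u, 'u) cat) K A l. small_category J \<and> is_colimit C J K A l \<longrightarrow>
        is_colimit D J (comp_ftr J G K) (fobj G A) (\<lambda>i. farr G (l i)))"

section \<open>Sets and Hom-functors\<close>

type_synonym 'u set_arr = "'u set \<times> 'u set \<times> ('u \<Rightarrow> 'u)"

text \<open>The category of small sets; every small set over another type has a copy in \<open>'u\<close>.\<close>

definition Sets :: "('u set, 'u set_arr) cat" where
  "Sets =
     \<lparr>Obj = {X. small TYPE('u) X},
      Arr = {(X, Y, f). small TYPE('u) X \<and> small TYPE('u) Y \<and> f \<in> X \<rightarrow>\<^sub>E Y},
      Dom = (\<lambda>(X, Y, f). X),
      Cod = (\<lambda>(X, Y, f). Y),
      Ident = (\<lambda>X. (X, X, \<lambda>x\<in>X. x)),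
      Comp = (\<lambda>(Y, Z, g) (X, Y', f). (X, Z, \<lambda>x\<in>X. g (f x)))\<rparr>"

text \<open>
  Arrows of a locally small category need not be elements of \<open>'u\<close>, so each Hom-set is replaced
  by its image \<open>Hset\<close> under a chosen injection \<open>enc\<close> into \<open>'u\<close>, with inverse \<open>dec\<close>.
\<close>

definition enc :: "('o, 'm) cat \<Rightarrow> 'o \<Rightarrow> 'o \<Rightarrow> 'm \<Rightarrow> 'u" where
  "enc C A B = (SOME e. inj_on e (hom C A B))"

definition Hset :: "('o, 'm) cat \<Rightarrow> 'o \<Rightarrow> 'o \<Rightarrow> 'u set" where
  "Hset C A B = enc C A B ` hom C A B"

definition dec :: "('o, 'm) cat \<Rightarrow> 'o \<Rightarrow> 'o \<Rightarrow> 'u \<Rightarrow> 'm" where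
  "dec C A B = inv_into (hom C A B) (enc C A B)"

text \<open>\<open>hom_ftr C A\<close> is \<open>Hom(A, -)\<close>; hence \<open>hom_ftr (op C) A\<close> is \<open>Hom(-, A)\<close>.\<close>

definition hom_ftr :: "('o, 'm) cat \<Rightarrow> 'o \<Rightarrow> ('o, 'm, 'u set, 'u set_arr) ftr" where
  "hom_ftr C A =
     \<lparr>fobj = (\<lambda>B\<in>Obj C. Hset C A B),
      farr = (\<lambda>f\<in>Arr C. (Hset C A (Dom C f), Hset C A (Cod C f),
        \<lambda>x\<in>Hset C A (Dom C f). enc C A (Cod C f) (Comp C f (dec C A (Dom C f) x))))\<rparr>"

text \<open>The Yoneda functor \<open>A \<mapsto> Hom(A, -)\<close> on \<open>op C\<close>.\<close>

definition yoneda ::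
  "('o, 'm) cat \<Rightarrow>
   ('o, 'm, ('o, 'm, 'u set, 'u set_arr) ftr, ('o, 'm, 'u set, 'u set_arr) nat_trans) ftr" where
  "yoneda C =
     \<lparr>fobj = (\<lambda>A\<in>Obj C. hom_ftr C A),
      farr = (\<lambda>f\<in>Arr C. (hom_ftr C (Cod C f), hom_ftr C (Dom C f),
        \<lambda>X\<in>Obj C. (Hset C (Cod C f) X, Hset C (Dom C f) X,
          \<lambda>x\<in>Hset C (Cod C f) X. enc C (Dom C f) X (Comp C (dec C (Cod C f) X x) f))))\<rparr>"

section \<open>Limit sketches and their models\<close>

record ('o, 'm, 'u) cone =
  cindex :: "('u, 'u) cat"
  cdiagram :: "('u, 'u, 'o, 'm) ftr"
  capex :: "'o"
  cleg :: "'u \<Rightarrow> 'm"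

definition limit_sketch :: "('e, 'a) cat \<Rightarrow> ('e, 'a, 'u) cone set \<Rightarrow> bool" where
  "limit_sketch E S \<longleftrightarrow>
     category E \<and> locally_small TYPE('u) E \<and>
     (\<forall>c\<in>S. small_category (cindex c) \<and>
        is_cone E (cindex c) (cdiagram c) (capex c) (cleg c))"

type_synonym ('e, 'a, 'u) model = "('e, 'a, 'u set, 'u set_arr) ftr"
type_synonym ('e, 'a, 'u) model_arr = "('e, 'a, 'u set, 'u set_arr) nat_trans"

definition Mod ::
  "('e, 'a) cat \<Rightarrow> ('e, 'a, 'u) cone set \<Rightarrow> (('e, 'a, 'u) model, ('e, 'a, 'u) model_arr) cat" where
  "Mod E S = full_sub (fun_cat E Sets)
     {M. \<forall>c\<in>S. is_limit Sets (cindex c) (comp_ftr (cindex c) M (cdiagram c))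
                 (fobj M (capex c)) (\<lambda>i. farr M (cleg c i))}"

definition realized :: "('e, 'a) cat \<Rightarrow> ('e, 'a, 'u) cone set \<Rightarrow> bool" where
  "realized E S \<longleftrightarrow> (\<forall>A\<in>Obj E. hom_ftr E A \<in> Obj (Mod E S))"

definition small_model ::
  "('e, 'a) cat \<Rightarrow> ('e, 'a, 'u) cone set \<Rightarrow> ('e, 'a, 'u) model \<Rightarrow> bool" where
  "small_model E S M \<longleftrightarrow>
     (\<exists>(J :: ('u, 'u) cat) D l. small_category J \<and>
        (\<forall>i\<in>Obj J. \<exists>A\<in>Obj E. fobj D i = hom_ftr E A) \<and>
        is_colimit (Mod E S) J D M l)"

definition Mod_small ::
  "('e, 'a) cat \<Rightarrow> ('e, 'a, 'u) cone set \<Rightarrow> (('e, 'a, 'u) model, ('e, 'a, 'u) model_arr) cat" where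
  "Mod_small E S = full_sub (Mod E S) {M. small_model E S M}"

text \<open>
  A cone in \<open>E\<close> indexed by \<open>J\<close> is a cocone in \<open>op E\<close> indexed by \<open>op J\<close>,
  given by the same object and arrow maps.
\<close>

definition Mod_op ::
  "('e, 'a) cat \<Rightarrow> ('e, 'a, 'u) cone set \<Rightarrow> ('c, 'd) cat \<Rightarrow>
   (('e, 'a, 'c, 'd) ftr, ('e, 'a, 'c, 'd) nat_trans) cat" where
  "Mod_op E S C = full_sub (fun_cat (op E) C)
     {N. \<forall>c\<in>S. is_colimit C (op (cindex c)) (comp_ftr (op (cindex c)) N (cdiagram c))
                 (fobj N (capex c)) (\<lambda>i. farr N (cleg c i))}"

definition weakly_cocontinuous ::
  "('e, 'a) cat \<Rightarrow> ('e, 'a, 'u) cone set \<Rightarrow> ('c, 'd) cat \<Rightarrow>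
   (('e, 'a, 'u) model, ('e, 'a, 'u) model_arr, 'c, 'd) ftr \<Rightarrow> bool" where
  "weakly_cocontinuous E S C F \<longleftrightarrow>
     (\<forall>(J :: ('u, 'u) cat) D M l.
        small_category J \<and> is_colimit (Mod_small E S) J D M l \<and> is_colimit (Mod E S) J D M l \<longrightarrow>
        is_colimit C J (comp_ftr J F D) (fobj F M) (\<lambda>i. farr F (l i)))"

definition Hom_wc ::
  "('e, 'a) cat \<Rightarrow> ('e, 'a, 'u) cone set \<Rightarrow> ('c, 'd) cat \<Rightarrow>
   ((('e, 'a, 'u) model, ('e, 'a, 'u) model_arr, 'c, 'd) ftr,
    (('e, 'a, 'u) model, ('e, 'a, 'u) model_arr, 'c, 'd) nat_trans) cat" where
  "Hom_wc E S C = full_sub (fun_cat (Mod_small E S) C) {F. weakly_cocontinuous E S C F}"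

text \<open>The functor \<open>F \<mapsto> F \<circ> Y\<close>.\<close>

definition restrict_yoneda ::
  "('e, 'a) cat \<Rightarrow> ('e, 'a, 'u) cone set \<Rightarrow> ('c, 'd) cat \<Rightarrow>
   ((('e, 'a, 'u) model, ('e, 'a, 'u) model_arr, 'c, 'd) ftr,
    (('e, 'a, 'u) model, ('e, 'a, 'u) model_arr, 'c, 'd) nat_trans,
    ('e, 'a, 'c, 'd) ftr, ('e, 'a, 'c, 'd) nat_trans) ftr" where
  "restrict_yoneda E S C = precomp (op E) (yoneda E) (Hom_wc E S C)"

section \<open>Tensor products\<close>

text \<open>
  \<open>hom_from E C N T\<close> is \<open>Hom(N(-), T)\<close> for \<open>N : op E \<rightarrow> C\<close>: the composite of \<open>N\<close>, read as a functor
  from \<open>E\<close> to \<open>op C\<close>, with \<open>Hom(-, T)\<close>.  The next two definitions give its functoriality in \<open>T\<close>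
  (along an arrow \<open>g\<close> of \<open>C\<close>) and, contravariantly, in \<open>N\<close> (along \<open>\<nu> : N \<rightarrow> N'\<close>).
\<close>

definition hom_from ::
  "('e, 'a) cat \<Rightarrow> ('c, 'd) cat \<Rightarrow> ('e, 'a, 'c, 'd) ftr \<Rightarrow> 'c \<Rightarrow> ('e, 'a, 'u) model" where
  "hom_from E C N T = comp_ftr E (hom_ftr (op C) T) N"

definition hom_from_post ::
  "('e, 'a) cat \<Rightarrow> ('c, 'd) cat \<Rightarrow> ('e, 'a, 'c, 'd) ftr \<Rightarrow> 'd \<Rightarrow> ('e, 'a, 'u) model_arr" where
  "hom_from_post E C N g =
     (hom_from E C N (Dom C g), hom_from E C N (Cod C g),
      \<lambda>A\<in>Obj E. (Hset (op C) (Dom C g) (fobj N A), Hset (op C) (Cod C g) (fobj N A),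
        \<lambda>x\<in>Hset (op C) (Dom C g) (fobj N A).
          enc (op C) (Cod C g) (fobj N A) (Comp C g (dec (op C) (Dom C g) (fobj N A) x))))"

definition hom_from_pre ::
  "('e, 'a) cat \<Rightarrow> ('c, 'd) cat \<Rightarrow> ('e, 'a, 'c, 'd) nat_trans \<Rightarrow> 'c \<Rightarrow> ('e, 'a, 'u) model_arr" where
  "hom_from_pre E C = (\<lambda>(N, N', \<nu>) T.
     (hom_from E C N' T, hom_from E C N T, \<lambda>A\<in>Obj E. farr (hom_ftr (op C) T) (\<nu> A)))"

text \<open>
  \<open>X\<close> together with the bijections \<open>\<phi> T : Hom(X, T) \<rightarrow> Hom(M, Hom(N(-), T))\<close>,
  natural in \<open>T\<close>, is a tensor product of \<open>N\<close> and \<open>M\<close>.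
\<close>

definition is_tensor ::
  "('e, 'a) cat \<Rightarrow> ('c, 'd) cat \<Rightarrow> ('e, 'a, 'c, 'd) ftr \<Rightarrow> ('e, 'a, 'u) model \<Rightarrow>
   'c \<Rightarrow> ('c \<Rightarrow> 'd \<Rightarrow> ('e, 'a, 'u) model_arr) \<Rightarrow> bool" where
  "is_tensor E C N M X \<phi> \<longleftrightarrow>
     X \<in> Obj C \<and>
     (\<forall>T\<in>Obj C. bij_betw (\<phi> T) (hom C X T) (hom (fun_cat E Sets) M (hom_from E C N T))) \<and>
     (\<forall>T\<in>Obj C. \<forall>T'\<in>Obj C. \<forall>h\<in>hom C X T. \<forall>g\<in>hom C T T'.
        \<phi> T' (Comp C g h) = Comp (fun_cat E Sets) (hom_from_post E C N g) (\<phi> T h))"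

text \<open>A choice of a tensor product \<open>P N M\<close>, with bijections \<open>\<phi> N M\<close>, for all \<open>N\<close> and all small \<open>M\<close>.\<close>

definition tensor_products ::
  "('e, 'a) cat \<Rightarrow> ('e, 'a, 'u) cone set \<Rightarrow> ('c, 'd) cat \<Rightarrow>
   (('e, 'a, 'c, 'd) ftr \<Rightarrow> ('e, 'a, 'u) model \<Rightarrow> 'c) \<Rightarrow>
   (('e, 'a, 'c, 'd) ftr \<Rightarrow> ('e, 'a, 'u) model \<Rightarrow> 'c \<Rightarrow> 'd \<Rightarrow> ('e, 'a, 'u) model_arr) \<Rightarrow> bool" where
  "tensor_products E S C P \<phi> \<longleftrightarrow>
     (\<forall>N\<in>Obj (Mod_op E S C). \<forall>M\<in>Obj (Mod_small E S). is_tensor E C N M (P N M) (\<phi> N M))"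

text \<open>
  The functor \<open>N \<otimes> -\<close>, and the functor \<open>N \<mapsto> N \<otimes> -\<close>.  The arrows \<open>N \<otimes> \<mu>\<close> and \<open>\<nu> \<otimes> M\<close> are the
  unique ones making the bijections \<open>\<phi>\<close> natural in \<open>M\<close> and in \<open>N\<close>.
\<close>

definition tensor_left ::
  "('e, 'a) cat \<Rightarrow> ('e, 'a, 'u) cone set \<Rightarrow> ('c, 'd) cat \<Rightarrow>
   (('e, 'a, 'c, 'd) ftr \<Rightarrow> ('e, 'a, 'u) model \<Rightarrow> 'c) \<Rightarrow>
   (('e, 'a, 'c, 'd) ftr \<Rightarrow> ('e, 'a, 'u) model \<Rightarrow> 'c \<Rightarrow> 'd \<Rightarrow> ('e, 'a, 'u) model_arr) \<Rightarrow>
   ('e, 'a, 'c, 'd) ftr \<Rightarrow>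
   (('e, 'a, 'u) model, ('e, 'a, 'u) model_arr, 'c, 'd) ftr" where
  "tensor_left E S C P \<phi> N =
     \<lparr>fobj = (\<lambda>M\<in>Obj (Mod_small E S). P N M),
      farr = (\<lambda>\<mu>\<in>Arr (Mod_small E S).
        let M = Dom (Mod_small E S) \<mu>; M' = Cod (Mod_small E S) \<mu>
        in THE h. h \<in> hom C (P N M) (P N M') \<and>
             (\<forall>T\<in>Obj C. \<forall>g\<in>hom C (P N M') T.
                \<phi> N M T (Comp C g h) = Comp (fun_cat E Sets) (\<phi> N M' T g) \<mu>))\<rparr>"

definition tensor ::
  "('e, 'a) cat \<Rightarrow> ('e, 'a, 'u) cone set \<Rightarrow> ('c, 'd) cat \<Rightarrow>
   (('e, 'a, 'c, 'd) ftr \<Rightarrow> ('e, 'a, 'u) model \<Rightarrow> 'c) \<Rightarrow>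
   (('e, 'a, 'c, 'd) ftr \<Rightarrow> ('e, 'a, 'u) model \<Rightarrow> 'c \<Rightarrow> 'd \<Rightarrow> ('e, 'a, 'u) model_arr) \<Rightarrow>
   (('e, 'a, 'c, 'd) ftr, ('e, 'a, 'c, 'd) nat_trans,
    (('e, 'a, 'u) model, ('e, 'a, 'u) model_arr, 'c, 'd) ftr,
    (('e, 'a, 'u) model, ('e, 'a, 'u) model_arr, 'c, 'd) nat_trans) ftr" where
  "tensor E S C P \<phi> =
     \<lparr>fobj = (\<lambda>N\<in>Obj (Mod_op E S C). tensor_left E S C P \<phi> N),
      farr = (\<lambda>\<nu>\<in>Arr (Mod_op E S C).
        let N = Dom (Mod_op E S C) \<nu>; N' = Cod (Mod_op E S C) \<nu>
        in (tensor_left E S C P \<phi> N, tensor_left E S C P \<phi> N',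
            \<lambda>M\<in>Obj (Mod_small E S).
              THE h. h \<in> hom C (P N M) (P N' M) \<and>
                (\<forall>T\<in>Obj C. \<forall>g\<in>hom C (P N' M) T.
                   \<phi> N M T (Comp C g h) =
                     Comp (fun_cat E Sets) (hom_from_pre E C \<nu> T) (\<phi> N' M T g))))\<rparr>"

end

theory Submission
  imports Defs
begin

text \<open>
  Write \<open>Y\<close> for the Yoneda functor and \<open>N \<otimes> M\<close> for the tensor product. Why the theorem holds: a
  tensor product is a universal weighted cocone, that is, a universal family of arrows
  \<open>t A x : N A \<rightarrow> X\<close> indexed by the elements \<open>x \<in> M A\<close> and compatible with the arrows of \<open>E\<close>. Three
  facts about such families carry the proof.

  First, on a representable the universal family is evaluation, \<open>N \<otimes> Hom(A, -) = N A\<close>; this is the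
  Yoneda lemma (\<open>universal_representable\<close>).

  Secondly, if \<open>N\<close> sends the distinguished cones to colimits, then \<open>Hom(N(-), T)\<close> is a model
  (\<open>K_model\<close>). Hence, if \<open>M\<close> is a colimit of models \<open>D i\<close> in the category of all models, weighted
  cocones on \<open>M\<close> are compatible families of weighted cocones on the \<open>D i\<close>. It follows that a weighted
  cocone on \<open>M\<close> is universal exactly when the corresponding cocone under the tensor products of
  the \<open>D i\<close> is a colimit (\<open>universal_of_colimit\<close> and \<open>colimit_of_universal\<close>). Together with the first
  fact this gives the existence of \<open>N \<otimes> M\<close> for small \<open>M\<close>, as a colimit of objects \<open>N A\<close>, and the weak
  cocontinuity of \<open>N \<otimes> -\<close>.

  Thirdly, let \<open>F\<close> be weakly cocontinuous. Since models send the distinguished cones to limits, \<open>Y\<close>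
  sends them to colimits (\<open>yoneda_sends_cones_to_colimits\<close>), so \<open>F \<circ> Y\<close> is an object of \<open>Mod_op\<close>. An
  element \<open>x \<in> M A\<close> is an arrow \<open>Y A \<rightarrow> M\<close>, and applying \<open>F\<close> to these arrows gives a weighted cocone
  from \<open>F \<circ> Y\<close> and \<open>M\<close> to \<open>F M\<close>. It is universal for representable \<open>M\<close> by the first fact and for every
  small \<open>M\<close> by the second one, because \<open>F\<close> preserves the presentation of \<open>M\<close> as a colimit of
  representables (\<open>weakly_cocontinuous_universal\<close>).

  By the uniqueness of universal families, the first fact gives \<open>(N \<otimes> -) \<circ> Y \<cong> N\<close> and the third one
  gives \<open>(F \<circ> Y) \<otimes> - \<cong> F\<close>. The naturality of these isomorphisms, and the functoriality
  of the tensor product itself, hold because arrows out of a tensor product agree as soon as they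
  agree after composition with the universal family (\<open>universal_eqI\<close>). Naturality in \<open>C\<close> holds
  strictly, by the associativity of the composition of functors.

  Two technical choices: Hom-sets are encoded in \<open>'u\<close>, so transformations into \<open>Hom(N(-), T)\<close> are
  decoded once and for all into weighted cocones; and transformations of set-valued functors are
  treated through their action on elements.
\<close>

section \<open>Categories and functors\<close>

lemma arr_hom: "f \<in> Arr C \<Longrightarrow> f \<in> hom C (Dom C f) (Cod C f)"
  by (simp add: hom_def)

lemma homD:
  assumes "f \<in> hom C A B"
  shows "f \<in> Arr C" "Dom C f = A" "Cod C f = B"
  using assms by (auto simp: hom_def)

lemma (in category) hom_Obj:
  assumes "f \<in> hom C A B"
  shows "A \<in> Obj C" "B \<in> Obj C"
  using assms Dom_Obj Cod_Obj by (auto simp: hom_def)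

lemma op_simps [simp]:
  "Obj (op C) = Obj C" "Arr (op C) = Arr C" "Dom (op C) = Cod C" "Cod (op C) = Dom C"
  "Ident (op C) = Ident C" "Comp (op C) g f = Comp C f g" "hom (op C) A B = hom C B A"
  by (auto simp: op_def hom_def)

lemma category_op [simp]:
  assumes "category C"
  shows "category (op C)"
proof -
  interpret category C by fact
  show ?thesis
    by unfold_locales (auto simp: Dom_Obj Cod_Obj Ident_hom Comp_Ident Ident_Comp
      intro: Comp_hom Comp_assoc[symmetric])
qed

lemma locally_small_op [simp]: "locally_small U C \<Longrightarrow> locally_small U (op C)"
  by (simp add: locally_small_def)

lemma small_category_op [simp]: "small_category J \<Longrightarrow> small_category (op J)"
  by (simp add: small_category_def)

lemma full_sub_simps [simp]:
  "Obj (full_sub C K) = Obj C \<inter> K"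
  "Dom (full_sub C K) = Dom C" "Cod (full_sub C K) = Cod C"
  "Ident (full_sub C K) = Ident C" "Comp (full_sub C K) = Comp C"
  by (auto simp: full_sub_def)

lemma hom_full_sub: "hom (full_sub C K) A B = (if A \<in> K \<and> B \<in> K then hom C A B else {})"
  by (auto simp: full_sub_def hom_def)

lemma Arr_full_sub: "Arr (full_sub C K) = {f \<in> Arr C. Dom C f \<in> K \<and> Cod C f \<in> K}"
  by (simp add: full_sub_def)

lemma category_full_sub:
  assumes "category C"
  shows "category (full_sub C K)"
proof -
  interpret category C by fact
  show ?thesis
    by unfold_locales
      (auto simp: Arr_full_sub hom_full_sub Dom_Obj Cod_Obj Ident_hom Comp_Ident Ident_Comp
        split: if_splits intro: Comp_hom Comp_assoc)
qed

lemma is_functorI: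
  assumes "fobj F \<in> extensional (Obj C)" "farr F \<in> extensional (Arr C)"
    and "\<And>A. A \<in> Obj C \<Longrightarrow> fobj F A \<in> Obj D"
    and "\<And>f A B. f \<in> hom C A B \<Longrightarrow> farr F f \<in> hom D (fobj F A) (fobj F B)"
    and "\<And>A. A \<in> Obj C \<Longrightarrow> farr F (Ident C A) = Ident D (fobj F A)"
    and "\<And>f g X Y Z. f \<in> hom C X Y \<Longrightarrow> g \<in> hom C Y Z \<Longrightarrow>
      farr F (Comp C g f) = Comp D (farr F g) (farr F f)"
  shows "is_functor C D F"
  unfolding is_functor_def
  using assms(1-3,5) assms(4)[OF arr_hom] assms(6)[OF arr_hom]
  by (auto simp: PiE_def) (simp add: hom_def)

lemma
  assumes "is_functor C D F"
  shows functor_Obj: "A \<in> Obj C \<Longrightarrow> fobj F A \<in> Obj D"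
    and functor_hom: "f \<in> hom C A B \<Longrightarrow> farr F f \<in> hom D (fobj F A) (fobj F B)"
    and functor_Ident: "A \<in> Obj C \<Longrightarrow> farr F (Ident C A) = Ident D (fobj F A)"
    and functor_Comp: "f \<in> hom C X Y \<Longrightarrow> g \<in> hom C Y Z \<Longrightarrow>
      farr F (Comp C g f) = Comp D (farr F g) (farr F f)"
  using assms by (auto simp: is_functor_def hom_def PiE_def)

lemma functor_op: "is_functor (op C) D F \<Longrightarrow> is_functor C (op D) F"
  by (auto simp: is_functor_def)

lemma functor_op_op: "is_functor C D F \<Longrightarrow> is_functor (op C) (op D) F"
  by (auto simp: is_functor_def)

lemma is_functor_full_sub:
  "is_functor J (full_sub C K) D \<longleftrightarrow> is_functor J C D \<and> (\<forall>i\<in>Obj J. fobj D i \<in> K)"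
  if "category J"
  using that category.Dom_Obj[OF that] category.Cod_Obj[OF that]
  by (auto simp: is_functor_def hom_full_sub PiE_def Pi_def split: if_splits)

lemma comp_ftr_simps [simp]:
  "A \<in> Obj C \<Longrightarrow> fobj (comp_ftr C G F) A = fobj G (fobj F A)"
  "f \<in> Arr C \<Longrightarrow> farr (comp_ftr C G F) f = farr G (farr F f)"
  by (auto simp: comp_ftr_def)

lemma comp_functor:
  assumes "category C" and F: "is_functor C D F" and G: "is_functor D D' G"
  shows "is_functor C D' (comp_ftr C G F)"
proof -
  interpret category C by fact
  show ?thesis
    by (rule is_functorI)
      (auto simp: comp_ftr_def homD Ident_hom[THEN homD(1)] Comp_hom[THEN homD(1)] hom_Obj
        functor_Obj[OF F] functor_Obj[OF G] functor_Ident[OF F] functor_Ident[OF G]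
        functor_Comp[OF F] functor_Comp[OF G, OF functor_hom[OF F] functor_hom[OF F]]
        intro: functor_hom[OF G functor_hom[OF F]])
qed

lemma id_functor:
  assumes "category C"
  shows "is_functor C C (id_ftr C)"
proof -
  interpret category C by fact
  show ?thesis
    by (rule is_functorI)
      (auto simp: id_ftr_def homD Ident_hom[THEN homD(1)] Comp_hom[THEN homD(1)] hom_Obj)
qed

lemma id_ftr_simps [simp]:
  "A \<in> Obj C \<Longrightarrow> fobj (id_ftr C) A = A" "f \<in> Arr C \<Longrightarrow> farr (id_ftr C) f = f"
  by (auto simp: id_ftr_def)

lemma comp_ftr_assoc:
  assumes "category C" and "is_functor C D F"
  shows "comp_ftr C (comp_ftr D H G) F = comp_ftr C H (comp_ftr C G F)"
  using functor_Obj[OF assms(2)] functor_hom[OF assms(2) arr_hom, THEN homD(1)]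
  by (auto simp: comp_ftr_def restrict_def fun_eq_iff)

section \<open>Functor categories\<close>

text \<open>
  The component of a natural transformation, which is stored with its source and target as a triple.
\<close>

definition at :: "('o1, 'm1, 'o2, 'm2) nat_trans \<Rightarrow> 'o1 \<Rightarrow> 'm2" where
  "at \<eta> = snd (snd \<eta>)"

lemma at_pair [simp]: "at (F, G, \<alpha>) = \<alpha>"
  by (simp add: at_def)

lemma fun_cat_simps [simp]:
  "Obj (fun_cat C D) = {F. is_functor C D F}"
  "Arr (fun_cat C D) = nat_transs C D"
  "Dom (fun_cat C D) \<eta> = fst \<eta>"
  "Cod (fun_cat C D) \<eta> = fst (snd \<eta>)"
  "Ident (fun_cat C D) F = (F, F, \<lambda>A\<in>Obj C. Ident D (fobj F A))"
  "Comp (fun_cat C D) \<theta> \<eta> = (fst \<eta>, fst (snd \<theta>), \<lambda>A\<in>Obj C. Comp D (at \<theta> A) (at \<eta> A))"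
  by (auto simp: fun_cat_def at_def split: prod.split)

lemma
  assumes "\<eta> \<in> hom (fun_cat C D) F G"
  shows nt_functors: "is_functor C D F" "is_functor C D G"
    and at_hom: "A \<in> Obj C \<Longrightarrow> at \<eta> A \<in> hom D (fobj F A) (fobj G A)"
    and at_natural: "f \<in> hom C A B \<Longrightarrow>
      Comp D (at \<eta> B) (farr F f) = Comp D (farr G f) (at \<eta> A)"
    and nt_eq: "\<eta> = (F, G, at \<eta>)"
    and at_ext: "at \<eta> \<in> extensional (Obj C)"
  using assms by (auto simp: hom_def nat_transs_def)

lemma ntI:
  assumes "is_functor C D F" "is_functor C D G"
    and "\<And>A. A \<in> Obj C \<Longrightarrow> \<alpha> A \<in> hom D (fobj F A) (fobj G A)"
    and "\<And>f A B. f \<in> hom C A B \<Longrightarrow> A \<in> Obj C \<Longrightarrow> B \<in> Obj C \<Longrightarrow>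
      Comp D (\<alpha> B) (farr F f) = Comp D (farr G f) (\<alpha> A)"
    and "category C"
  shows "(F, G, \<lambda>A\<in>Obj C. \<alpha> A) \<in> hom (fun_cat C D) F G"
  using assms(1-3) assms(4)[OF arr_hom]
    category.Dom_Obj[OF assms(5)] category.Cod_Obj[OF assms(5)]
  by (auto simp: hom_def nat_transs_def)

lemma nt_eqI:
  assumes "\<eta> \<in> hom (fun_cat C D) F G" "\<theta> \<in> hom (fun_cat C D) F G"
    and "\<And>A. A \<in> Obj C \<Longrightarrow> at \<eta> A = at \<theta> A"
  shows "\<eta> = \<theta>"
  using nt_eq[OF assms(1)] nt_eq[OF assms(2)]
    extensionalityI[OF at_ext[OF assms(1)] at_ext[OF assms(2)]] assms(3)
  by metis

lemma category_fun_cat: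
  assumes "category C" "category D"
  shows "category (fun_cat C D)"
proof -
  interpret C: category C by fact
  interpret D: category D by fact
  have id: "Ident (fun_cat C D) F \<in> hom (fun_cat C D) F F" if F: "is_functor C D F" for F
    unfolding fun_cat_simps using F
    by (intro ntI[OF F F _ _ assms(1)])
      (auto intro!: D.Ident_hom functor_Obj[OF F]
        simp: D.Comp_Ident[OF functor_hom[OF F]] D.Ident_Comp[OF functor_hom[OF F]])
  have comp: "Comp (fun_cat C D) \<theta> \<eta> \<in> hom (fun_cat C D) F H"
    if \<eta>: "\<eta> \<in> hom (fun_cat C D) F G" and \<theta>: "\<theta> \<in> hom (fun_cat C D) G H" for \<eta> \<theta> F G H
  proof -
    have "(F, H, \<lambda>A\<in>Obj C. Comp D (at \<theta> A) (at \<eta> A)) \<in> hom (fun_cat C D) F H"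
    proof (rule ntI[OF nt_functors(1)[OF \<eta>] nt_functors(2)[OF \<theta>] _ _ assms(1)])
      fix A assume "A \<in> Obj C"
      then show "Comp D (at \<theta> A) (at \<eta> A) \<in> hom D (fobj F A) (fobj H A)"
        using D.Comp_hom[OF at_hom[OF \<eta>] at_hom[OF \<theta>]] by blast
    next
      fix f A B assume f: "f \<in> hom C A B" and A: "A \<in> Obj C" and B: "B \<in> Obj C"
      note ff = functor_hom[OF nt_functors(1)[OF \<eta>] f] functor_hom[OF nt_functors(2)[OF \<eta>] f]
        functor_hom[OF nt_functors(2)[OF \<theta>] f]
      show "Comp D (Comp D (at \<theta> B) (at \<eta> B)) (farr F f) =
            Comp D (farr H f) (Comp D (at \<theta> A) (at \<eta> A))"
        using D.Comp_assoc[OF ff(1) at_hom[OF \<eta> B] at_hom[OF \<theta> B]]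
          D.Comp_assoc[OF at_hom[OF \<eta> A] ff(2) at_hom[OF \<theta> B]]
          D.Comp_assoc[OF at_hom[OF \<eta> A] at_hom[OF \<theta> A] ff(3)]
          at_natural[OF \<eta> f] at_natural[OF \<theta> f]
        by simp
    qed
    moreover have "fst \<eta> = F" "fst (snd \<theta>) = H"
      using \<eta> \<theta> by (auto simp: hom_def)
    ultimately show ?thesis by simp
  qed
  show ?thesis
  proof
    fix f assume "f \<in> Arr (fun_cat C D)"
    then show "Dom (fun_cat C D) f \<in> Obj (fun_cat C D)" "Cod (fun_cat C D) f \<in> Obj (fun_cat C D)"
      by (auto simp: nat_transs_def)
  next
    fix A assume "A \<in> Obj (fun_cat C D)"
    then show "Ident (fun_cat C D) A \<in> hom (fun_cat C D) A A" using id by simp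
  next
    fix f g X Y Z assume "f \<in> hom (fun_cat C D) X Y" "g \<in> hom (fun_cat C D) Y Z"
    then show "Comp (fun_cat C D) g f \<in> hom (fun_cat C D) X Z" by (rule comp)
  next
    fix f X Y assume f: "f \<in> hom (fun_cat C D) X Y"
    show "Comp (fun_cat C D) f (Ident (fun_cat C D) X) = f"
      by (rule nt_eqI[OF comp[OF id[OF nt_functors(1)[OF f]] f] f])
        (simp add: D.Comp_Ident[OF at_hom[OF f]])
    show "Comp (fun_cat C D) (Ident (fun_cat C D) Y) f = f"
      by (rule nt_eqI[OF comp[OF f id[OF nt_functors(2)[OF f]]] f])
        (simp add: D.Ident_Comp[OF at_hom[OF f]])
  next
    fix f g h W X Y Z
    assume f: "f \<in> hom (fun_cat C D) W X" and g: "g \<in> hom (fun_cat C D) X Y"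
      and h: "h \<in> hom (fun_cat C D) Y Z"
    show "Comp (fun_cat C D) h (Comp (fun_cat C D) g f) =
          Comp (fun_cat C D) (Comp (fun_cat C D) h g) f"
      by (rule nt_eqI[OF comp[OF comp[OF f g] h] comp[OF f comp[OF g h]]])
        (simp add: D.Comp_assoc[OF at_hom[OF f] at_hom[OF g] at_hom[OF h]])
  qed
qed

lemma at_Comp: "A \<in> Obj C \<Longrightarrow> at (Comp (fun_cat C D) \<theta> \<eta>) A = Comp D (at \<theta> A) (at \<eta> A)"
  by simp

section \<open>Isomorphisms\<close>

definition iso :: "('o, 'm) cat \<Rightarrow> 'o \<Rightarrow> 'o \<Rightarrow> 'm \<Rightarrow> bool" where
  "iso C A B f \<longleftrightarrow> f \<in> hom C A B \<and>
     (\<exists>g\<in>hom C B A. Comp C g f = Ident C A \<and> Comp C f g = Ident C B)"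

lemma iso_full_sub: "iso C A B f \<Longrightarrow> A \<in> K \<Longrightarrow> B \<in> K \<Longrightarrow> iso (full_sub C K) A B f"
  by (simp add: iso_def hom_full_sub)

text \<open>
  The inverse of each component is chosen separately; these choices are natural because conjugating
  the naturality square of \<open>\<eta>\<close> by the inverses reverses it.
\<close>

lemma iso_fun_cat:
  assumes C: "category C" and D: "category D"
    and \<eta>: "\<eta> \<in> hom (fun_cat C D) F G"
    and iso: "\<And>A. A \<in> Obj C \<Longrightarrow> iso D (fobj F A) (fobj G A) (at \<eta> A)"
  shows "iso (fun_cat C D) F G \<eta>"
proof -
  interpret C: category C by fact
  interpret D: category D by fact
  interpret FC: category "fun_cat C D" by (rule category_fun_cat[OF C D])
  obtain \<beta> where \<beta>: "\<And>A. A \<in> Obj C \<Longrightarrow> \<beta> A \<in> hom D (fobj G A) (fobj F A) \<and>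
      Comp D (\<beta> A) (at \<eta> A) = Ident D (fobj F A) \<and> Comp D (at \<eta> A) (\<beta> A) = Ident D (fobj G A)"
    using iso unfolding iso_def by metis
  note F = nt_functors(1)[OF \<eta>] and G = nt_functors(2)[OF \<eta>]
  have \<theta>: "(G, F, \<lambda>A\<in>Obj C. \<beta> A) \<in> hom (fun_cat C D) G F" (is "?\<theta> \<in> _")
  proof (rule ntI[OF G F _ _ C])
    fix f A B assume f: "f \<in> hom C A B" and A: "A \<in> Obj C" and B: "B \<in> Obj C"
    note Ff = functor_hom[OF F f] and Gf = functor_hom[OF G f]
    note a = at_hom[OF \<eta> A] and b = at_hom[OF \<eta> B]
    have "Comp D (\<beta> B) (farr G f) = Comp D (\<beta> B) (Comp D (farr G f) (Comp D (at \<eta> A) (\<beta> A)))"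
      using \<beta>[OF A] Gf by (simp add: D.Comp_Ident)
    also have "\<dots> = Comp D (\<beta> B) (Comp D (Comp D (at \<eta> B) (farr F f)) (\<beta> A))"
      using D.Comp_assoc[OF conjunct1[OF \<beta>[OF A]] a Gf] at_natural[OF \<eta> f] by simp
    also have "\<dots> = Comp D (Comp D (Comp D (\<beta> B) (at \<eta> B)) (farr F f)) (\<beta> A)"
      using \<beta>[OF A] \<beta>[OF B]
        D.Comp_assoc[OF conjunct1[OF \<beta>[OF A]] D.Comp_hom[OF Ff b] conjunct1[OF \<beta>[OF B]]]
        D.Comp_assoc[OF Ff b conjunct1[OF \<beta>[OF B]]]
      by simp
    also have "\<dots> = Comp D (farr F f) (\<beta> A)"
      using \<beta>[OF B] Ff by (simp add: D.Ident_Comp)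
    finally show "Comp D (\<beta> B) (farr G f) = Comp D (farr F f) (\<beta> A)" .
  qed (use \<beta> in auto)
  have "Comp (fun_cat C D) ?\<theta> \<eta> = Ident (fun_cat C D) F"
    using \<beta> by (intro nt_eqI[OF FC.Comp_hom[OF \<eta> \<theta>] FC.Ident_hom]) (auto simp: F)
  moreover have "Comp (fun_cat C D) \<eta> ?\<theta> = Ident (fun_cat C D) G"
    using \<beta> by (intro nt_eqI[OF FC.Comp_hom[OF \<theta> \<eta>] FC.Ident_hom]) (auto simp: G)
  ultimately show ?thesis using \<eta> \<theta> unfolding iso_def by blast
qed

lemma isomorphic_functorsI:
  assumes C: "category C" and D: "category D"
    and F: "is_functor C D F" and G: "is_functor C D G"
    and iso: "\<And>A. A \<in> Obj C \<Longrightarrow> iso D (fobj F A) (fobj G A) (\<alpha> A)"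
    and nat: "\<And>f A B. f \<in> hom C A B \<Longrightarrow> A \<in> Obj C \<Longrightarrow> B \<in> Obj C \<Longrightarrow>
      Comp D (\<alpha> B) (farr F f) = Comp D (farr G f) (\<alpha> A)"
  shows "isomorphic (fun_cat C D) F G"
proof -
  have "(F, G, \<lambda>A\<in>Obj C. \<alpha> A) \<in> hom (fun_cat C D) F G"
    using iso by (intro ntI[OF F G _ nat C]) (auto simp: iso_def)
  then have "iso (fun_cat C D) F G (F, G, \<lambda>A\<in>Obj C. \<alpha> A)"
    using iso by (intro iso_fun_cat[OF C D]) auto
  then show ?thesis unfolding iso_def isomorphic_def by blast
qed

section \<open>Cones and colimits\<close>

lemma functor_cone:
  assumes "is_cone E J D A l" and M: "is_functor E B M" and "category J"
  shows "is_cone B J (comp_ftr J M D) (fobj M A) (\<lambda>i. farr M (l i))"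
proof -
  interpret J: category J by fact
  have D: "is_functor J E D" and A: "A \<in> Obj E"
    and l: "\<And>i. i \<in> Obj J \<Longrightarrow> l i \<in> hom E A (fobj D i)"
    and nat: "\<And>u. u \<in> Arr J \<Longrightarrow> Comp E (farr D u) (l (Dom J u)) = l (Cod J u)"
    using assms(1) by (auto simp: is_cone_def)
  have "Comp B (farr M (farr D u)) (farr M (l (Dom J u))) = farr M (l (Cod J u))"
    if u: "u \<in> Arr J" for u
    using functor_Comp[OF M l[OF J.Dom_Obj[OF u]] functor_hom[OF D arr_hom[OF u]]] nat[OF u]
    by simp
  then show ?thesis
    using comp_functor[OF assms(3) D M] functor_Obj[OF M A] functor_hom[OF M l]
    by (auto simp: is_cone_def)
qed

text \<open>
  A functor on \<open>op E\<close> reads a cone over \<open>D : J \<rightarrow> E\<close> as a cocone indexed by \<open>op J\<close>; this is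
  how distinguished cones enter both the Yoneda functor and the objects of \<open>Mod_op\<close>.
\<close>

lemma functor_cone_op:
  assumes "is_cone E J D A l" and N: "is_functor (op E) B N" and "category J"
  shows "is_cocone B (op J) (comp_ftr (op J) N D) (fobj N A) (\<lambda>i. farr N (l i))"
proof -
  interpret J: category J by fact
  have D: "is_functor J E D" and A: "A \<in> Obj E"
    and l: "\<And>i. i \<in> Obj J \<Longrightarrow> l i \<in> hom E A (fobj D i)"
    and nat: "\<And>u. u \<in> Arr J \<Longrightarrow> Comp E (farr D u) (l (Dom J u)) = l (Cod J u)"
    using assms(1) by (auto simp: is_cone_def)
  have D': "is_functor (op J) (op E) D"
    using D by (auto simp: is_functor_def)
  have "Comp B (farr N (l (Dom J u))) (farr N (farr D u)) = farr N (l (Cod J u))"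
    if u: "u \<in> Arr J" for u
    using functor_Comp[OF N, of "farr D u" _ _ "l (Dom J u)"] nat[OF u]
      l[OF J.Dom_Obj[OF u]] functor_hom[OF D arr_hom[OF u]]
    by fastforce
  then show ?thesis
    using comp_functor[OF category_op[OF assms(3)] D' N] functor_Obj[OF N] A functor_hom[OF N] l
    by (auto simp: is_cocone_def)
qed

lemma is_colimit_full_sub:
  assumes col: "is_colimit C J D A l" and J: "category J"
    and D: "\<And>i. i \<in> Obj J \<Longrightarrow> fobj D i \<in> K" and A: "A \<in> K"
  shows "is_colimit (full_sub C K) J D A l"
proof -
  have c: "is_cocone (full_sub C K) J D B k \<longleftrightarrow> is_cocone C J D B k \<and> B \<in> K" for B k
    using D by (auto simp: is_cocone_def is_functor_full_sub[OF J] hom_full_sub J)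
  show ?thesis
    using col A unfolding is_colimit_def c by (simp add: hom_full_sub)
qed

text \<open>
  Legs are not required to be extensional, so equal legs need only agree on the index category.
\<close>

lemma is_colimit_cong:
  assumes "is_colimit C J D A l" and "\<And>i. i \<in> Obj J \<Longrightarrow> l i = l' i" and "category J"
  shows "is_colimit C J D A l'"
  using assms(1,2) category.Dom_Obj[OF assms(3)] category.Cod_Obj[OF assms(3)]
  by (simp add: is_colimit_def is_cocone_def)

section \<open>Composition with a fixed functor\<close>

lemma
  assumes "\<eta> \<in> Arr X"
  shows precomp_arr: "farr (precomp A K X) \<eta> =
      (comp_ftr A (fst \<eta>) K, comp_ftr A (fst (snd \<eta>)) K, \<lambda>a\<in>Obj A. at \<eta> (fobj K a))"
    and postcomp_arr: "farr (postcomp B G X) \<eta> =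
      (comp_ftr B G (fst \<eta>), comp_ftr B G (fst (snd \<eta>)), \<lambda>b\<in>Obj B. farr G (at \<eta> b))"
  using assms by (simp_all add: precomp_def postcomp_def at_def split_beta)

lemma
  assumes "F \<in> Obj X"
  shows precomp_Obj: "fobj (precomp A K X) F = comp_ftr A F K"
    and postcomp_Obj: "fobj (postcomp B G X) F = comp_ftr B G F"
  using assms by (simp_all add: precomp_def postcomp_def)

lemma precomp_functor:
  assumes A: "category A" and B: "category B" and C: "category C" and K: "is_functor A B K"
    and Q: "\<And>F. is_functor B C F \<Longrightarrow> F \<in> P \<Longrightarrow> comp_ftr A F K \<in> Q"
  shows "is_functor (full_sub (fun_cat B C) P) (full_sub (fun_cat A C) Q)
    (precomp A K (full_sub (fun_cat B C) P))" (is "is_functor ?X ?Y ?R")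
proof (rule is_functorI)
  interpret X: category ?X by (intro category_full_sub category_fun_cat B C)
  have hom: "farr ?R \<eta> \<in> hom ?Y (comp_ftr A F K) (comp_ftr A F' K) \<and>
      farr ?R \<eta> = (comp_ftr A F K, comp_ftr A F' K, \<lambda>a\<in>Obj A. at \<eta> (fobj K a))"
    if "\<eta> \<in> hom ?X F F'" for \<eta> F F'
  proof -
    have \<eta>: "\<eta> \<in> hom (fun_cat B C) F F'" and P: "F \<in> P" "F' \<in> P"
      using that by (auto simp: hom_full_sub split: if_splits)
    have eq: "farr ?R \<eta> = (comp_ftr A F K, comp_ftr A F' K, \<lambda>a\<in>Obj A. at \<eta> (fobj K a))"
      using precomp_arr[OF homD(1)[OF that], of A K] homD[OF \<eta>] by simp
    note F = nt_functors[OF \<eta>]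
    have "farr ?R \<eta> \<in> hom (fun_cat A C) (comp_ftr A F K) (comp_ftr A F' K)"
      unfolding eq
      by (rule ntI[OF comp_functor[OF A K F(1)] comp_functor[OF A K F(2)] _ _ A])
        (auto simp: at_hom[OF \<eta> functor_Obj[OF K]] homD at_natural[OF \<eta> functor_hom[OF K]])
    then show ?thesis using eq Q F P by (simp add: hom_full_sub)
  qed
  fix \<eta> F F' assume \<eta>: "\<eta> \<in> hom ?X F F'"
  show "farr ?R \<eta> \<in> hom ?Y (fobj ?R F) (fobj ?R F')"
    using conjunct1[OF hom[OF \<eta>]] by (simp only: precomp_Obj[OF X.hom_Obj(1)[OF \<eta>]] precomp_Obj[OF X.hom_Obj(2)[OF \<eta>]])
  fix \<theta> F'' assume \<theta>: "\<theta> \<in> hom ?X F' F''"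
  show "farr ?R (Comp ?X \<theta> \<eta>) = Comp ?Y (farr ?R \<theta>) (farr ?R \<eta>)"
    using hom[OF \<eta>] hom[OF \<theta>] hom[OF X.Comp_hom[OF \<eta> \<theta>]] functor_Obj[OF K]
    by (simp add: fun_eq_iff)
next
  interpret X: category ?X by (intro category_full_sub category_fun_cat B C)
  fix F assume F: "F \<in> Obj ?X"
  then show "fobj ?R F \<in> Obj ?Y"
    using comp_functor[OF A K, of C F] Q by (simp add: precomp_def)
  have "Ident ?X F \<in> Arr ?X" using X.Ident_hom[OF F] by (rule homD(1))
  then show "farr ?R (Ident ?X F) = Ident ?Y (fobj ?R F)"
    using F functor_Obj[OF K] by (simp add: precomp_arr) (simp add: precomp_def fun_eq_iff)
qed (auto simp: precomp_def)

lemma postcomp_functor: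
  assumes B: "category B" and C: "category C" and C': "category C'" and G: "is_functor C C' G"
    and Q: "\<And>F. is_functor B C F \<Longrightarrow> F \<in> P \<Longrightarrow> comp_ftr B G F \<in> Q"
  shows "is_functor (full_sub (fun_cat B C) P) (full_sub (fun_cat B C') Q)
    (postcomp B G (full_sub (fun_cat B C) P))" (is "is_functor ?X ?Y ?R")
proof (rule is_functorI)
  interpret X: category ?X by (intro category_full_sub category_fun_cat B C)
  have inX: "\<eta> \<in> hom (fun_cat B C) F F'" "F \<in> P" "F' \<in> P" if "\<eta> \<in> hom ?X F F'" for \<eta> F F'
    using that by (auto simp: hom_full_sub split: if_splits)
  have hom: "farr ?R \<eta> \<in> hom ?Y (comp_ftr B G F) (comp_ftr B G F') \<and>
      farr ?R \<eta> = (comp_ftr B G F, comp_ftr B G F', \<lambda>b\<in>Obj B. farr G (at \<eta> b))"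
    if "\<eta> \<in> hom ?X F F'" for \<eta> F F'
  proof -
    note \<eta> = inX(1)[OF that]
    have eq: "farr ?R \<eta> = (comp_ftr B G F, comp_ftr B G F', \<lambda>b\<in>Obj B. farr G (at \<eta> b))"
      using postcomp_arr[OF homD(1)[OF that], of B G] homD[OF \<eta>] by simp
    note F = nt_functors[OF \<eta>]
    have "farr ?R \<eta> \<in> hom (fun_cat B C') (comp_ftr B G F) (comp_ftr B G F')"
      unfolding eq
    proof (rule ntI[OF comp_functor[OF B F(1) G] comp_functor[OF B F(2) G] _ _ B])
      fix b assume "b \<in> Obj B"
      then show "farr G (at \<eta> b) \<in> hom C' (fobj (comp_ftr B G F) b) (fobj (comp_ftr B G F') b)"
        using functor_hom[OF G at_hom[OF \<eta>]] by simp
    next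
      fix f a b assume f: "f \<in> hom B a b" and a: "a \<in> Obj B" and b: "b \<in> Obj B"
      show "Comp C' (farr G (at \<eta> b)) (farr (comp_ftr B G F) f) =
          Comp C' (farr (comp_ftr B G F') f) (farr G (at \<eta> a))"
        using functor_Comp[OF G functor_hom[OF F(1) f] at_hom[OF \<eta> b]] at_natural[OF \<eta> f]
          functor_Comp[OF G at_hom[OF \<eta> a] functor_hom[OF F(2) f]] homD(1)[OF f] by simp
    qed
    then show ?thesis using eq Q F inX[OF that] by (simp add: hom_full_sub)
  qed
  fix \<eta> F F' assume \<eta>: "\<eta> \<in> hom ?X F F'"
  show "farr ?R \<eta> \<in> hom ?Y (fobj ?R F) (fobj ?R F')"
    using conjunct1[OF hom[OF \<eta>]] by (simp only: postcomp_Obj[OF X.hom_Obj(1)[OF \<eta>]] postcomp_Obj[OF X.hom_Obj(2)[OF \<eta>]])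
  fix \<theta> F'' assume \<theta>: "\<theta> \<in> hom ?X F' F''"
  show "farr ?R (Comp ?X \<theta> \<eta>) = Comp ?Y (farr ?R \<theta>) (farr ?R \<eta>)"
    using hom[OF \<eta>] hom[OF \<theta>] hom[OF X.Comp_hom[OF \<eta> \<theta>]]
      functor_Comp[OF G at_hom[OF inX(1)[OF \<eta>]] at_hom[OF inX(1)[OF \<theta>]]]
    by (simp add: fun_eq_iff)
next
  interpret X: category ?X by (intro category_full_sub category_fun_cat B C)
  fix F assume F: "F \<in> Obj ?X"
  then show "fobj ?R F \<in> Obj ?Y"
    using comp_functor[OF B _ G] Q by (simp add: postcomp_def)
  have "Ident ?X F \<in> Arr ?X" using X.Ident_hom[OF F] by (rule homD(1))
  then show "farr ?R (Ident ?X F) = Ident ?Y (fobj ?R F)"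
    using F functor_Ident[OF G functor_Obj[of B C F]]
    by (simp add: postcomp_arr) (simp add: postcomp_def fun_eq_iff)
qed (auto simp: postcomp_def)

section \<open>Set-valued functors\<close>

definition app :: "'u set_arr \<Rightarrow> 'u \<Rightarrow> 'u" where
  "app s = snd (snd s)"

lemma Sets_simps [simp]:
  "Obj Sets = {X :: 'u set. small TYPE('u) X}"
  "Ident Sets X = (X, X, \<lambda>x\<in>X. x)"
  "Comp Sets t s = (fst s, fst (snd t), \<lambda>x\<in>fst s. app t (app s x))"
  by (auto simp: Sets_def app_def split: prod.split)

lemma app_triple [simp]: "app (X, Y, f) = f"
  by (simp add: app_def)

lemma hom_Sets:
  "s \<in> hom Sets X (Y :: 'u set) \<longleftrightarrow>
     small TYPE('u) X \<and> small TYPE('u) Y \<and> s = (X, Y, app s) \<and> app s \<in> X \<rightarrow>\<^sub>E Y"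
  by (auto simp: hom_def Sets_def)

lemma app_in: "s \<in> hom Sets X Y \<Longrightarrow> x \<in> X \<Longrightarrow> app s x \<in> Y"
  by (auto simp: hom_Sets)

lemma Sets_arr_eqI:
  assumes "s \<in> hom Sets X Y" "t \<in> hom Sets X Y" and "\<And>x. x \<in> X \<Longrightarrow> app s x = app t x"
  shows "s = t"
proof -
  have "app s = app t"
    using assms by (auto simp: hom_Sets intro: PiE_ext)
  then show ?thesis using assms(1,2) unfolding hom_Sets by metis
qed

lemma app_Comp:
  assumes "s \<in> hom Sets X Y" "x \<in> X"
  shows "app (Comp Sets t s) x = app t (app s x)"
proof -
  have "fst s = X" using assms(1) unfolding hom_Sets by (metis fst_conv)
  then show ?thesis using assms(2) by simp
qed

lemma Sets_homI:
  "small TYPE('u) X \<Longrightarrow> small TYPE('u) Y \<Longrightarrow> (\<And>x. x \<in> X \<Longrightarrow> f x \<in> Y) \<Longrightarrow>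
   (X, Y, \<lambda>x\<in>X. f x) \<in> hom Sets X (Y :: 'u set)"
  by (auto simp: hom_Sets)

lemma category_Sets: "category (Sets :: ('u set, 'u set_arr) cat)"
proof
  fix f :: "'u set_arr" assume "f \<in> Arr Sets"
  then show "Dom Sets f \<in> Obj Sets" "Cod Sets f \<in> Obj Sets" by (auto simp: Sets_def)
next
  fix A :: "'u set" assume "A \<in> Obj Sets"
  then show "Ident Sets A \<in> hom Sets A A" by (auto intro: Sets_homI)
next
  fix f g and X Y Z :: "'u set" assume f: "f \<in> hom Sets X Y" and g: "g \<in> hom Sets Y Z"
  have "(X, Z, \<lambda>x\<in>X. app g (app f x)) \<in> hom Sets X Z"
    using f g by (intro Sets_homI) (auto simp: hom_Sets)
  moreover have "fst f = X" "fst (snd g) = Z"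
    using f g unfolding hom_Sets by (metis fst_conv snd_conv)+
  ultimately show "Comp Sets g f \<in> hom Sets X Z" by simp
next
  fix f and X Y :: "'u set" assume f: "f \<in> hom Sets X Y"
  then have f': "fst f = X" "fst (snd f) = Y" and XY: "f = (X, Y, app f)" "app f \<in> X \<rightarrow>\<^sub>E Y"
    unfolding hom_Sets by (metis fst_conv snd_conv)+
  have "restrict (app f) X = app f" using XY(2) by (auto simp: PiE_def extensional_restrict)
  moreover have "(\<lambda>x\<in>X. app f (if x \<in> X then x else undefined)) = restrict (app f) X"
    "(\<lambda>x\<in>X. if app f x \<in> Y then app f x else undefined) = restrict (app f) X"
    using XY(2) by (auto simp: fun_eq_iff)
  ultimately show "Comp Sets f (Ident Sets X) = f" "Comp Sets (Ident Sets Y) f = f"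
    using f' XY(1) by (auto simp: restrict_def)
next
  fix f g h and W X Y Z :: "'u set"
  assume "f \<in> hom Sets W X" "g \<in> hom Sets X Y" "h \<in> hom Sets Y Z"
  moreover from this have "fst f = W" "fst g = X"
    unfolding hom_Sets by (metis fst_conv)+
  ultimately show "Comp Sets h (Comp Sets g f) = Comp Sets (Comp Sets h g) f"
    by (auto simp: fun_eq_iff app_in)
qed

text \<open>
  Set-valued functors are handled through their elements: \<open>act M f\<close> transports an element of
  \<open>M A\<close> along \<open>f : A \<rightarrow> B\<close>, and \<open>elt \<eta> A\<close> is the function on elements given by a component.
\<close>

definition act :: "('e, 'a, 'u) model \<Rightarrow> 'a \<Rightarrow> 'u \<Rightarrow> 'u" where
  "act M f = app (farr M f)"

definition elt :: "('e, 'a, 'u) model_arr \<Rightarrow> 'e \<Rightarrow> 'u \<Rightarrow> 'u" where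
  "elt \<eta> A = app (at \<eta> A)"

lemma
  assumes M: "is_functor E Sets (M :: ('e, 'a, 'u) model)"
  shows act_in: "f \<in> hom E A B \<Longrightarrow> x \<in> fobj M A \<Longrightarrow> act M f x \<in> fobj M B"
    and act_Comp: "f \<in> hom E A B \<Longrightarrow> g \<in> hom E B B' \<Longrightarrow> x \<in> fobj M A \<Longrightarrow>
      act M (Comp E g f) x = act M g (act M f x)"
    and act_Ident: "A \<in> Obj E \<Longrightarrow> x \<in> fobj M A \<Longrightarrow> act M (Ident E A) x = x"
    and model_small: "A \<in> Obj E \<Longrightarrow> small TYPE('u) (fobj M A)"
  using functor_Obj[OF M]
  by (auto simp: act_def functor_Comp[OF M] functor_Ident[OF M]
      app_Comp[OF functor_hom[OF M]] simp del: Sets_simps(3) intro: app_in[OF functor_hom[OF M]])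

text \<open>
  For set-valued functors the functor laws can be checked on elements, which avoids computing
  with arrows of \<open>Sets\<close>, that is, with triples and restricted functions.
\<close>

lemma set_functorI:
  assumes "category E"
    and "fobj M \<in> extensional (Obj E)" "farr M \<in> extensional (Arr E)"
    and hom: "\<And>f A B. f \<in> hom E A B \<Longrightarrow> farr M f \<in> hom Sets (fobj M A) (fobj M B)"
    and id: "\<And>A x. A \<in> Obj E \<Longrightarrow> x \<in> fobj M A \<Longrightarrow> act M (Ident E A) x = x"
    and comp: "\<And>f g A B B' x. f \<in> hom E A B \<Longrightarrow> g \<in> hom E B B' \<Longrightarrow> x \<in> fobj M A \<Longrightarrow>
      act M (Comp E g f) x = act M g (act M f x)"
  shows "is_functor E Sets M"
proof -
  interpret category E by fact
  interpret S: category "Sets :: ('c set, 'c set_arr) cat" by (rule category_Sets)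
  have ob: "fobj M A \<in> Obj Sets" if "A \<in> Obj E" for A
    using S.hom_Obj[OF hom[OF Ident_hom[OF that]]] by simp
  show ?thesis
  proof (rule is_functorI)
    fix A assume A: "A \<in> Obj E"
    show "farr M (Ident E A) = Ident Sets (fobj M A)"
      by (rule Sets_arr_eqI[OF hom[OF Ident_hom[OF A]] S.Ident_hom[OF ob[OF A]]])
        (use id[OF A] in \<open>simp add: act_def\<close>)
  next
    fix f g X Y Z assume f: "f \<in> hom E X Y" and g: "g \<in> hom E Y Z"
    show "farr M (Comp E g f) = Comp Sets (farr M g) (farr M f)"
      by (rule Sets_arr_eqI[OF hom[OF Comp_hom[OF f g]] S.Comp_hom[OF hom[OF f] hom[OF g]]])
        (use comp[OF f g] in \<open>simp add: act_def app_Comp[OF hom[OF f]] del: Sets_simps\<close>)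
  qed (use assms ob in auto)
qed

lemma
  assumes \<eta>: "\<eta> \<in> hom (fun_cat E Sets) M M'"
  shows elt_in: "A \<in> Obj E \<Longrightarrow> x \<in> fobj M A \<Longrightarrow> elt \<eta> A x \<in> fobj M' A"
    and elt_natural: "f \<in> hom E A B \<Longrightarrow> A \<in> Obj E \<Longrightarrow> B \<in> Obj E \<Longrightarrow> x \<in> fobj M A \<Longrightarrow>
      elt \<eta> B (act M f x) = act M' f (elt \<eta> A x)"
    and elt_Comp: "A \<in> Obj E \<Longrightarrow> x \<in> fobj M A \<Longrightarrow>
      elt (Comp (fun_cat E Sets) \<theta> \<eta>) A x = elt \<theta> A (elt \<eta> A x)"
proof -
  assume A: "A \<in> Obj E" and x: "x \<in> fobj M A"
  show "elt \<eta> A x \<in> fobj M' A"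
    using app_in[OF at_hom[OF \<eta> A] x] by (simp add: elt_def)
  show "elt (Comp (fun_cat E Sets) \<theta> \<eta>) A x = elt \<theta> A (elt \<eta> A x)"
    using app_Comp[OF at_hom[OF \<eta> A] x] by (simp add: elt_def A del: Sets_simps)
  assume f: "f \<in> hom E A B" and B: "B \<in> Obj E"
  show "elt \<eta> B (act M f x) = act M' f (elt \<eta> A x)"
    using app_Comp[OF at_hom[OF \<eta> A] x, of "farr M' f"] at_natural[OF \<eta> f]
      app_Comp[OF functor_hom[OF nt_functors(1)[OF \<eta>] f] x, of "at \<eta> B"]
    by (simp add: elt_def act_def del: Sets_simps)
qed

lemma elt_Ident: "A \<in> Obj E \<Longrightarrow> x \<in> fobj M A \<Longrightarrow> elt (Ident (fun_cat E Sets) M) A x = x"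
  by (simp add: elt_def)

lemma elt_eqI:
  assumes \<eta>: "\<eta> \<in> hom (fun_cat E Sets) M M'" and \<theta>: "\<theta> \<in> hom (fun_cat E Sets) M M'"
    and "\<And>A x. A \<in> Obj E \<Longrightarrow> x \<in> fobj M A \<Longrightarrow> elt \<eta> A x = elt \<theta> A x"
  shows "\<eta> = \<theta>"
  using assms(3) by (intro nt_eqI[OF \<eta> \<theta>] Sets_arr_eqI[OF at_hom[OF \<eta>] at_hom[OF \<theta>]])
    (auto simp: elt_def)

definition set_nt ::
  "('e, 'a) cat \<Rightarrow> ('e, 'a, 'u) model \<Rightarrow> ('e, 'a, 'u) model \<Rightarrow> ('e \<Rightarrow> 'u \<Rightarrow> 'u) \<Rightarrow>
   ('e, 'a, 'u) model_arr" where
  "set_nt E M M' t = (M, M', \<lambda>A\<in>Obj E. (fobj M A, fobj M' A, \<lambda>x\<in>fobj M A. t A x))"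

lemma elt_set_nt [simp]: "A \<in> Obj E \<Longrightarrow> x \<in> fobj M A \<Longrightarrow> elt (set_nt E M M' t) A x = t A x"
  by (simp add: set_nt_def elt_def)

lemma set_nt_hom:
  assumes E: "category E" and M: "is_functor E Sets M" and M': "is_functor E Sets M'"
    and t: "\<And>A x. A \<in> Obj E \<Longrightarrow> x \<in> fobj M A \<Longrightarrow> t A x \<in> fobj M' A"
    and nat: "\<And>f A B x. f \<in> hom E A B \<Longrightarrow> A \<in> Obj E \<Longrightarrow> B \<in> Obj E \<Longrightarrow> x \<in> fobj M A \<Longrightarrow>
      t B (act M f x) = act M' f (t A x)"
  shows "set_nt E M M' t \<in> hom (fun_cat E Sets) M M'"
proof -
  interpret category E by fact
  interpret S: category Sets by (rule category_Sets)
  have h: "(fobj M A, fobj M' A, \<lambda>x\<in>fobj M A. t A x) \<in> hom Sets (fobj M A) (fobj M' A)"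
    if "A \<in> Obj E" for A
    using model_small[OF M that] model_small[OF M' that] t[OF that] by (intro Sets_homI)
  show ?thesis
    unfolding set_nt_def
  proof (rule ntI[OF M M' h _ E])
    fix f A B assume f: "f \<in> hom E A B" and A: "A \<in> Obj E" and B: "B \<in> Obj E"
    show "Comp Sets (fobj M B, fobj M' B, \<lambda>x\<in>fobj M B. t B x) (farr M f) =
          Comp Sets (farr M' f) (fobj M A, fobj M' A, \<lambda>x\<in>fobj M A. t A x)"
    proof (rule Sets_arr_eqI[OF S.Comp_hom[OF functor_hom[OF M f] h[OF B]]
          S.Comp_hom[OF h[OF A] functor_hom[OF M' f]]])
      fix x assume x: "x \<in> fobj M A"
      show "app (Comp Sets (fobj M B, fobj M' B, restrict (t B) (fobj M B)) (farr M f)) x =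
         app (Comp Sets (farr M' f) (fobj M A, fobj M' A, restrict (t A) (fobj M A))) x"
        using nat[OF f A B x] act_in[OF M f x] x
          app_Comp[OF functor_hom[OF M f] x, of "(fobj M B, fobj M' B, restrict (t B) (fobj M B))"]
          app_Comp[OF h[OF A] x]
        by (simp add: act_def del: Sets_simps)
    qed
  qed
qed

section \<open>Encoding of Hom-sets\<close>

lemma inj_on_enc:
  assumes "locally_small TYPE('u) C" "A \<in> Obj C" "B \<in> Obj C"
  shows "inj_on (enc C A B :: _ \<Rightarrow> 'u) (hom C A B)"
proof -
  have "\<exists>e :: _ \<Rightarrow> 'u. inj_on e (hom C A B)"
    using assms by (auto simp: locally_small_def small_def lesspoll_def lepoll_def)
  then show ?thesis unfolding enc_def by (rule someI_ex)
qed

lemma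
  assumes C: "locally_small TYPE('u) C" "A \<in> Obj C" "B \<in> Obj C"
  shows dec_enc: "f \<in> hom C A B \<Longrightarrow> dec C A B (enc C A B f :: 'u) = f"
    and enc_dec: "x \<in> Hset C A B \<Longrightarrow> enc C A B (dec C A B (x :: 'u)) = x"
    and dec_hom: "x \<in> Hset C A B \<Longrightarrow> dec C A B (x :: 'u) \<in> hom C A B"
    and small_Hset: "small TYPE('u) (Hset C A B :: 'u set)"
proof -
  note inj = inj_on_enc[OF C]
  show "dec C A B (enc C A B f :: 'u) = f" if "f \<in> hom C A B"
    using inj that by (simp add: dec_def)
next
  note inj = inj_on_enc[OF C]
  assume "x \<in> Hset C A B"
  then show "enc C A B (dec C A B (x :: 'u)) = x" "dec C A B (x :: 'u) \<in> hom C A B"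
    using inj by (auto simp: dec_def Hset_def)
next
  have "(Hset C A B :: 'u set) \<lesssim> hom C A B"
    unfolding Hset_def by (rule image_lepoll)
  then show "small TYPE('u) (Hset C A B :: 'u set)"
    using C unfolding small_def locally_small_def by (meson lesspoll_trans1)
qed

lemma enc_in: "f \<in> hom C A B \<Longrightarrow> enc C A B f \<in> Hset C A B"
  by (simp add: Hset_def)

section \<open>Hom-functors and the Yoneda lemma\<close>

locale locally_small_category = category E for E :: "('e, 'a) cat" +
  fixes U :: "'u itself"
  assumes locally_small: "locally_small TYPE('u) E"
begin

lemmas enc_simps = dec_enc[OF locally_small] enc_dec[OF locally_small]
lemma enc_in': "f \<in> hom E A B \<Longrightarrow> (enc E A B f :: 'u) \<in> Hset E A B"
  by (rule enc_in)

lemmas dec_hom' = dec_hom[OF locally_small]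

lemma hom_ftr_Obj [simp]: "B \<in> Obj E \<Longrightarrow> fobj (hom_ftr E A) B = Hset E A B"
  by (simp add: hom_ftr_def)

lemma act_hom_ftr:
  assumes "f \<in> hom E B B'" and "x \<in> Hset E A B"
  shows "act (hom_ftr E A) f x = enc E A B' (Comp E f (dec E A B x))"
  using assms by (auto simp: hom_ftr_def act_def homD)

lemma hom_ftr_functor:
  assumes A: "A \<in> Obj E"
  shows "is_functor E Sets (hom_ftr E A :: ('e, 'a, 'u) model)"
proof (rule set_functorI)
  show "category E" by unfold_locales
  show "fobj (hom_ftr E A :: ('e, 'a, 'u) model) \<in> extensional (Obj E)"
    "farr (hom_ftr E A :: ('e, 'a, 'u) model) \<in> extensional (Arr E)"
    by (auto simp: hom_ftr_def)
  fix f B B' assume f: "f \<in> hom E B B'"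
  note B = hom_Obj[OF f]
  have "(Hset E A B, Hset E A B', \<lambda>x\<in>Hset E A B. enc E A B' (Comp E f (dec E A B x)) :: 'u) \<in>
      hom Sets (Hset E A B) (Hset E A B')"
    using small_Hset[OF locally_small A] B
    by (intro Sets_homI enc_in' Comp_hom[OF dec_hom'[OF A B(1)] f])
  then show "farr (hom_ftr E A) f \<in> hom Sets (fobj (hom_ftr E A) B)
      (fobj (hom_ftr E A :: ('e, 'a, 'u) model) B')"
    using f B by (simp add: hom_ftr_def homD[OF f])
next
  fix B and x :: 'u assume B: "B \<in> Obj E" and "x \<in> fobj (hom_ftr E A) B"
  then have x: "x \<in> Hset E A B" by simp
  show "act (hom_ftr E A) (Ident E B) x = x"
    using B A x by (simp add: act_hom_ftr[OF Ident_hom] Ident_Comp[OF dec_hom'] enc_simps)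
next
  fix f g X Y Z and x :: 'u
  assume f: "f \<in> hom E X Y" and g: "g \<in> hom E Y Z" and "x \<in> fobj (hom_ftr E A) X"
  note Ob = hom_Obj[OF f] hom_Obj[OF g]
  have x: "x \<in> Hset E A X" using \<open>x \<in> _\<close> Ob by simp
  have d: "dec E A X x \<in> hom E A X" by (rule dec_hom'[OF A Ob(1) x])
  show "act (hom_ftr E A) (Comp E g f) x = act (hom_ftr E A) g (act (hom_ftr E A) f x)"
    using act_hom_ftr[OF f x] act_hom_ftr[OF Comp_hom[OF f g] x]
      act_hom_ftr[OF g, of "enc E A Y (Comp E f (dec E A X x)) :: 'u" A] enc_in'[OF Comp_hom[OF d f]]
    by (simp add: enc_simps A Ob Comp_hom[OF d f] Comp_assoc[OF d f g])
qed

text \<open>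
  The Yoneda lemma: \<open>yo M A x : Hom(A, -) \<rightarrow> M\<close> corresponds to \<open>x \<in> M A\<close>, and conversely a
  transformation is recovered from its value at the (encoded) identity \<open>gen A\<close>.
\<close>

definition yo :: "('e, 'a, 'u) model \<Rightarrow> 'e \<Rightarrow> 'u \<Rightarrow> ('e, 'a, 'u) model_arr" where
  "yo M A x = set_nt E (hom_ftr E A) M (\<lambda>B y. act M (dec E A B y) x)"

definition gen :: "'e \<Rightarrow> 'u" where
  "gen A = enc E A A (Ident E A)"

lemma gen_in: "A \<in> Obj E \<Longrightarrow> gen A \<in> fobj (hom_ftr E A) A"
  by (simp add: gen_def enc_in' Ident_hom)

lemma elt_yo: "B \<in> Obj E \<Longrightarrow> y \<in> Hset E A B \<Longrightarrow> elt (yo M A x) B y = act M (dec E A B y) x"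
  by (simp add: yo_def)

lemma yo_hom:
  assumes M: "is_functor E Sets M" and A: "A \<in> Obj E" and x: "x \<in> fobj M A"
  shows "yo M A x \<in> hom (fun_cat E Sets) (hom_ftr E A) M"
  unfolding yo_def
proof (rule set_nt_hom[OF _ hom_ftr_functor[OF A] M])
  show "category E" by unfold_locales
  fix B and y :: 'u assume B: "B \<in> Obj E" "y \<in> fobj (hom_ftr E A) B"
  then have y: "y \<in> Hset E A B" by simp
  then show "act M (dec E A B y) x \<in> fobj M B"
    using act_in[OF M dec_hom'[OF A B(1) y] x] by simp
  fix f B' assume f: "f \<in> hom E B B'" "B' \<in> Obj E"
  show "act M (dec E A B' (act (hom_ftr E A) f y)) x = act M f (act M (dec E A B y) x)"
    using act_Comp[OF M dec_hom'[OF A B(1) y] f(1) x] y A f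
    by (simp add: act_hom_ftr[OF f(1) y] enc_simps Comp_hom[OF dec_hom'[OF A B(1) y] f(1)])
qed

lemma yo_gen:
  assumes "is_functor E Sets M" "A \<in> Obj E" "x \<in> fobj M A"
  shows "elt (yo M A x) A (gen A) = x"
  using assms gen_in[OF assms(2)]
  by (simp add: elt_yo act_Ident) (simp add: gen_def enc_simps Ident_hom act_Ident)

lemma yo_eq:
  assumes \<eta>: "\<eta> \<in> hom (fun_cat E Sets) (hom_ftr E A) M" and A: "A \<in> Obj E"
  shows "\<eta> = yo M A (elt \<eta> A (gen A))"
proof (rule elt_eqI[OF \<eta> yo_hom[OF nt_functors(2)[OF \<eta>] A elt_in[OF \<eta> A gen_in[OF A]]]])
  fix B and y :: 'u assume B: "B \<in> Obj E" "y \<in> fobj (hom_ftr E A) B"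
  then have y: "y \<in> Hset E A B" by simp
  note d = dec_hom'[OF A B(1) y]
  have "y = act (hom_ftr E A) (dec E A B y) (gen A)"
    using gen_in[OF A] A B y d
    by (simp add: act_hom_ftr) (simp add: gen_def enc_simps Ident_hom Comp_Ident[OF d])
  then show "elt \<eta> B y = elt (yo M A (elt \<eta> A (gen A))) B y"
    using elt_natural[OF \<eta> d A B(1) gen_in[OF A]] by (simp add: elt_yo[OF B(1) y])
qed

text \<open>
  The Yoneda bijection is natural in \<open>M\<close>; \<open>yo_pre\<close> below is naturality in \<open>A\<close>. Both follow from
  \<open>yo_eq\<close>, by evaluating at the identity.
\<close>

lemma yo_post:
  assumes \<mu>: "\<mu> \<in> hom (fun_cat E Sets) M M'" and A: "A \<in> Obj E" and x: "x \<in> fobj M A"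
  shows "Comp (fun_cat E Sets) \<mu> (yo M A x) = yo M' A (elt \<mu> A x)"
proof -
  interpret FC: category "fun_cat E Sets"
    by (rule category_fun_cat[OF category_axioms category_Sets])
  note M = nt_functors(1)[OF \<mu>]
  note y = yo_hom[OF M A x]
  show ?thesis
    using yo_eq[OF FC.Comp_hom[OF y \<mu>] A] elt_Comp[OF y A gen_in[OF A], of \<mu>] yo_gen[OF M A x]
    by simp
qed

text \<open>
  The arrows of the Yoneda functor are themselves instances of \<open>yo\<close>, so that its functoriality and
  its interaction with models reduce to the Yoneda lemma.
\<close>

lemma yoneda_arr:
  assumes f: "f \<in> hom E A B"
  shows "farr (yoneda E) f = yo (hom_ftr E A) B (enc E A B f)"
proof -
  note Ob = hom_Obj[OF f]
  have "(\<lambda>y\<in>(Hset E B X :: 'u set). enc E A X (Comp E (dec E B X y) f) :: 'u) =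
      (\<lambda>y\<in>Hset E B X. act (hom_ftr E A) (dec E B X y) (enc E A B f))" if "X \<in> Obj E" for X
  proof (rule restrict_ext)
    fix y :: 'u assume "y \<in> Hset E B X"
    then show "(enc E A X (Comp E (dec E B X y) f) :: 'u) =
        act (hom_ftr E A) (dec E B X y) (enc E A B f)"
      using act_hom_ftr[OF dec_hom'[OF Ob(2) that], of y "enc E A B f :: 'u" A] enc_in'[OF f] f Ob
      by (simp add: enc_simps)
  qed
  then have "(\<lambda>X\<in>Obj E. (Hset E B X, Hset E A X,
        \<lambda>y\<in>(Hset E B X :: 'u set). enc E A X (Comp E (dec E B X y) f) :: 'u)) =
      (\<lambda>X\<in>Obj E. (fobj (hom_ftr E B) X, fobj (hom_ftr E A) X,
        \<lambda>y\<in>fobj (hom_ftr E B) X. act (hom_ftr E A) (dec E B X y) (enc E A B f)))"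
    by (intro restrict_ext) simp
  then show ?thesis
    using f by (simp add: yoneda_def yo_def set_nt_def homD[OF f])
qed

lemma yo_pre:
  assumes M: "is_functor E Sets M" and f: "f \<in> hom E A B" and x: "x \<in> fobj M A"
  shows "Comp (fun_cat E Sets) (yo M A x) (farr (yoneda E) f) = yo M B (act M f x)"
proof -
  note Ob = hom_Obj[OF f]
  show ?thesis
    using yo_post[OF yo_hom[OF M Ob(1) x] Ob(2), of "enc E A B f"] f Ob
    by (simp add: yoneda_arr[OF f] enc_in' elt_yo enc_simps del: fun_cat_simps)
qed

lemma elt_yoneda:
  assumes f: "f \<in> hom E A B" and X: "X \<in> Obj E" and y: "y \<in> (Hset E B X :: 'u set)"
  shows "elt (farr (yoneda E) f) X y = enc E A X (Comp E (dec E B X y) f)"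
  using act_hom_ftr[OF dec_hom'[OF hom_Obj(2)[OF f] X y] enc_in'[OF f]] hom_Obj[OF f] f
  by (simp add: yoneda_arr[OF f] elt_yo[OF X y] enc_simps)

lemma yoneda_Obj [simp]: "A \<in> Obj E \<Longrightarrow> fobj (yoneda E) A = hom_ftr E A"
  by (simp add: yoneda_def)

lemma yoneda_functor:
  "is_functor (op E) (fun_cat E Sets) (yoneda E :: (_, _, ('e, 'a, 'u) model, _) ftr)"
proof (rule is_functorI)
  fix f A B assume "f \<in> hom (op E) A B"
  then have f: "f \<in> hom E B A" by simp
  note Ob = hom_Obj[OF f]
  show "farr (yoneda E) f \<in> hom (fun_cat E Sets) (fobj (yoneda E) A)
     (fobj (yoneda E) B :: ('e, 'a, 'u) model)"
    using yo_hom[OF hom_ftr_functor[OF Ob(1)] Ob(2), of "enc E B A f"] Ob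
    by (simp add: yoneda_arr[OF f] enc_in'[OF f])
next
  fix A assume "A \<in> Obj (op E)"
  then have A: "A \<in> Obj E" by simp
  interpret FC: category "fun_cat E Sets"
    by (rule category_fun_cat[OF category_axioms category_Sets])
  note id = FC.Ident_hom[of "hom_ftr E A"]
  have "Ident (fun_cat E Sets) (hom_ftr E A) = yo (hom_ftr E A) A (gen A :: 'u)"
    using yo_eq[OF id A] elt_Ident[of A E "gen A :: 'u" "hom_ftr E A"] gen_in[OF A]
      hom_ftr_functor[OF A] A by simp
  then show "farr (yoneda E) (Ident (op E) A) =
      Ident (fun_cat E Sets) (fobj (yoneda E) A :: ('e, 'a, 'u) model)"
    using A by (simp add: yoneda_arr[OF Ident_hom] gen_def)
next
  fix f g X Y Z assume "f \<in> hom (op E) X Y" "g \<in> hom (op E) Y Z"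
  then have f: "f \<in> hom E Y X" and g: "g \<in> hom E Z Y" by auto
  note Ob = hom_Obj[OF f] hom_Obj[OF g]
  have "Comp (fun_cat E Sets) (farr (yoneda E) g) (farr (yoneda E) f) =
      yo (hom_ftr E Z) X (act (hom_ftr E Z) f (enc E Z Y g :: 'u))"
    unfolding yoneda_arr[OF g]
    by (rule yo_pre[OF hom_ftr_functor f]) (use Ob enc_in'[OF g] in auto)
  then show "farr (yoneda E) (Comp (op E) g f) =
      Comp (fun_cat E Sets) (farr (yoneda E) g :: ('e, 'a, 'u) model_arr) (farr (yoneda E) f)"
    using Ob g by (simp add: yoneda_arr[OF Comp_hom[OF g f]] act_hom_ftr[OF f enc_in'[OF g]]
      enc_simps del: fun_cat_simps)
qed (auto simp: yoneda_def hom_ftr_functor)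

end

(* Composites are from now on evaluated on components and elements (at_Comp, elt_Comp); unfolding
   them into triples would hide the terms to which those rules apply. *)
declare fun_cat_simps(5,6) [simp del] Sets_simps(2,3) [simp del]

section \<open>Tensor products as universal weighted cocones\<close>

locale weighted_setting =
  E: locally_small_category E U + C: locally_small_category C U
  for E :: "('e, 'a) cat" and C :: "('c, 'd) cat" and U :: "'u itself"
begin

sublocale Cop: locally_small_category "op C" U
  by (intro locally_small_category.intro locally_small_category_axioms.intro category_op
      C.category_axioms locally_small_op C.locally_small)

sublocale psh: category "fun_cat E (Sets :: ('u set, 'u set_arr) cat)"
  by (rule category_fun_cat[OF E.category_axioms category_Sets])

abbreviation K :: "('e, 'a, 'c, 'd) ftr \<Rightarrow> 'c \<Rightarrow> ('e, 'a, 'u) model" where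
  "K N T \<equiv> hom_from E C N T"

abbreviation PSh :: "(('e, 'a, 'u) model, ('e, 'a, 'u) model_arr) cat" where
  "PSh \<equiv> fun_cat E Sets"

text \<open>
  A weighted cocone is a transformation \<open>M \<rightarrow> Hom(N(-), T)\<close> with the encoding of the Hom-sets
  removed: an arrow \<open>t A x : N A \<rightarrow> T\<close> for every \<open>x \<in> M A\<close>, such that transporting \<open>x\<close> along \<open>f\<close>
  amounts to precomposing with \<open>N f\<close>. In this form all arguments take place in \<open>C\<close>. The conversion
  to and from transformations is given by \<open>leg\<close> and \<open>transpose\<close>.
\<close>

definition weighted_cocone ::
  "('e, 'a, 'c, 'd) ftr \<Rightarrow> ('e, 'a, 'u) model \<Rightarrow> 'c \<Rightarrow> ('e \<Rightarrow> 'u \<Rightarrow> 'd) \<Rightarrow> bool" where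
  "weighted_cocone N M T t \<longleftrightarrow> T \<in> Obj C \<and>
     (\<forall>A\<in>Obj E. \<forall>x\<in>fobj M A. t A x \<in> hom C (fobj N A) T) \<and>
     (\<forall>f\<in>Arr E. \<forall>x\<in>fobj M (Dom E f).
        Comp C (t (Dom E f) x) (farr N f) = t (Cod E f) (act M f x))"

lemma
  assumes "weighted_cocone N M T t"
  shows weighted_cocone_Obj: "T \<in> Obj C"
    and weighted_cocone_hom: "A \<in> Obj E \<Longrightarrow> x \<in> fobj M A \<Longrightarrow> t A x \<in> hom C (fobj N A) T"
    and weighted_cocone_natural: "f \<in> hom E A B \<Longrightarrow> x \<in> fobj M A \<Longrightarrow>
      Comp C (t A x) (farr N f) = t B (act M f x)"
  using assms by (auto simp: weighted_cocone_def hom_def)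

lemma weighted_coconeI:
  assumes "T \<in> Obj C"
    and "\<And>A x. A \<in> Obj E \<Longrightarrow> x \<in> fobj M A \<Longrightarrow> t A x \<in> hom C (fobj N A) T"
    and "\<And>f A B x. f \<in> hom E A B \<Longrightarrow> A \<in> Obj E \<Longrightarrow> B \<in> Obj E \<Longrightarrow> x \<in> fobj M A \<Longrightarrow>
      Comp C (t A x) (farr N f) = t B (act M f x)"
  shows "weighted_cocone N M T t"
  using assms(1,2) assms(3)[OF arr_hom] E.Dom_Obj E.Cod_Obj by (auto simp: weighted_cocone_def)

lemma weighted_cocone_post:
  assumes N: "is_functor (op E) C N" and t: "weighted_cocone N M T t" and g: "g \<in> hom C T T'"
  shows "weighted_cocone N M T' (\<lambda>A x. Comp C g (t A x))"
proof (rule weighted_coconeI)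
  fix f A B x assume f: "f \<in> hom E A B" and A: "A \<in> Obj E" and x: "x \<in> fobj M A"
  have Nf: "farr N f \<in> hom C (fobj N B) (fobj N A)" using functor_hom[OF N] f by simp
  show "Comp C (Comp C g (t A x)) (farr N f) = Comp C g (t B (act M f x))"
    using C.Comp_assoc[OF Nf weighted_cocone_hom[OF t A x] g] weighted_cocone_natural[OF t f x] by simp
qed (use C.hom_Obj[OF g] weighted_cocone_hom[OF t] g in \<open>auto intro: C.Comp_hom\<close>)

lemma weighted_cocone_pre:
  assumes t: "weighted_cocone N M T t" and \<mu>: "\<mu> \<in> hom PSh M' M"
  shows "weighted_cocone N M' T (\<lambda>A x. t A (elt \<mu> A x))"
  by (rule weighted_coconeI)
    (use weighted_cocone_Obj[OF t] in \<open>auto simp: elt_natural[OF \<mu>] weighted_cocone_natural[OF t] elt_in[OF \<mu>]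
      intro: weighted_cocone_hom[OF t]\<close>)

lemma weighted_cocone_diagram:
  assumes t: "weighted_cocone N' M T t" and \<nu>: "\<nu> \<in> hom (fun_cat (op E) C) N N'"
  shows "weighted_cocone N M T (\<lambda>A x. Comp C (t A x) (at \<nu> A))"
proof (rule weighted_coconeI)
  fix A x assume "A \<in> Obj E" "x \<in> fobj M A"
  then show "Comp C (t A x) (at \<nu> A) \<in> hom C (fobj N A) T"
    using C.Comp_hom[OF at_hom[OF \<nu>] weighted_cocone_hom[OF t]] by simp
next
  fix f A B x assume f: "f \<in> hom E A B" and A: "A \<in> Obj E" and B: "B \<in> Obj E"
    and x: "x \<in> fobj M A"
  have f': "f \<in> hom (op E) B A" using f by simp
  have a: "at \<nu> A \<in> hom C (fobj N A) (fobj N' A)" "at \<nu> B \<in> hom C (fobj N B) (fobj N' B)"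
    using at_hom[OF \<nu>] A B by auto
  show "Comp C (Comp C (t A x) (at \<nu> A)) (farr N f) = Comp C (t B (act M f x)) (at \<nu> B)"
    using C.Comp_assoc[OF functor_hom[OF nt_functors(1)[OF \<nu>] f'] a(1) weighted_cocone_hom[OF t A x]]
      C.Comp_assoc[OF a(2) functor_hom[OF nt_functors(2)[OF \<nu>] f'] weighted_cocone_hom[OF t A x]]
      at_natural[OF \<nu> f'] weighted_cocone_natural[OF t f x]
    by simp
qed (rule weighted_cocone_Obj[OF t])

text \<open>
  By the Yoneda lemma in \<open>C\<close>, a tensor product \<open>N \<otimes> M\<close> is an object \<open>X\<close> with a universal weighted
  cocone \<open>t\<close>, the image of the identity of \<open>X\<close>. The lemmas \<open>universal_is_tensor\<close> and
  \<open>tensor_universal\<close> below make this precise.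
\<close>

definition universal ::
  "('e, 'a, 'c, 'd) ftr \<Rightarrow> ('e, 'a, 'u) model \<Rightarrow> 'c \<Rightarrow> ('e \<Rightarrow> 'u \<Rightarrow> 'd) \<Rightarrow> bool" where
  "universal N M X t \<longleftrightarrow> weighted_cocone N M X t \<and>
     (\<forall>T s. weighted_cocone N M T s \<longrightarrow>
        (\<exists>!h. h \<in> hom C X T \<and> (\<forall>A\<in>Obj E. \<forall>x\<in>fobj M A. Comp C h (t A x) = s A x)))"

lemma universal_cocone: "universal N M X t \<Longrightarrow> weighted_cocone N M X t"
  by (simp add: universal_def)

lemma universal_ex1:
  assumes "universal N M X t" "weighted_cocone N M T s"
  shows "\<exists>!h. h \<in> hom C X T \<and> (\<forall>A\<in>Obj E. \<forall>x\<in>fobj M A. Comp C h (t A x) = s A x)"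
  using assms by (simp add: universal_def)

lemma universal_arr:
  assumes "universal N M X t" "weighted_cocone N M T s"
  obtains h where "h \<in> hom C X T" "\<And>A x. A \<in> Obj E \<Longrightarrow> x \<in> fobj M A \<Longrightarrow> Comp C h (t A x) = s A x"
  using universal_ex1[OF assms] by blast

text \<open>
  Arrows out of a tensor product are determined by their composites with the universal cocone. All
  functoriality and naturality statements about tensor products are proved by this rule.
\<close>

lemma universal_eqI:
  assumes N: "is_functor (op E) C N" and t: "universal N M X t"
    and h: "h \<in> hom C X T" and h': "h' \<in> hom C X T"
    and "\<And>A x. A \<in> Obj E \<Longrightarrow> x \<in> fobj M A \<Longrightarrow> Comp C h (t A x) = Comp C h' (t A x)"
  shows "h = h'"
  using universal_ex1[OF t weighted_cocone_post[OF N universal_cocone[OF t] h']] assms by blast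

lemma universal_iso:
  assumes N: "is_functor (op E) C N" and t: "universal N M X t" and t': "universal N M X' t'"
    and h: "h \<in> hom C X X'"
    and ht: "\<And>A x. A \<in> Obj E \<Longrightarrow> x \<in> fobj M A \<Longrightarrow> Comp C h (t A x) = t' A x"
  shows "iso C X X' h"
proof -
  obtain g where g: "g \<in> hom C X' X"
    and gt: "\<And>A x. A \<in> Obj E \<Longrightarrow> x \<in> fobj M A \<Longrightarrow> Comp C g (t' A x) = t A x"
    using universal_arr[OF t' universal_cocone[OF t]] by blast
  note X = C.hom_Obj[OF h]
  have "Comp C g h = Ident C X"
  proof (rule universal_eqI[OF N t C.Comp_hom[OF h g] C.Ident_hom[OF X(1)]])
    fix A x assume A: "A \<in> Obj E" "x \<in> fobj M A"
    note tx = weighted_cocone_hom[OF universal_cocone[OF t] A]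
    show "Comp C (Comp C g h) (t A x) = Comp C (Ident C X) (t A x)"
      using C.Comp_assoc[OF tx h g] ht[OF A] gt[OF A] C.Ident_Comp[OF tx] by simp
  qed
  moreover have "Comp C h g = Ident C X'"
  proof (rule universal_eqI[OF N t' C.Comp_hom[OF g h] C.Ident_hom[OF X(2)]])
    fix A x assume A: "A \<in> Obj E" "x \<in> fobj M A"
    note tx = weighted_cocone_hom[OF universal_cocone[OF t'] A]
    show "Comp C (Comp C h g) (t' A x) = Comp C (Ident C X') (t' A x)"
      using C.Comp_assoc[OF tx g h] ht[OF A] gt[OF A] C.Ident_Comp[OF tx] by simp
  qed
  ultimately show ?thesis using h g unfolding iso_def by blast
qed

lemma K_Obj [simp]: "A \<in> Obj E \<Longrightarrow> is_functor (op E) C N \<Longrightarrow>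
    fobj (K N T) A = Hset (op C) T (fobj N A)"
  using functor_Obj[of "op E" C N A] by (simp add: hom_from_def hom_ftr_def)

lemma K_functor:
  assumes N: "is_functor (op E) C N" and T: "T \<in> Obj C"
  shows "is_functor E Sets (K N T)"
  unfolding hom_from_def
  by (rule comp_functor[OF E.category_axioms functor_op[OF N] Cop.hom_ftr_functor]) (simp add: T)

lemma act_K:
  assumes N: "is_functor (op E) C N" and f: "f \<in> hom E A B"
    and y: "y \<in> Hset (op C) T (fobj N A)"
  shows "act (K N T) f y =
    enc (op C) T (fobj N B) (Comp C (dec (op C) T (fobj N A) y) (farr N f))"
proof -
  have Nf: "farr N f \<in> hom (op C) (fobj N A) (fobj N B)"
    using functor_hom[OF functor_op[OF N] f] .
  show ?thesis
    using Cop.act_hom_ftr[OF Nf y] homD(1)[OF f] by (simp add: hom_from_def act_def)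
qed

definition leg :: "('e, 'a, 'c, 'd) ftr \<Rightarrow> 'c \<Rightarrow> ('e, 'a, 'u) model_arr \<Rightarrow> 'e \<Rightarrow> 'u \<Rightarrow> 'd" where
  "leg N T \<theta> A x = dec (op C) T (fobj N A) (elt \<theta> A x)"

definition transpose ::
  "('e, 'a, 'c, 'd) ftr \<Rightarrow> ('e, 'a, 'u) model \<Rightarrow> 'c \<Rightarrow> ('e \<Rightarrow> 'u \<Rightarrow> 'd) \<Rightarrow> ('e, 'a, 'u) model_arr"
  where "transpose N M T t = set_nt E M (K N T) (\<lambda>A x. enc (op C) T (fobj N A) (t A x))"

lemma leg_cocone:
  assumes N: "is_functor (op E) C N" and T: "T \<in> Obj C" and \<theta>: "\<theta> \<in> hom PSh M (K N T)"
  shows "weighted_cocone N M T (leg N T \<theta>)"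
proof (rule weighted_coconeI[OF T])
  fix A x assume A: "A \<in> Obj E" and x: "x \<in> fobj M A"
  have NA: "fobj N A \<in> Obj C" using functor_Obj[OF N] A by simp
  have e: "elt \<theta> A x \<in> Hset (op C) T (fobj N A)" using elt_in[OF \<theta> A x] A N by simp
  show l: "leg N T \<theta> A x \<in> hom C (fobj N A) T"
    using Cop.dec_hom'[OF _ _ e] T NA by (simp add: leg_def)
  fix f B assume f: "f \<in> hom E A B" and B: "B \<in> Obj E"
  have NB: "fobj N B \<in> Obj C" using functor_Obj[OF N] B by simp
  have Nf: "farr N f \<in> hom C (fobj N B) (fobj N A)" using functor_hom[OF N] f by simp
  show "Comp C (leg N T \<theta> A x) (farr N f) = leg N T \<theta> B (act M f x)"
    using act_K[OF N f e] elt_natural[OF \<theta> f A B x] C.Comp_hom[OF Nf l] T NB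
    by (simp add: leg_def Cop.enc_simps)
qed

lemma transpose_hom:
  assumes N: "is_functor (op E) C N" and M: "is_functor E Sets M" and t: "weighted_cocone N M T t"
  shows "transpose N M T t \<in> hom PSh M (K N T)"
  unfolding transpose_def
proof (rule set_nt_hom[OF E.category_axioms M K_functor[OF N weighted_cocone_Obj[OF t]]])
  fix A x assume A: "A \<in> Obj E" and x: "x \<in> fobj M A"
  have NA: "fobj N A \<in> Obj C" using functor_Obj[OF N] A by simp
  have e: "enc (op C) T (fobj N A) (t A x) \<in> (Hset (op C) T (fobj N A) :: 'u set)"
    using Cop.enc_in' weighted_cocone_hom[OF t A x] by simp
  then show "enc (op C) T (fobj N A) (t A x) \<in> fobj (K N T) A" using A N by simp
  fix f B assume f: "f \<in> hom E A B"
  show "enc (op C) T (fobj N B) (t B (act M f x)) =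
      act (K N T) f (enc (op C) T (fobj N A) (t A x))"
    using act_K[OF N f e] weighted_cocone_hom[OF t A x] weighted_cocone_Obj[OF t] NA weighted_cocone_natural[OF t f x]
    by (simp add: Cop.enc_simps)
qed

lemma leg_transpose:
  assumes N: "is_functor (op E) C N" and t: "weighted_cocone N M T t"
    and A: "A \<in> Obj E" and x: "x \<in> fobj M A"
  shows "leg N T (transpose N M T t) A x = t A x"
  using functor_Obj[OF N] weighted_cocone_hom[OF t A x] weighted_cocone_Obj[OF t] A x
  by (simp add: leg_def transpose_def Cop.enc_simps)

lemma leg_eqI:
  assumes N: "is_functor (op E) C N" and T: "T \<in> Obj C"
    and \<theta>: "\<theta> \<in> hom PSh M (K N T)" and \<theta>': "\<theta>' \<in> hom PSh M (K N T)"
    and eq: "\<And>A x. A \<in> Obj E \<Longrightarrow> x \<in> fobj M A \<Longrightarrow> leg N T \<theta> A x = leg N T \<theta>' A x"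
  shows "\<theta> = \<theta>'"
proof (rule elt_eqI[OF \<theta> \<theta>'])
  fix A x assume A: "A \<in> Obj E" and x: "x \<in> fobj M A"
  have NA: "fobj N A \<in> Obj C" using functor_Obj[OF N] A by simp
  have "elt \<theta> A x \<in> Hset (op C) T (fobj N A)" "elt \<theta>' A x \<in> Hset (op C) T (fobj N A)"
    using elt_in[OF \<theta> A x] elt_in[OF \<theta>' A x] A N by auto
  then show "elt \<theta> A x = elt \<theta>' A x"
    using eq[OF A x] Cop.enc_simps(2) T NA by (metis leg_def op_simps(1))
qed

lemma leg_pre:
  assumes "\<mu> \<in> hom PSh M M'" "A \<in> Obj E" "x \<in> fobj M A"
  shows "leg N T (Comp PSh \<theta> \<mu>) A x = leg N T \<theta> A (elt \<mu> A x)"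
  using elt_Comp[OF assms] by (simp add: leg_def)

lemma
  assumes N: "is_functor (op E) C N" and g: "g \<in> hom C T T'"
  shows post_hom: "hom_from_post E C N g \<in> hom PSh (K N T) (K N T')"
    and leg_post: "\<theta> \<in> hom PSh M (K N T) \<Longrightarrow> A \<in> Obj E \<Longrightarrow> x \<in> fobj M A \<Longrightarrow>
      leg N T' (Comp PSh (hom_from_post E C N g) \<theta>) A x = Comp C g (leg N T \<theta> A x)"
proof -
  note T = C.hom_Obj[OF g]
  have NA: "fobj N A \<in> Obj C" if "A \<in> Obj E" for A using functor_Obj[OF N] that by simp
  have eq: "hom_from_post E C N g = set_nt E (K N T) (K N T')
     (\<lambda>A y. enc (op C) T' (fobj N A) (Comp C g (dec (op C) T (fobj N A) y)))"
    unfolding hom_from_post_def set_nt_def using N by (auto simp: homD[OF g] fun_eq_iff)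
  have d: "dec (op C) T (fobj N A) y \<in> hom C (fobj N A) T"
    if "A \<in> Obj E" "y \<in> Hset (op C) T (fobj N A)" for A and y :: 'u
    using Cop.dec_hom'[OF _ _ that(2)] T(1) NA[OF that(1)] by simp
  have e: "(enc (op C) T' (fobj N A) (Comp C g (dec (op C) T (fobj N A) y)) :: 'u) \<in>
      Hset (op C) T' (fobj N A)" if "A \<in> Obj E" "y \<in> Hset (op C) T (fobj N A)" for A and y :: 'u
    using Cop.enc_in' C.Comp_hom[OF d[OF that] g] by simp
  show hom: "hom_from_post E C N g \<in> hom PSh (K N T) (K N T')"
    unfolding eq
  proof (rule set_nt_hom[OF E.category_axioms K_functor[OF N T(1)] K_functor[OF N T(2)]])
    fix A and y :: 'u assume A: "A \<in> Obj E" and "y \<in> fobj (K N T) A"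
    then have y: "y \<in> Hset (op C) T (fobj N A)" using N by simp
    show "enc (op C) T' (fobj N A) (Comp C g (dec (op C) T (fobj N A) y)) \<in> fobj (K N T') A"
      using A N e[OF A y] by simp
    fix f B assume f: "f \<in> hom E A B" and B: "B \<in> Obj E"
    have Nf: "farr N f \<in> hom C (fobj N B) (fobj N A)" using functor_hom[OF N] f by simp
    show "enc (op C) T' (fobj N B) (Comp C g (dec (op C) T (fobj N B) (act (K N T) f y))) =
      act (K N T') f (enc (op C) T' (fobj N A) (Comp C g (dec (op C) T (fobj N A) y)))"
      using act_K[OF N f y] act_K[OF N f e[OF A y]] C.Comp_assoc[OF Nf d[OF A y] g]
        C.Comp_hom[OF d[OF A y] g] C.Comp_hom[OF Nf d[OF A y]] T NA[OF A] NA[OF B]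
      by (simp add: Cop.enc_simps)
  qed
  assume \<theta>: "\<theta> \<in> hom PSh M (K N T)" and A: "A \<in> Obj E" and x: "x \<in> fobj M A"
  have y: "elt \<theta> A x \<in> Hset (op C) T (fobj N A)" using elt_in[OF \<theta> A x] A N by simp
  show "leg N T' (Comp PSh (hom_from_post E C N g) \<theta>) A x = Comp C g (leg N T \<theta> A x)"
    using elt_Comp[OF \<theta> A x] C.Comp_hom[OF d[OF A y] g] T NA[OF A] A y N
    by (simp add: leg_def eq Cop.enc_simps)
qed

lemma
  assumes \<nu>: "\<nu> \<in> hom (fun_cat (op E) C) N N'" and T: "T \<in> Obj C"
  shows pre_hom: "hom_from_pre E C \<nu> T \<in> hom PSh (K N' T) (K N T)"
    and leg_diagram: "\<theta> \<in> hom PSh M (K N' T) \<Longrightarrow> A \<in> Obj E \<Longrightarrow> x \<in> fobj M A \<Longrightarrow>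
      leg N T (Comp PSh (hom_from_pre E C \<nu> T) \<theta>) A x = Comp C (leg N' T \<theta> A x) (at \<nu> A)"
proof -
  note N = nt_functors(1)[OF \<nu>] and N' = nt_functors(2)[OF \<nu>]
  have NA: "fobj N A \<in> Obj C" "fobj N' A \<in> Obj C" if "A \<in> Obj E" for A
    using functor_Obj[OF N] functor_Obj[OF N'] that by simp_all
  have \<nu>A: "at \<nu> A \<in> hom C (fobj N A) (fobj N' A)" if "A \<in> Obj E" for A
    using at_hom[OF \<nu>] that by simp
  have "hom_from_pre E C (N, N', at \<nu>) T = set_nt E (K N' T) (K N T)
     (\<lambda>A y. enc (op C) T (fobj N A) (Comp C (dec (op C) T (fobj N' A) y) (at \<nu> A)))"
    unfolding hom_from_pre_def set_nt_def using N N'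
    by (auto simp: fun_eq_iff hom_ftr_def homD[OF \<nu>A])
  then have eq: "hom_from_pre E C \<nu> T = set_nt E (K N' T) (K N T)
     (\<lambda>A y. enc (op C) T (fobj N A) (Comp C (dec (op C) T (fobj N' A) y) (at \<nu> A)))"
    using nt_eq[OF \<nu>] by metis
  have d: "dec (op C) T (fobj N' A) y \<in> hom C (fobj N' A) T"
    if "A \<in> Obj E" "y \<in> Hset (op C) T (fobj N' A)" for A and y :: 'u
    using Cop.dec_hom'[OF _ _ that(2)] T NA[OF that(1)] by simp
  have c: "Comp C (dec (op C) T (fobj N' A) y) (at \<nu> A) \<in> hom C (fobj N A) T"
    if "A \<in> Obj E" "y \<in> Hset (op C) T (fobj N' A)" for A and y :: 'u
    using C.Comp_hom[OF \<nu>A[OF that(1)] d[OF that]] .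
  have e: "(enc (op C) T (fobj N A) (Comp C (dec (op C) T (fobj N' A) y) (at \<nu> A)) :: 'u) \<in>
      Hset (op C) T (fobj N A)" if "A \<in> Obj E" "y \<in> Hset (op C) T (fobj N' A)" for A and y :: 'u
    using Cop.enc_in' c[OF that] by simp
  show hom: "hom_from_pre E C \<nu> T \<in> hom PSh (K N' T) (K N T)"
    unfolding eq
  proof (rule set_nt_hom[OF E.category_axioms K_functor[OF N' T] K_functor[OF N T]])
    fix A and y :: 'u assume A: "A \<in> Obj E" and "y \<in> fobj (K N' T) A"
    then have y: "y \<in> Hset (op C) T (fobj N' A)" using N' by simp
    show "enc (op C) T (fobj N A) (Comp C (dec (op C) T (fobj N' A) y) (at \<nu> A)) \<in> fobj (K N T) A"
      using A N e[OF A y] by simp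
    fix f B assume f: "f \<in> hom E A B" and B: "B \<in> Obj E"
    have f': "f \<in> hom (op E) B A" using f by simp
    note Nf = functor_hom[OF N f'] and N'f = functor_hom[OF N' f']
    show "enc (op C) T (fobj N B)
        (Comp C (dec (op C) T (fobj N' B) (act (K N' T) f y)) (at \<nu> B)) =
      act (K N T) f (enc (op C) T (fobj N A) (Comp C (dec (op C) T (fobj N' A) y) (at \<nu> A)))"
      using act_K[OF N' f y] act_K[OF N f e[OF A y]] c[OF A y] C.Comp_hom[OF N'f d[OF A y]]
        C.Comp_assoc[OF Nf \<nu>A[OF A] d[OF A y]] C.Comp_assoc[OF \<nu>A[OF B] N'f d[OF A y]]
        at_natural[OF \<nu> f'] T NA[OF A] NA[OF B]
      by (simp add: Cop.enc_simps)
  qed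
  assume \<theta>: "\<theta> \<in> hom PSh M (K N' T)" and A: "A \<in> Obj E" and x: "x \<in> fobj M A"
  have y: "elt \<theta> A x \<in> Hset (op C) T (fobj N' A)" using elt_in[OF \<theta> A x] A N' by simp
  show "leg N T (Comp PSh (hom_from_pre E C \<nu> T) \<theta>) A x = Comp C (leg N' T \<theta> A x) (at \<nu> A)"
    using elt_Comp[OF \<theta> A x] c[OF A y] T NA[OF A] A y N'
    by (simp add: leg_def eq Cop.enc_simps)
qed

lemma universal_is_tensor:
  assumes N: "is_functor (op E) C N" and M: "is_functor E Sets M" and t: "universal N M X t"
  shows "is_tensor E C N M X (\<lambda>T h. transpose N M T (\<lambda>A x. Comp C h (t A x)))"
proof -
  note t' = universal_cocone[OF t]
  let ?\<phi> = "\<lambda>T h. transpose N M T (\<lambda>A x. Comp C h (t A x))"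
  have \<phi>: "?\<phi> T h \<in> hom PSh M (K N T)" if "h \<in> hom C X T" for T h
    by (rule transpose_hom[OF N M weighted_cocone_post[OF N t' that]])
  have leg: "leg N T (?\<phi> T h) A x = Comp C h (t A x)"
    if "h \<in> hom C X T" "A \<in> Obj E" "x \<in> fobj M A" for T h A x
    by (rule leg_transpose[OF N weighted_cocone_post[OF N t' that(1)] that(2,3)])
  have "bij_betw (?\<phi> T) (hom C X T) (hom PSh M (K N T))" if T: "T \<in> Obj C" for T
  proof (rule bij_betw_imageI)
    show "inj_on (?\<phi> T) (hom C X T)"
    proof (rule inj_onI)
      fix h h' assume h: "h \<in> hom C X T" "h' \<in> hom C X T" and eq: "?\<phi> T h = ?\<phi> T h'"
      show "h = h'"
        by (rule universal_eqI[OF N t h]) (simp add: leg[OF h(1), symmetric] leg[OF h(2), symmetric] eq)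
    qed
    show "?\<phi> T ` hom C X T = hom PSh M (K N T)"
    proof
      show "?\<phi> T ` hom C X T \<subseteq> hom PSh M (K N T)" using \<phi> by blast
      show "hom PSh M (K N T) \<subseteq> ?\<phi> T ` hom C X T"
      proof
        fix \<theta> assume \<theta>: "\<theta> \<in> hom PSh M (K N T)"
        obtain h where h: "h \<in> hom C X T"
          and "\<And>A x. A \<in> Obj E \<Longrightarrow> x \<in> fobj M A \<Longrightarrow> Comp C h (t A x) = leg N T \<theta> A x"
          using universal_arr[OF t leg_cocone[OF N T \<theta>]] by blast
        then have "\<theta> = ?\<phi> T h"
          using leg[OF h] by (intro leg_eqI[OF N T \<theta> \<phi>[OF h]]) simp
        then show "\<theta> \<in> ?\<phi> T ` hom C X T" using h by blast
      qed
    qed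
  qed
  moreover have "?\<phi> T' (Comp C g h) = Comp PSh (hom_from_post E C N g) (?\<phi> T h)"
    if h: "h \<in> hom C X T" and g: "g \<in> hom C T T'" for T T' g h
  proof (rule leg_eqI[OF N _ \<phi>[OF C.Comp_hom[OF h g]] psh.Comp_hom[OF \<phi>[OF h] post_hom[OF N g]]])
    show "T' \<in> Obj C" using C.hom_Obj[OF g] by simp
    fix A x assume A: "A \<in> Obj E" "x \<in> fobj M A"
    show "leg N T' (?\<phi> T' (Comp C g h)) A x =
        leg N T' (Comp PSh (hom_from_post E C N g) (?\<phi> T h)) A x"
      using leg[OF C.Comp_hom[OF h g] A] leg_post[OF N g \<phi>[OF h] A] leg[OF h A]
        C.Comp_assoc[OF weighted_cocone_hom[OF t' A] h g] by simp
  qed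
  ultimately show ?thesis
    using weighted_cocone_Obj[OF t'] unfolding is_tensor_def by blast
qed

lemma
  assumes N: "is_functor (op E) C N" and X: "is_tensor E C N M X \<phi>"
  shows tensor_leg: "h \<in> hom C X T \<Longrightarrow> A \<in> Obj E \<Longrightarrow> x \<in> fobj M A \<Longrightarrow>
      leg N T (\<phi> T h) A x = Comp C h (leg N X (\<phi> X (Ident C X)) A x)"
    and tensor_universal: "universal N M X (leg N X (\<phi> X (Ident C X)))"
    and tensor_hom: "h \<in> hom C X T \<Longrightarrow> \<phi> T h \<in> hom PSh M (K N T)"
proof -
  have XO: "X \<in> Obj C" and bij: "\<And>T. T \<in> Obj C \<Longrightarrow> bij_betw (\<phi> T) (hom C X T) (hom PSh M (K N T))"
    and nat: "\<And>T T' h g. h \<in> hom C X T \<Longrightarrow> g \<in> hom C T T' \<Longrightarrow>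
      \<phi> T' (Comp C g h) = Comp PSh (hom_from_post E C N g) (\<phi> T h)"
    using X C.hom_Obj unfolding is_tensor_def by blast+
  let ?t = "leg N X (\<phi> X (Ident C X))"
  note id = C.Ident_hom[OF XO]
  show \<phi>: "\<phi> T h \<in> hom PSh M (K N T)" if "h \<in> hom C X T" for T h
    using bij_betwE[OF bij] C.hom_Obj[OF that] that by blast
  show leg: "leg N T (\<phi> T h) A x = Comp C h (?t A x)"
    if h: "h \<in> hom C X T" and A: "A \<in> Obj E" "x \<in> fobj M A" for T h A x
    using leg_post[OF N h \<phi>[OF id] A] nat[OF id h] C.Comp_Ident[OF h] by simp
  show "universal N M X ?t"
    unfolding universal_def
  proof (intro conjI allI impI)
    show "weighted_cocone N M X ?t" by (rule leg_cocone[OF N XO \<phi>[OF id]])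
    fix T s assume s: "weighted_cocone N M T s"
    have M: "is_functor E Sets M" using nt_functors(1)[OF \<phi>[OF id]] .
    note T = weighted_cocone_Obj[OF s]
    have "transpose N M T s \<in> \<phi> T ` hom C X T"
      using transpose_hom[OF N M s] bij[OF T] by (simp add: bij_betw_def)
    then obtain h where h: "h \<in> hom C X T" and eq: "transpose N M T s = \<phi> T h" by blast
    show "\<exists>!h. h \<in> hom C X T \<and> (\<forall>A\<in>Obj E. \<forall>x\<in>fobj M A. Comp C h (?t A x) = s A x)"
    proof (rule ex1I[of _ h])
      show "h \<in> hom C X T \<and> (\<forall>A\<in>Obj E. \<forall>x\<in>fobj M A. Comp C h (?t A x) = s A x)"
        using h leg[OF h] leg_transpose[OF N s] eq by simp
      fix h' assume h': "h' \<in> hom C X T \<and> (\<forall>A\<in>Obj E. \<forall>x\<in>fobj M A. Comp C h' (?t A x) = s A x)"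
      then have h'': "h' \<in> hom C X T" by blast
      have "\<phi> T h' = \<phi> T h"
        using h' leg[OF h] leg[OF h''] leg_transpose[OF N s] eq
        by (intro leg_eqI[OF N T \<phi>[OF h''] \<phi>[OF h]]) auto
      then show "h' = h"
        using bij[OF T] h h'' by (auto simp: bij_betw_def dest: inj_onD)
    qed
  qed
qed

text \<open>
  Tensoring with a representable is evaluation, \<open>N \<otimes> Hom(A, -) = N A\<close>: a weighted cocone \<open>s\<close> on
  \<open>Hom(A, -)\<close> is determined by its value at the identity of \<open>A\<close>.
\<close>

lemma universal_representable:
  assumes N: "is_functor (op E) C N" and A: "A \<in> Obj E"
  shows "universal N (hom_ftr E A) (fobj N A) (\<lambda>B y. farr N (dec E A B y))"
proof -
  have hom: "farr N (dec E A B y) \<in> hom C (fobj N B) (fobj N A)"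
    if "B \<in> Obj E" "y \<in> Hset E A B" for B and y :: 'u
    using functor_hom[OF N] E.dec_hom'[OF A that] by simp
  have "weighted_cocone N (hom_ftr E A) (fobj N A) (\<lambda>B y. farr N (dec E A B y))"
  proof (rule weighted_coconeI)
    fix f B B' and y :: 'u
    assume f: "f \<in> hom E B B'" and B: "B \<in> Obj E" "B' \<in> Obj E" and "y \<in> fobj (hom_ftr E A) B"
    then have y: "y \<in> Hset E A B" by simp
    note d = E.dec_hom'[OF A B(1) y]
    show "Comp C (farr N (dec E A B y)) (farr N f) =
        farr N (dec E A B' (act (hom_ftr E A) f y))"
      using functor_Comp[OF N, of f B' B "dec E A B y" A] E.act_hom_ftr[OF f y]
        E.Comp_hom[OF d f] d f A B by (simp add: E.enc_simps)
  qed (use hom functor_Obj[OF N] A in auto)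
  moreover have "\<exists>!h. h \<in> hom C (fobj N A) T \<and>
      (\<forall>B\<in>Obj E. \<forall>y\<in>fobj (hom_ftr E A) B. Comp C h (farr N (dec E A B y)) = s B y)"
    if s: "weighted_cocone N (hom_ftr E A) T s" for T s
  proof (rule ex1I[of _ "s A (E.gen A)"])
    note g = E.gen_in[OF A]
    have id: "Ident PSh (hom_ftr E A) \<in> hom PSh (hom_ftr E A) (hom_ftr E A)"
      using psh.Ident_hom[of "hom_ftr E A"] E.hom_ftr_functor[OF A] by simp
    have "Comp C (s A (E.gen A)) (farr N (dec E A B y)) = s B y"
      if B: "B \<in> Obj E" and y: "y \<in> Hset E A B" for B and y :: 'u
    proof -
      note d = E.dec_hom'[OF A B y]
      have "act (hom_ftr E A) (dec E A B y) (E.gen A) = y"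
        using E.elt_yo[OF B y, of "hom_ftr E A" "E.gen A"]
          E.yo_eq[OF id A] E.hom_ftr_functor[OF A] A B y
          elt_Ident[of A E "E.gen A" "hom_ftr E A"] elt_Ident[of B E y "hom_ftr E A"] g
        by simp
      then show ?thesis using weighted_cocone_natural[OF s d g] by simp
    qed
    then show "s A (E.gen A) \<in> hom C (fobj N A) T \<and> (\<forall>B\<in>Obj E. \<forall>y\<in>fobj (hom_ftr E A) B.
        Comp C (s A (E.gen A)) (farr N (dec E A B y)) = s B y)"
      using weighted_cocone_hom[OF s A g] by simp
    fix h assume h: "h \<in> hom C (fobj N A) T \<and>
      (\<forall>B\<in>Obj E. \<forall>y\<in>fobj (hom_ftr E A) B. Comp C h (farr N (dec E A B y)) = s B y)"
    then have "Comp C h (farr N (dec E A A (E.gen A))) = s A (E.gen A)" using A g by blast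
    moreover have "farr N (dec E A A (E.gen A)) = Ident C (fobj N A)"
      using functor_Ident[OF N] A by (simp add: E.gen_def E.enc_simps E.Ident_hom)
    ultimately show "h = s A (E.gen A)" using C.Comp_Ident h by metis
  qed
  ultimately show ?thesis unfolding universal_def by blast
qed

text \<open>
  Tensor products of the objects of a diagram \<open>D\<close> form a diagram in \<open>C\<close>. The first lemma
  recognises a given pair of maps as this functor; the second constructs the functor.
\<close>

lemma functor_by_universality:
  assumes J: "category J" and D: "is_functor J PSh D" and N: "is_functor (op E) C N"
    and t: "\<And>i. i \<in> Obj J \<Longrightarrow> universal N (fobj D i) (X i) (t i)"
    and ext: "fobj F \<in> extensional (Obj J)" "farr F \<in> extensional (Arr J)"
    and ob: "\<And>i. i \<in> Obj J \<Longrightarrow> fobj F i = X i"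
    and hom: "\<And>u i j. u \<in> hom J i j \<Longrightarrow> farr F u \<in> hom C (X i) (X j)"
    and nat: "\<And>u i j A x. u \<in> hom J i j \<Longrightarrow> A \<in> Obj E \<Longrightarrow> x \<in> fobj (fobj D i) A \<Longrightarrow>
      Comp C (farr F u) (t i A x) = t j A (elt (farr D u) A x)"
  shows "is_functor J C F"
proof -
  interpret J: category J by fact
  note tc = universal_cocone[OF t]
  show ?thesis
  proof (rule is_functorI[OF ext])
    fix i assume i: "i \<in> Obj J"
    show "fobj F i \<in> Obj C" using ob[OF i] weighted_cocone_Obj[OF tc[OF i]] by simp
    have "farr F (Ident J i) = Ident C (X i)"
    proof (rule universal_eqI[OF N t[OF i] hom[OF J.Ident_hom[OF i]]
          C.Ident_hom[OF weighted_cocone_Obj[OF tc[OF i]]]])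
      fix A x assume A: "A \<in> Obj E" "x \<in> fobj (fobj D i) A"
      show "Comp C (farr F (Ident J i)) (t i A x) = Comp C (Ident C (X i)) (t i A x)"
        using nat[OF J.Ident_hom[OF i] A] functor_Ident[OF D i] elt_Ident[OF A]
          C.Ident_Comp[OF weighted_cocone_hom[OF tc[OF i] A]] by simp
    qed
    then show "farr F (Ident J i) = Ident C (fobj F i)" using ob[OF i] by simp
  next
    fix u v i j k assume u: "u \<in> hom J i j" and v: "v \<in> hom J j k"
    note Ob = J.hom_Obj[OF u] J.hom_Obj[OF v]
    show "farr F (Comp J v u) = Comp C (farr F v) (farr F u)"
    proof (rule universal_eqI[OF N t[OF Ob(1)] hom[OF J.Comp_hom[OF u v]]
          C.Comp_hom[OF hom[OF u] hom[OF v]]])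
      fix A x assume A: "A \<in> Obj E" "x \<in> fobj (fobj D i) A"
      note Du = functor_hom[OF D u]
      show "Comp C (farr F (Comp J v u)) (t i A x) =
          Comp C (Comp C (farr F v) (farr F u)) (t i A x)"
        using nat[OF J.Comp_hom[OF u v] A] nat[OF u A] nat[OF v A(1) elt_in[OF Du A]]
          functor_Comp[OF D u v] elt_Comp[OF Du A]
          C.Comp_assoc[OF weighted_cocone_hom[OF tc[OF Ob(1)] A] hom[OF u] hom[OF v]]
        by simp
    qed
  qed (use ob hom J.hom_Obj in \<open>metis\<close>)
qed

lemma ex_functor_by_universality:
  assumes J: "category J" and D: "is_functor J PSh D" and N: "is_functor (op E) C N"
    and t: "\<And>i. i \<in> Obj J \<Longrightarrow> universal N (fobj D i) (X i) (t i)"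
  obtains F where "is_functor J C F" "\<And>i. i \<in> Obj J \<Longrightarrow> fobj F i = X i"
    "\<And>u i j A x. u \<in> hom J i j \<Longrightarrow> A \<in> Obj E \<Longrightarrow> x \<in> fobj (fobj D i) A \<Longrightarrow>
      Comp C (farr F u) (t i A x) = t j A (elt (farr D u) A x)"
proof -
  interpret J: category J by fact
  have "\<exists>h. h \<in> hom C (X (Dom J u)) (X (Cod J u)) \<and>
     (\<forall>A\<in>Obj E. \<forall>x\<in>fobj (fobj D (Dom J u)) A.
        Comp C h (t (Dom J u) A x) = t (Cod J u) A (elt (farr D u) A x))" if "u \<in> Arr J" for u
    using universal_ex1[OF t[OF J.Dom_Obj[OF that]] weighted_cocone_pre[OF universal_cocone[OF t[OF J.Cod_Obj[OF that]]]
      functor_hom[OF D arr_hom[OF that]]]] by blast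
  then obtain H where H: "\<And>u. u \<in> Arr J \<Longrightarrow> H u \<in> hom C (X (Dom J u)) (X (Cod J u)) \<and>
     (\<forall>A\<in>Obj E. \<forall>x\<in>fobj (fobj D (Dom J u)) A.
        Comp C (H u) (t (Dom J u) A x) = t (Cod J u) A (elt (farr D u) A x))"
    by metis
  let ?F = "\<lparr>fobj = (\<lambda>i\<in>Obj J. X i), farr = (\<lambda>u\<in>Arr J. H u)\<rparr>"
  have nat: "Comp C (farr ?F u) (t i A x) = t j A (elt (farr D u) A x)"
    if "u \<in> hom J i j" "A \<in> Obj E" "x \<in> fobj (fobj D i) A" for u i j A x
    using H[OF homD(1)[OF that(1)]] that homD[OF that(1)] by auto
  have "is_functor J C ?F"
    by (rule functor_by_universality[OF J D N t _ _ _ _ nat])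
      (use H in \<open>auto simp: hom_def[of J] extensional_def\<close>)
  then show ?thesis using that[of ?F] nat by simp
qed

end

section \<open>Models of a limit sketch\<close>

text \<open>
  Limits in \<open>Sets\<close> are sets of compatible families. The elements of a limit are found by testing
  against a one-point set, which is small because \<open>'u\<close> is infinite.
\<close>

lemma is_limit_Sets_iff:
  fixes A :: "'u set"
  assumes inf: "infinite (UNIV :: 'u set)" and J: "category J"
  shows "is_limit Sets J D A l \<longleftrightarrow> is_cone Sets J D A l \<and>
    (\<forall>x. (\<forall>i\<in>Obj J. x i \<in> fobj D i) \<and>
         (\<forall>u\<in>Arr J. app (farr D u) (x (Dom J u)) = x (Cod J u)) \<longrightarrow>
       (\<exists>!a. a \<in> A \<and> (\<forall>i\<in>Obj J. app (l i) a = x i)))"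
    (is "_ \<longleftrightarrow> _ \<and> (\<forall>x. ?compat x \<longrightarrow> (\<exists>!a. ?pt x a))")
proof (intro iffI conjI allI impI)
  interpret S: category "Sets :: ('u set, 'u set_arr) cat" by (rule category_Sets)
  assume lim: "is_limit Sets J D A l"
  then show cone: "is_cone Sets J D A l" by (simp add: is_limit_def)
  then have D: "is_functor J Sets D" and l: "\<And>i. i \<in> Obj J \<Longrightarrow> l i \<in> hom Sets A (fobj D i)"
    and sA: "small TYPE('u) A"
    by (auto simp: is_cone_def)
  fix x assume x: "?compat x"
  let ?b = "undefined :: 'u"
  have sb: "small TYPE('u) {?b}"
    using inf by (simp add: small_def finite_lesspoll_infinite)
  define k where "k i = ({?b}, fobj D i, \<lambda>_\<in>{?b}. x i)" for i
  have k: "k i \<in> hom Sets {?b} (fobj D i)" "app (k i) ?b = x i" if "i \<in> Obj J" for i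
    using x functor_Obj[OF D that] that sb unfolding k_def by (auto intro!: Sets_homI)
  have "is_cone Sets J D {?b} k"
    unfolding is_cone_def
  proof (intro conjI ballI)
    fix u assume u: "u \<in> Arr J"
    have ob: "Dom J u \<in> Obj J" "Cod J u \<in> Obj J"
      using u category.Dom_Obj[OF J] category.Cod_Obj[OF J] by auto
    note Du = functor_hom[OF D arr_hom[OF u]]
    show "Comp Sets (farr D u) (k (Dom J u)) = k (Cod J u)"
      by (rule Sets_arr_eqI[OF S.Comp_hom[OF k(1)[OF ob(1)] Du] k(1)[OF ob(2)]])
        (use x u k ob in \<open>simp add: app_Comp[OF k(1)[OF ob(1)]]\<close>)
  qed (use D k sb in auto)
  then have ex1: "\<exists>!h. h \<in> hom Sets {?b} A \<and> (\<forall>i\<in>Obj J. Comp Sets (l i) h = k i)"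
    using lim by (simp add: is_limit_def)
  then obtain h where h: "h \<in> hom Sets {?b} A" "\<And>i. i \<in> Obj J \<Longrightarrow> Comp Sets (l i) h = k i"
    by blast
  show "\<exists>!a. ?pt x a"
  proof (rule ex1I[of _ "app h ?b"])
    show "?pt x (app h ?b)"
      using app_in[OF h(1)] h(2) k(2) app_Comp[OF h(1), symmetric] by simp
    fix a assume a: "?pt x a"
    define h' where "h' = ({?b}, A, \<lambda>_\<in>{?b}. a)"
    have h': "h' \<in> hom Sets {?b} A" "app h' ?b = a"
      using a sA sb unfolding h'_def by (auto intro!: Sets_homI)
    have "Comp Sets (l i) h' = k i" if i: "i \<in> Obj J" for i
      by (rule Sets_arr_eqI[OF S.Comp_hom[OF h'(1) l[OF i]] k(1)[OF i]])
        (use a h'(2) k(2)[OF i] i in \<open>simp add: app_Comp[OF h'(1)]\<close>)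
    then have "h' = h" using ex1 h h' by blast
    then show "a = app h ?b" using h' by simp
  qed
next
  interpret S: category "Sets :: ('u set, 'u set_arr) cat" by (rule category_Sets)
  assume *: "is_cone Sets J D A l \<and> (\<forall>x. ?compat x \<longrightarrow> (\<exists>!a. ?pt x a))"
  then have cone: "is_cone Sets J D A l" and l: "\<And>i. i \<in> Obj J \<Longrightarrow> l i \<in> hom Sets A (fobj D i)"
    and sA: "small TYPE('u) A"
    by (auto simp: is_cone_def)
  have "\<exists>!h. h \<in> hom Sets B A \<and> (\<forall>i\<in>Obj J. Comp Sets (l i) h = k i)"
    if k: "is_cone Sets J D B k" for B k
  proof -
    have kh: "\<And>i. i \<in> Obj J \<Longrightarrow> k i \<in> hom Sets B (fobj D i)" and sB: "small TYPE('u) B"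
      and D: "is_functor J Sets D"
      using k by (auto simp: is_cone_def)
    have ex: "\<exists>!a. ?pt (\<lambda>i. app (k i) b) a" if b: "b \<in> B" for b
    proof -
      have "app (farr D u) (app (k (Dom J u)) b) = app (k (Cod J u)) b" if u: "u \<in> Arr J" for u
      proof -
        have ob: "Dom J u \<in> Obj J" by (rule category.Dom_Obj[OF J u])
        have "Comp Sets (farr D u) (k (Dom J u)) = k (Cod J u)"
          using k u by (simp add: is_cone_def)
        then show ?thesis using app_Comp[OF kh[OF ob] b, of "farr D u"] by simp
      qed
      then show ?thesis
        using *[THEN conjunct2, THEN spec[of _ "\<lambda>i. app (k i) b"]] app_in[OF kh b] by simp
    qed
    define h where "h = (B, A, \<lambda>b\<in>B. THE a. ?pt (\<lambda>i. app (k i) b) a)"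
    have pt: "?pt (\<lambda>i. app (k i) b) (app h b)" if "b \<in> B" for b
      using theI'[OF ex[OF that]] that by (simp add: h_def)
    have h: "h \<in> hom Sets B A"
      using pt sA sB unfolding h_def by (auto intro!: Sets_homI)
    show ?thesis
    proof (rule ex1I[of _ h])
      have "Comp Sets (l i) h = k i" if i: "i \<in> Obj J" for i
        by (rule Sets_arr_eqI[OF S.Comp_hom[OF h l[OF i]] kh[OF i]])
          (use pt i in \<open>simp add: app_Comp[OF h]\<close>)
      then show "h \<in> hom Sets B A \<and> (\<forall>i\<in>Obj J. Comp Sets (l i) h = k i)" using h by blast
      fix h' assume h': "h' \<in> hom Sets B A \<and> (\<forall>i\<in>Obj J. Comp Sets (l i) h' = k i)"
      show "h' = h"
      proof (rule Sets_arr_eqI[OF conjunct1[OF h'] h])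
        fix b assume b: "b \<in> B"
        have "?pt (\<lambda>i. app (k i) b) (app h' b)"
          using app_in[OF conjunct1[OF h'] b] h' app_Comp[OF conjunct1[OF h'] b, symmetric] by simp
        then show "app h' b = app h b" using ex[OF b] pt[OF b] by blast
      qed
    qed
  qed
  then show "is_limit Sets J D A l" using cone by (simp add: is_limit_def)
qed

locale sketch_setting = weighted_setting E C U
  for E :: "('e, 'a) cat" and C :: "('c, 'd) cat" and U :: "'u itself" +
  fixes S :: "('e, 'a, 'u) cone set"
  assumes inf: "infinite (UNIV :: 'u set)"
    and sketch: "limit_sketch E S"
    and realized: "realized E S"
begin

lemma cone_index: "c \<in> S \<Longrightarrow> small_category (cindex c)" "c \<in> S \<Longrightarrow> category (cindex c)"
  and cone: "c \<in> S \<Longrightarrow> is_cone E (cindex c) (cdiagram c) (capex c) (cleg c)"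
  using sketch by (auto simp: limit_sketch_def small_category_def)

lemma Mod_simps [simp]:
  "Comp (Mod E S) = Comp PSh" "Ident (Mod E S) = Ident PSh" "Dom (Mod E S) = fst"
  "Cod (Mod E S) = (\<lambda>\<eta>. fst (snd \<eta>))"
  by (auto simp: Mod_def fun_eq_iff)

lemma Mod_functor: "M \<in> Obj (Mod E S) \<Longrightarrow> is_functor E Sets M"
  by (simp add: Mod_def)

lemma hom_Mod: "\<eta> \<in> hom (Mod E S) M M' \<Longrightarrow> \<eta> \<in> hom PSh M M'"
  by (simp add: Mod_def hom_full_sub split: if_splits)

lemma hom_ModI: "\<eta> \<in> hom PSh M M' \<Longrightarrow> M \<in> Obj (Mod E S) \<Longrightarrow> M' \<in> Obj (Mod E S) \<Longrightarrow>
    \<eta> \<in> hom (Mod E S) M M'"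
  by (simp add: Mod_def hom_full_sub)

lemma category_Mod: "category (Mod E S)"
  unfolding Mod_def by (rule category_full_sub[OF psh.category_axioms])

lemma Mod_small_simps [simp]:
  "Comp (Mod_small E S) = Comp PSh" "Ident (Mod_small E S) = Ident PSh"
  "Dom (Mod_small E S) = fst" "Cod (Mod_small E S) = (\<lambda>\<eta>. fst (snd \<eta>))"
  "Obj (Mod_small E S) = {M \<in> Obj (Mod E S). small_model E S M}"
  by (auto simp: Mod_small_def)

lemma hom_Mod_small: "hom (Mod_small E S) M M' =
    (if small_model E S M \<and> small_model E S M' then hom (Mod E S) M M' else {})"
  by (simp add: Mod_small_def hom_full_sub)

lemma category_Mod_small: "category (Mod_small E S)"
  unfolding Mod_small_def by (rule category_full_sub[OF category_Mod])

lemma Mod_op_functor: "N \<in> Obj (Mod_op E S C) \<Longrightarrow> is_functor (op E) C N"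
  by (simp add: Mod_op_def)

lemma Mod_op_simps [simp]:
  "Comp (Mod_op E S C) = Comp (fun_cat (op E) C)" "Ident (Mod_op E S C) = Ident (fun_cat (op E) C)"
  "Dom (Mod_op E S C) = fst" "Cod (Mod_op E S C) = (\<lambda>\<eta>. fst (snd \<eta>))"
  by (auto simp: Mod_op_def fun_eq_iff)

lemma representable_model: "A \<in> Obj E \<Longrightarrow> hom_ftr E A \<in> Obj (Mod E S)"
  using realized by (simp add: realized_def)

text \<open>
  \<open>Hom(-, T)\<close> turns colimits into limits. As \<open>N\<close> sends the distinguished cones to colimits,
  \<open>Hom(N(-), T)\<close> is therefore a model; this is what makes the universal property of colimits of
  models available for weighted cocones, although these colimits need not be computed pointwise.
\<close>

lemma K_model:
  assumes N: "N \<in> Obj (Mod_op E S C)" and T: "T \<in> Obj C"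
  shows "K N T \<in> Obj (Mod E S)"
proof -
  note N' = Mod_op_functor[OF N]
  note KN = K_functor[OF N' T]
  have "is_limit Sets (cindex c) (comp_ftr (cindex c) (K N T) (cdiagram c))
        (fobj (K N T) (capex c)) (\<lambda>i. farr (K N T) (cleg c i))" if c: "c \<in> S" for c
    unfolding is_limit_Sets_iff[OF inf cone_index(2)[OF c]]
  proof (intro conjI allI impI)
    define J D A l where "J = cindex c" and "D = cdiagram c" and "A = capex c" and "l = cleg c"
    note defs = J_def D_def A_def l_def
    interpret J: category J using cone_index(2)[OF c] by (simp add: J_def)
    note cn = cone[OF c, folded defs]
    then have D: "is_functor J E D" and A: "A \<in> Obj E"
      and l: "\<And>i. i \<in> Obj J \<Longrightarrow> l i \<in> hom E A (fobj D i)"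
      by (auto simp: is_cone_def)
    show "is_cone Sets (cindex c) (comp_ftr (cindex c) (K N T) (cdiagram c))
        (fobj (K N T) (capex c)) (\<lambda>i. farr (K N T) (cleg c i))"
      by (rule functor_cone[OF cone[OF c] KN cone_index(2)[OF c]])
    have col: "is_colimit C (op J) (comp_ftr (op J) N D) (fobj N A) (\<lambda>i. farr N (l i))"
      using N c by (simp add: Mod_op_def defs)
    have NA: "fobj N A \<in> Obj C" using functor_Obj[OF N'] A by simp
    have ND: "fobj N (fobj D i) \<in> Obj C" if "i \<in> Obj J" for i
      using functor_Obj[OF N'] functor_Obj[OF D that] by simp
    fix x assume "(\<forall>i\<in>Obj (cindex c). x i \<in> fobj (comp_ftr (cindex c) (K N T) (cdiagram c)) i) \<and>
      (\<forall>u\<in>Arr (cindex c). app (farr (comp_ftr (cindex c) (K N T) (cdiagram c)) u)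
        (x (Dom (cindex c) u)) = x (Cod (cindex c) u))"
    then have x: "\<And>i. i \<in> Obj J \<Longrightarrow> x i \<in> Hset (op C) T (fobj N (fobj D i))"
      and xu: "\<And>u. u \<in> Arr J \<Longrightarrow> act (K N T) (farr D u) (x (Dom J u)) = x (Cod J u)"
      using functor_Obj[OF D] N' by (auto simp: defs[symmetric] act_def)
    define k where "k i = dec (op C) T (fobj N (fobj D i)) (x i)" for i
    have k: "k i \<in> hom C (fobj N (fobj D i)) T" if "i \<in> Obj J" for i
      using Cop.dec_hom'[OF _ _ x[OF that]] T ND[OF that] by (simp add: k_def)
    have kx: "enc (op C) T (fobj N (fobj D i)) (k i) = x i" if "i \<in> Obj J" for i
      using x[OF that] T ND[OF that] by (simp add: k_def Cop.enc_simps)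
    have "is_cocone C (op J) (comp_ftr (op J) N D) T k"
      unfolding is_cocone_def
    proof (intro conjI ballI)
      show "is_functor (op J) C (comp_ftr (op J) N D)"
        using col by (simp add: is_colimit_def is_cocone_def)
      fix u assume "u \<in> Arr (op J)"
      then have u: "u \<in> Arr J" by simp
      have Du: "farr D u \<in> hom E (fobj D (Dom J u)) (fobj D (Cod J u))"
        by (rule functor_hom[OF D arr_hom[OF u]])
      note ob = J.Dom_Obj[OF u] J.Cod_Obj[OF u]
      have "farr N (farr D u) \<in> hom C (fobj N (fobj D (Cod J u))) (fobj N (fobj D (Dom J u)))"
        using functor_hom[OF N', of "farr D u"] Du by simp
      then have c: "Comp C (k (Dom J u)) (farr N (farr D u)) \<in> hom C (fobj N (fobj D (Cod J u))) T"
        using C.Comp_hom k[OF ob(1)] by blast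
      have "x (Cod J u) = enc (op C) T (fobj N (fobj D (Cod J u)))
          (Comp C (k (Dom J u)) (farr N (farr D u)))"
        using act_K[OF N' Du x[OF ob(1)]] xu[OF u] by (simp add: k_def)
      then have "k (Cod J u) = Comp C (k (Dom J u)) (farr N (farr D u))"
        using c T ND[OF ob(2)] by (simp add: k_def Cop.enc_simps)
      then show "Comp C (k (Cod (op J) u)) (farr (comp_ftr (op J) N D) u) = k (Dom (op J) u)"
        using u by simp
    qed (use k T in auto)
    then have ex: "\<exists>!h. h \<in> hom C (fobj N A) T \<and>
        (\<forall>i\<in>Obj J. Comp C h (farr N (l i)) = k i)"
      using col by (simp add: is_colimit_def)
    have act_l: "act (K N T) (l i) (enc (op C) T (fobj N A) h) = x i \<longleftrightarrow>
        Comp C h (farr N (l i)) = k i"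
      if h: "h \<in> hom C (fobj N A) T" and i: "i \<in> Obj J" for h i
    proof -
      have Nl: "farr N (l i) \<in> hom C (fobj N (fobj D i)) (fobj N A)"
        using functor_hom[OF N', of "l i"] l[OF i] by simp
      have "act (K N T) (l i) (enc (op C) T (fobj N A) h) =
          enc (op C) T (fobj N (fobj D i)) (Comp C h (farr N (l i)))"
        using act_K[OF N' l[OF i] Cop.enc_in'[of h]] h T NA by (simp add: Cop.enc_simps)
      then show ?thesis
        using kx[OF i] C.Comp_hom[OF Nl h] k[OF i] T ND[OF i]
        by (metis Cop.enc_simps(1) op_simps(1,7))
    qed
    obtain h where h: "h \<in> hom C (fobj N A) T" "\<forall>i\<in>Obj J. Comp C h (farr N (l i)) = k i"
      using ex by blast
    have "\<exists>!a. a \<in> fobj (K N T) A \<and> (\<forall>i\<in>Obj J. act (K N T) (l i) a = x i)"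
    proof (rule ex1I[of _ "enc (op C) T (fobj N A) h"])
      show "enc (op C) T (fobj N A) h \<in> fobj (K N T) A \<and>
          (\<forall>i\<in>Obj J. act (K N T) (l i) (enc (op C) T (fobj N A) h) = x i)"
        using act_l[OF h(1)] h N' A Cop.enc_in'[of h] by simp
      fix a assume a: "a \<in> fobj (K N T) A \<and> (\<forall>i\<in>Obj J. act (K N T) (l i) a = x i)"
      let ?h = "dec (op C) T (fobj N A) a"
      have a': "a \<in> Hset (op C) T (fobj N A)" using a A N' by simp
      have "enc (op C) T (fobj N A) ?h = a" using a' T NA by (simp add: Cop.enc_simps)
      moreover have "?h \<in> hom C (fobj N A) T" using Cop.dec_hom'[OF _ _ a'] T NA by simp
      ultimately show "a = enc (op C) T (fobj N A) h"
        using ex h act_l[of ?h] a by metis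
    qed
    then show "\<exists>!a. a \<in> fobj (K N T) (capex c) \<and>
        (\<forall>i\<in>Obj (cindex c). app (farr (K N T) (cleg c i)) a = x i)"
      by (simp add: defs act_def)
  qed
  then show ?thesis using KN by (simp add: Mod_def)
qed

text \<open>
  By the Yoneda lemma, a cocone from the representables \<open>Hom(D i, -)\<close> to a model \<open>M\<close> is a compatible
  family of elements of the sets \<open>M (D i)\<close>. Such families are the elements of \<open>M A\<close>, where \<open>A\<close> is
  the apex, because \<open>M\<close> sends the distinguished cone to a limit.
\<close>

lemma yoneda_sends_cones_to_colimits:
  assumes c: "c \<in> S"
  shows "is_colimit (Mod E S) (op (cindex c)) (comp_ftr (op (cindex c)) (yoneda E) (cdiagram c))
    (hom_ftr E (capex c)) (\<lambda>i. farr (yoneda E) (cleg c i))"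
proof -
  define J D A l where "J = cindex c" and "D = cdiagram c" and "A = capex c" and "l = cleg c"
  note defs = J_def D_def A_def l_def
  interpret J: category J using cone_index(2)[OF c] by (simp add: J_def)
  interpret Mod: category "Mod E S" by (rule category_Mod)
  note cn = cone[OF c, folded defs]
  then have D: "is_functor J E D" and A: "A \<in> Obj E"
    and l: "\<And>i. i \<in> Obj J \<Longrightarrow> l i \<in> hom E A (fobj D i)"
    by (auto simp: is_cone_def)
  have DO: "fobj D i \<in> Obj E" if "i \<in> Obj J" for i using functor_Obj[OF D that] .
  have Y: "is_functor (op E) (Mod E S) (yoneda E)"
    unfolding Mod_def
    using E.yoneda_functor representable_model
    by (simp add: is_functor_full_sub[OF category_op[OF E.category_axioms]] E.category_axioms Mod_def)
  have YD: "is_functor (op J) (Mod E S) (comp_ftr (op J) (yoneda E) D)"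
    using functor_cone_op[OF cn Y J.category_axioms] by (simp add: is_cocone_def)
  have Yl: "farr (yoneda E) (l i) \<in> hom PSh (hom_ftr E (fobj D i)) (hom_ftr E A)"
    if "i \<in> Obj J" for i
    using hom_Mod[OF functor_hom[OF Y, of "l i" "fobj D i" A]] l[OF that] DO[OF that] A by simp
  have "is_colimit (Mod E S) (op J) (comp_ftr (op J) (yoneda E) D) (hom_ftr E A)
     (\<lambda>i. farr (yoneda E) (l i))"
    unfolding is_colimit_def
  proof (intro conjI allI impI)
    show "is_cocone (Mod E S) (op J) (comp_ftr (op J) (yoneda E) D) (hom_ftr E A)
        (\<lambda>i. farr (yoneda E) (l i))"
      using functor_cone_op[OF cn Y J.category_axioms] A by simp
    fix M k assume k: "is_cocone (Mod E S) (op J) (comp_ftr (op J) (yoneda E) D) M k"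
    then have M: "M \<in> Obj (Mod E S)" and kh: "\<And>i. i \<in> Obj J \<Longrightarrow> k i \<in> hom PSh (hom_ftr E (fobj D i)) M"
      and kn: "\<And>u. u \<in> Arr J \<Longrightarrow>
        Comp PSh (k (Dom J u)) (farr (yoneda E) (farr D u)) = k (Cod J u)"
      using DO hom_Mod by (auto simp: is_cocone_def)
    note M' = Mod_functor[OF M]
    define x where "x i = elt (k i) (fobj D i) (E.gen (fobj D i))" for i
    have x: "x i \<in> fobj M (fobj D i)" if "i \<in> Obj J" for i
      unfolding x_def by (rule elt_in[OF kh[OF that] DO[OF that] E.gen_in[OF DO[OF that]]])
    have kx: "k i = E.yo M (fobj D i) (x i)" if "i \<in> Obj J" for i
      unfolding x_def by (rule E.yo_eq[OF kh[OF that] DO[OF that]])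
    have xu: "act M (farr D u) (x (Dom J u)) = x (Cod J u)" if u: "u \<in> Arr J" for u
    proof -
      note ob = J.Dom_Obj[OF u] J.Cod_Obj[OF u]
      note Du = functor_hom[OF D arr_hom[OF u]]
      have "E.yo M (fobj D (Cod J u)) (act M (farr D u) (x (Dom J u))) = k (Cod J u)"
        using E.yo_pre[OF M' Du x[OF ob(1)]] kn[OF u] kx[OF ob(1)] by simp
      then show ?thesis
        using E.yo_gen[OF M' DO[OF ob(2)] act_in[OF M' Du x[OF ob(1)]]] by (simp add: x_def)
    qed
    have lim: "is_limit Sets J (comp_ftr J M D) (fobj M A) (\<lambda>i. farr M (l i))"
      using M c by (simp add: Mod_def defs)
    then have ex: "\<exists>!a. a \<in> fobj M A \<and> (\<forall>i\<in>Obj J. act M (l i) a = x i)"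
      unfolding is_limit_Sets_iff[OF inf J.category_axioms] act_def
      by (rule conjunct2[THEN spec[of _ x], THEN mp]) (use x xu J.Dom_Obj in \<open>auto simp: act_def\<close>)
    have yo_l: "Comp PSh (E.yo M A a) (farr (yoneda E) (l i)) = k i \<longleftrightarrow> act M (l i) a = x i"
      if a: "a \<in> fobj M A" and i: "i \<in> Obj J" for a i
      using E.yo_pre[OF M' l[OF i] a] kx[OF i] x[OF i] act_in[OF M' l[OF i] a]
        E.yo_gen[OF M' DO[OF i]] by metis
    obtain a where a: "a \<in> fobj M A" "\<forall>i\<in>Obj J. act M (l i) a = x i" using ex by blast
    show "\<exists>!h. h \<in> hom (Mod E S) (hom_ftr E A) M \<and>
        (\<forall>i\<in>Obj (op J). Comp (Mod E S) h (farr (yoneda E) (l i)) = k i)"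
    proof (rule ex1I[of _ "E.yo M A a"])
      show "E.yo M A a \<in> hom (Mod E S) (hom_ftr E A) M \<and>
          (\<forall>i\<in>Obj (op J). Comp (Mod E S) (E.yo M A a) (farr (yoneda E) (l i)) = k i)"
        using hom_ModI[OF E.yo_hom[OF M' A a(1)] representable_model[OF A] M] yo_l[OF a(1)] a(2)
        by simp
      fix h assume h: "h \<in> hom (Mod E S) (hom_ftr E A) M \<and>
          (\<forall>i\<in>Obj (op J). Comp (Mod E S) h (farr (yoneda E) (l i)) = k i)"
      then have h': "h \<in> hom PSh (hom_ftr E A) M" using hom_Mod by blast
      let ?a = "elt h A (E.gen A)"
      have "?a \<in> fobj M A" by (rule elt_in[OF h' A E.gen_in[OF A]])
      moreover have "h = E.yo M A ?a" by (rule E.yo_eq[OF h' A])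
      ultimately have "?a = a" using ex a yo_l[of ?a] h by (metis Mod_simps(1) op_simps(1))
      then show "h = E.yo M A a" using \<open>h = E.yo M A ?a\<close> by simp
    qed
  qed
  then show ?thesis by (simp add: defs)
qed

text \<open>
  A representable is the colimit of itself, as a diagram on the category with a single arrow.
\<close>

lemma representable_small:
  assumes A: "A \<in> Obj E"
  shows "hom_ftr E A \<in> Obj (Mod_small E S)"
proof -
  interpret Mod: category "Mod E S" by (rule category_Mod)
  let ?b = "undefined :: 'u"
  let ?H = "hom_ftr E A :: ('e, 'a, 'u) model"
  define J :: "('u, 'u) cat" where
    "J = \<lparr>Obj = {?b}, Arr = {?b}, Dom = \<lambda>_. ?b, Cod = \<lambda>_. ?b, Ident = \<lambda>_. ?b, Comp = \<lambda>_ _. ?b\<rparr>"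
  define D :: "('u, 'u, ('e, 'a, 'u) model, ('e, 'a, 'u) model_arr) ftr" where
    "D = \<lparr>fobj = \<lambda>_\<in>{?b}. ?H, farr = \<lambda>_\<in>{?b}. Ident PSh ?H\<rparr>"
  have H: "?H \<in> Obj (Mod E S)" by (rule representable_model[OF A])
  have id: "Ident PSh ?H \<in> hom (Mod E S) ?H ?H" using Mod.Ident_hom[OF H] by simp
  have idid: "Comp PSh (Ident PSh ?H) (Ident PSh ?H) = Ident PSh ?H"
    using Mod.Comp_Ident[OF id] by simp
  have "small TYPE('u) {?b}" using inf by (simp add: small_def finite_lesspoll_infinite)
  then have J: "small_category J"
    unfolding small_category_def
    by (auto simp: J_def intro!: category.intro) (auto simp: hom_def)
  have J_sel: "Obj J = {?b}" "Arr J = {?b}" "Ident J i = ?b" "Comp J u v = ?b" for i u v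
    by (simp_all add: J_def)
  have J_hom: "u \<in> hom J i j \<longleftrightarrow> u = ?b \<and> i = ?b \<and> j = ?b" for u i j
    by (auto simp: J_def hom_def)
  have D: "is_functor J (Mod E S) D"
    by (rule is_functorI) (auto simp: J_sel J_hom D_def H id idid)
  have col: "is_colimit (Mod E S) J D ?H (\<lambda>_. Ident PSh ?H)"
    unfolding is_colimit_def
  proof (intro conjI allI impI)
    show "is_cocone (Mod E S) J D ?H (\<lambda>_. Ident PSh ?H)"
      using D H id idid by (auto simp: is_cocone_def J_def D_def)
    fix M k assume "is_cocone (Mod E S) J D M k"
    then have k: "k ?b \<in> hom (Mod E S) ?H M" by (auto simp: is_cocone_def J_def D_def)
    show "\<exists>!h. h \<in> hom (Mod E S) ?H M \<and> (\<forall>i\<in>Obj J. Comp (Mod E S) h (Ident PSh ?H) = k i)"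
      by (rule ex1I[of _ "k ?b"]) (use k Mod.Comp_Ident in \<open>auto simp: J_def\<close>)
  qed
  have "small_model E S ?H"
    unfolding small_model_def
    by (rule exI[of _ J], rule exI[of _ D], rule exI[of _ "\<lambda>_. Ident PSh ?H"])
      (use J col A in \<open>auto simp: J_def D_def\<close>)
  then show ?thesis using H by simp
qed

section \<open>Tensor products and colimits of models\<close>

text \<open>
  A weighted cocone on a colimit \<open>M\<close> of models is a compatible family of weighted cocones on the
  objects of the diagram. The first lemma gives uniqueness and the second existence; both are the
  universal property of \<open>M\<close> applied to the model \<open>Hom(N(-), T)\<close>.
\<close>

lemma weighted_cocone_colimit_eqI:
  assumes col: "is_colimit (Mod E S) J D M l" and J: "category J" and N: "N \<in> Obj (Mod_op E S C)"
    and s: "weighted_cocone N M T s" and s': "weighted_cocone N M T s'"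
    and eq: "\<And>i A x. i \<in> Obj J \<Longrightarrow> A \<in> Obj E \<Longrightarrow> x \<in> fobj (fobj D i) A \<Longrightarrow>
      s A (elt (l i) A x) = s' A (elt (l i) A x)"
    and A: "A \<in> Obj E" and x: "x \<in> fobj M A"
  shows "s A x = s' A x"
proof -
  interpret Mod: category "Mod E S" by (rule category_Mod)
  note N' = Mod_op_functor[OF N] and T = weighted_cocone_Obj[OF s]
  have M: "M \<in> Obj (Mod E S)" and c: "is_cocone (Mod E S) J D M l"
    and l: "\<And>i. i \<in> Obj J \<Longrightarrow> l i \<in> hom (Mod E S) (fobj D i) M"
    using col by (auto simp: is_colimit_def is_cocone_def)
  note tr = transpose_hom[OF N' Mod_functor[OF M]]
  note trM = hom_ModI[OF tr M K_model[OF N T]]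
  have cc: "is_cocone (Mod E S) J D (K N T) (\<lambda>i. Comp PSh (transpose N M T s) (l i))"
    unfolding is_cocone_def
  proof (intro conjI ballI)
    show DM: "is_functor J (Mod E S) D" using c by (simp add: is_cocone_def)
    show "K N T \<in> Obj (Mod E S)" by (rule K_model[OF N T])
    fix i assume "i \<in> Obj J"
    then show "Comp PSh (transpose N M T s) (l i) \<in> hom (Mod E S) (fobj D i) (K N T)"
      using Mod.Comp_hom[OF l trM[OF s]] by simp
  next
    fix u assume u: "u \<in> Arr J"
    have DM: "is_functor J (Mod E S) D" and n: "Comp PSh (l (Cod J u)) (farr D u) = l (Dom J u)"
      using c u by (auto simp: is_cocone_def)
    have "Cod J u \<in> Obj J" by (rule category.Cod_Obj[OF J u])
    then show "Comp (Mod E S) (Comp PSh (transpose N M T s) (l (Cod J u))) (farr D u) =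
        Comp PSh (transpose N M T s) (l (Dom J u))"
      using Mod.Comp_assoc[OF functor_hom[OF DM arr_hom[OF u]] l trM[OF s]] n by simp
  qed
  have "Comp PSh (transpose N M T s') (l i) = Comp PSh (transpose N M T s) (l i)"
    if i: "i \<in> Obj J" for i
  proof (rule leg_eqI[OF N' T])
    note li = hom_Mod[OF l[OF i]]
    show "Comp PSh (transpose N M T s') (l i) \<in> hom PSh (fobj D i) (K N T)"
      "Comp PSh (transpose N M T s) (l i) \<in> hom PSh (fobj D i) (K N T)"
      using psh.Comp_hom[OF li tr] s s' by auto
    fix A x assume A: "A \<in> Obj E" "x \<in> fobj (fobj D i) A"
    show "leg N T (Comp PSh (transpose N M T s') (l i)) A x =
        leg N T (Comp PSh (transpose N M T s) (l i)) A x"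
        using eq[OF i A] leg_transpose[OF N' s A(1) elt_in[OF li A]]
          leg_transpose[OF N' s' A(1) elt_in[OF li A]] by (simp add: leg_pre[OF li A])
  qed
  moreover have "\<exists>!h. h \<in> hom (Mod E S) M (K N T) \<and>
      (\<forall>i\<in>Obj J. Comp PSh h (l i) = Comp PSh (transpose N M T s) (l i))"
    using col cc unfolding is_colimit_def Mod_simps by blast
  ultimately have "transpose N M T s = transpose N M T s'"
    using trM[OF s] trM[OF s'] by blast
  then show ?thesis using leg_transpose[OF N' s A x] leg_transpose[OF N' s' A x] by simp
qed

lemma weighted_cocone_colimit_ex:
  assumes col: "is_colimit (Mod E S) J D M l" and J: "category J" and N: "N \<in> Obj (Mod_op E S C)"
    and T: "T \<in> Obj C"
    and s: "\<And>i. i \<in> Obj J \<Longrightarrow> weighted_cocone N (fobj D i) T (s i)"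
    and nat: "\<And>u i j A x. u \<in> hom J i j \<Longrightarrow> i \<in> Obj J \<Longrightarrow> j \<in> Obj J \<Longrightarrow> A \<in> Obj E \<Longrightarrow>
      x \<in> fobj (fobj D i) A \<Longrightarrow> s j A (elt (farr D u) A x) = s i A x"
  obtains t where "weighted_cocone N M T t"
    "\<And>i A x. i \<in> Obj J \<Longrightarrow> A \<in> Obj E \<Longrightarrow> x \<in> fobj (fobj D i) A \<Longrightarrow> t A (elt (l i) A x) = s i A x"
proof -
  interpret J: category J by fact
  interpret Mod: category "Mod E S" by (rule category_Mod)
  note N' = Mod_op_functor[OF N]
  have D: "is_functor J (Mod E S) D"
    and l: "\<And>i. i \<in> Obj J \<Longrightarrow> l i \<in> hom (Mod E S) (fobj D i) M"
    using col by (auto simp: is_colimit_def is_cocone_def)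
  have DO: "fobj D i \<in> Obj (Mod E S)" if "i \<in> Obj J" for i by (rule functor_Obj[OF D that])
  have tr: "transpose N (fobj D i) T (s i) \<in> hom PSh (fobj D i) (K N T)" if i: "i \<in> Obj J" for i
    by (rule transpose_hom[OF N' Mod_functor[OF DO[OF i]] s[OF i]])
  have "is_cocone (Mod E S) J D (K N T) (\<lambda>i. transpose N (fobj D i) T (s i))"
    unfolding is_cocone_def
  proof (intro conjI ballI)
    fix u assume u: "u \<in> Arr J"
    note ob = J.Dom_Obj[OF u] J.Cod_Obj[OF u]
    note Du = hom_Mod[OF functor_hom[OF D arr_hom[OF u]]]
    have "Comp PSh (transpose N (fobj D (Cod J u)) T (s (Cod J u))) (farr D u) =
        transpose N (fobj D (Dom J u)) T (s (Dom J u))"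
    proof (rule leg_eqI[OF N' T psh.Comp_hom[OF Du tr[OF ob(2)]] tr[OF ob(1)]])
      fix A x assume A: "A \<in> Obj E" "x \<in> fobj (fobj D (Dom J u)) A"
      show "leg N T (Comp PSh (transpose N (fobj D (Cod J u)) T (s (Cod J u))) (farr D u)) A x =
          leg N T (transpose N (fobj D (Dom J u)) T (s (Dom J u))) A x"
        using nat[OF arr_hom[OF u] ob A] leg_transpose[OF N' s[OF ob(1)] A]
          leg_transpose[OF N' s[OF ob(2)] A(1) elt_in[OF Du A]] by (simp add: leg_pre[OF Du A])
    qed
    then show "Comp (Mod E S) (transpose N (fobj D (Cod J u)) T (s (Cod J u))) (farr D u) =
        transpose N (fobj D (Dom J u)) T (s (Dom J u))" by simp
  qed (use D K_model[OF N T] hom_ModI[OF tr DO K_model[OF N T]] in auto)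
  then have "\<exists>!h. h \<in> hom (Mod E S) M (K N T) \<and>
      (\<forall>i\<in>Obj J. Comp PSh h (l i) = transpose N (fobj D i) T (s i))"
    using col unfolding is_colimit_def Mod_simps by blast
  then obtain h where h: "h \<in> hom (Mod E S) M (K N T)"
    and hl: "\<And>i. i \<in> Obj J \<Longrightarrow> Comp PSh h (l i) = transpose N (fobj D i) T (s i)"
    by blast
  show ?thesis
  proof (rule that[of "leg N T h"])
    show "weighted_cocone N M T (leg N T h)" by (rule leg_cocone[OF N' T hom_Mod[OF h]])
    fix i A x assume i: "i \<in> Obj J" and A: "A \<in> Obj E" "x \<in> fobj (fobj D i) A"
    show "leg N T h A (elt (l i) A x) = s i A x"
      using leg_pre[OF hom_Mod[OF l[OF i]] A, of N T h] hl[OF i] leg_transpose[OF N' s[OF i] A]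
      by simp
  qed
qed

text \<open>
  The main lemma on tensor products and colimits. Let \<open>M\<close> be a colimit, among all models, of models
  \<open>D i\<close> that have tensor products \<open>F i\<close> with \<open>N\<close>, and let \<open>s\<close> and \<open>k\<close> be corresponding cocones on
  \<open>M\<close> and under \<open>F\<close>. Then \<open>s\<close> is universal if and only if \<open>k\<close> is a colimit, since weighted cocones
  on \<open>M\<close> are the same as cocones under \<open>F\<close>. One direction constructs tensor products, the other
  shows that they preserve colimits.
\<close>

lemma
  assumes col: "is_colimit (Mod E S) J D M l" and J: "category J" and N: "N \<in> Obj (Mod_op E S C)"
    and t: "\<And>i. i \<in> Obj J \<Longrightarrow> universal N (fobj D i) (fobj F i) (t i)"
    and F: "is_functor J C F"
    and nat: "\<And>u i j A x. u \<in> hom J i j \<Longrightarrow> A \<in> Obj E \<Longrightarrow> x \<in> fobj (fobj D i) A \<Longrightarrow>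
      Comp C (farr F u) (t i A x) = t j A (elt (farr D u) A x)"
    and k: "\<And>i. i \<in> Obj J \<Longrightarrow> k i \<in> hom C (fobj F i) X"
    and kt: "\<And>i A x. i \<in> Obj J \<Longrightarrow> A \<in> Obj E \<Longrightarrow> x \<in> fobj (fobj D i) A \<Longrightarrow>
      Comp C (k i) (t i A x) = s A (elt (l i) A x)"
  shows universal_of_colimit: "weighted_cocone N M X s \<Longrightarrow> is_colimit C J F X k \<Longrightarrow> universal N M X s"
    and colimit_of_universal: "universal N M X s \<Longrightarrow> is_colimit C J F X k"
proof -
  interpret J: category J by fact
  note N' = Mod_op_functor[OF N]
  have D: "is_functor J (Mod E S) D"
    and l: "\<And>i. i \<in> Obj J \<Longrightarrow> l i \<in> hom PSh (fobj D i) M"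
    and ln: "\<And>u. u \<in> Arr J \<Longrightarrow> Comp PSh (l (Cod J u)) (farr D u) = l (Dom J u)"
    using col hom_Mod by (auto simp: is_colimit_def is_cocone_def)
  note tc = universal_cocone[OF t]
  have Du: "farr D u \<in> hom PSh (fobj D i) (fobj D j)" if "u \<in> hom J i j" for u i j
    by (rule hom_Mod[OF functor_hom[OF D that]])
  have ln': "elt (l j) A (elt (farr D u) A x) = elt (l i) A x"
    if u: "u \<in> hom J i j" and A: "A \<in> Obj E" "x \<in> fobj (fobj D i) A" for u i j A x
    using ln[OF homD(1)[OF u]] elt_Comp[OF Du[OF u] A, of "l j"] homD[OF u] by simp
  have th: "t i A x \<in> hom C (fobj N A) (fobj F i)"
    if "i \<in> Obj J" "A \<in> Obj E" "x \<in> fobj (fobj D i) A" for i A x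
    by (rule weighted_cocone_hom[OF tc[OF that(1)] that(2,3)])
  have lin: "elt (l i) A x \<in> fobj M A"
    if "i \<in> Obj J" "A \<in> Obj E" "x \<in> fobj (fobj D i) A" for i A x
    by (rule elt_in[OF l[OF that(1)] that(2,3)])
  \<comment> \<open>For a weighted cocone \<open>r\<close> on \<open>M\<close> and the corresponding cocone \<open>g\<close> under \<open>F\<close>, the
    factorizations of \<open>r\<close> through \<open>s\<close> are those of \<open>g\<close> through \<open>k\<close>.\<close>
  have cocone_iff: "h \<in> hom C X T \<Longrightarrow> weighted_cocone N M X s \<Longrightarrow> weighted_cocone N M T r \<Longrightarrow>
      (\<And>i. i \<in> Obj J \<Longrightarrow> g i \<in> hom C (fobj F i) T) \<Longrightarrow>
      (\<And>i A x. i \<in> Obj J \<Longrightarrow> A \<in> Obj E \<Longrightarrow> x \<in> fobj (fobj D i) A \<Longrightarrow>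
         Comp C (g i) (t i A x) = r A (elt (l i) A x)) \<Longrightarrow>
      (\<forall>i\<in>Obj J. Comp C h (k i) = g i) \<longleftrightarrow>
      (\<forall>A\<in>Obj E. \<forall>x\<in>fobj M A. Comp C h (s A x) = r A x)" for T r g h
  proof -
    assume h: "h \<in> hom C X T" and s: "weighted_cocone N M X s" and r: "weighted_cocone N M T r"
      and g: "\<And>i. i \<in> Obj J \<Longrightarrow> g i \<in> hom C (fobj F i) T"
      and gr: "\<And>i A x. i \<in> Obj J \<Longrightarrow> A \<in> Obj E \<Longrightarrow> x \<in> fobj (fobj D i) A \<Longrightarrow>
         Comp C (g i) (t i A x) = r A (elt (l i) A x)"
    have hk: "Comp C (Comp C h (k i)) (t i A x) = Comp C h (s A (elt (l i) A x))"
      if "i \<in> Obj J" "A \<in> Obj E" "x \<in> fobj (fobj D i) A" for i A x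
      using C.Comp_assoc[OF th[OF that] k[OF that(1)] h] kt[OF that] by simp
    show "(\<forall>i\<in>Obj J. Comp C h (k i) = g i) \<longleftrightarrow>
        (\<forall>A\<in>Obj E. \<forall>x\<in>fobj M A. Comp C h (s A x) = r A x)"
    proof (intro iffI ballI)
      fix A x assume *: "\<forall>i\<in>Obj J. Comp C h (k i) = g i" and A: "A \<in> Obj E" "x \<in> fobj M A"
      show "Comp C h (s A x) = r A x"
      proof (rule weighted_cocone_colimit_eqI[OF col J N weighted_cocone_post[OF N' s h] r _ A])
        fix i A x assume i: "i \<in> Obj J" and A: "A \<in> Obj E" "x \<in> fobj (fobj D i) A"
        show "Comp C h (s A (elt (l i) A x)) = r A (elt (l i) A x)"
          using hk[OF i A] gr[OF i A] * i by simp
      qed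
    next
      fix i assume *: "\<forall>A\<in>Obj E. \<forall>x\<in>fobj M A. Comp C h (s A x) = r A x" and i: "i \<in> Obj J"
      show "Comp C h (k i) = g i"
        by (rule universal_eqI[OF N' t[OF i] C.Comp_hom[OF k[OF i] h] g[OF i]])
          (use * hk[OF i] gr[OF i] lin[OF i] in simp)
    qed
  qed
  show "universal N M X s" if s: "weighted_cocone N M X s" and F_col: "is_colimit C J F X k"
    unfolding universal_def
  proof (intro conjI allI impI)
    show "weighted_cocone N M X s" by fact
    fix T r assume r: "weighted_cocone N M T r"
    have "\<exists>g. g \<in> hom C (fobj F i) T \<and> (\<forall>A\<in>Obj E. \<forall>x\<in>fobj (fobj D i) A.
        Comp C g (t i A x) = r A (elt (l i) A x))" if i: "i \<in> Obj J" for i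
      using universal_ex1[OF t[OF i] weighted_cocone_pre[OF r l[OF i]]] by blast
    then obtain g where g: "\<And>i. i \<in> Obj J \<Longrightarrow> g i \<in> hom C (fobj F i) T"
      and gr: "\<And>i A x. i \<in> Obj J \<Longrightarrow> A \<in> Obj E \<Longrightarrow> x \<in> fobj (fobj D i) A \<Longrightarrow>
        Comp C (g i) (t i A x) = r A (elt (l i) A x)"
      by metis
    have "Comp C (g (Cod J u)) (farr F u) = g (Dom J u)" if u: "u \<in> Arr J" for u
    proof -
      note ob = J.Dom_Obj[OF u] J.Cod_Obj[OF u] and u' = arr_hom[OF u]
      note Fu = functor_hom[OF F u']
      show ?thesis
      proof (rule universal_eqI[OF N' t[OF ob(1)] C.Comp_hom[OF Fu g[OF ob(2)]] g[OF ob(1)]])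
        fix A x assume A: "A \<in> Obj E" "x \<in> fobj (fobj D (Dom J u)) A"
        show "Comp C (Comp C (g (Cod J u)) (farr F u)) (t (Dom J u) A x) =
            Comp C (g (Dom J u)) (t (Dom J u) A x)"
          using C.Comp_assoc[OF th[OF ob(1) A] Fu g[OF ob(2)]] nat[OF u' A]
            gr[OF ob(2) A(1) elt_in[OF Du[OF u'] A]] gr[OF ob(1) A] ln'[OF u' A] by simp
      qed
    qed
    then have "is_cocone C J F T g"
      using F g weighted_cocone_Obj[OF r] by (auto simp: is_cocone_def)
    then have "\<exists>!h. h \<in> hom C X T \<and> (\<forall>i\<in>Obj J. Comp C h (k i) = g i)"
      using F_col by (simp add: is_colimit_def)
    then show "\<exists>!h. h \<in> hom C X T \<and> (\<forall>A\<in>Obj E. \<forall>x\<in>fobj M A. Comp C h (s A x) = r A x)"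
      using cocone_iff[OF _ s r g gr] by (simp cong: conj_cong)
  qed
  show "is_colimit C J F X k" if s: "universal N M X s"
    unfolding is_colimit_def
  proof (intro conjI allI impI)
    note sc = universal_cocone[OF s]
    have "Comp C (k (Cod J u)) (farr F u) = k (Dom J u)" if u: "u \<in> Arr J" for u
    proof -
      note ob = J.Dom_Obj[OF u] J.Cod_Obj[OF u] and u' = arr_hom[OF u]
      note Fu = functor_hom[OF F u']
      show ?thesis
      proof (rule universal_eqI[OF N' t[OF ob(1)] C.Comp_hom[OF Fu k[OF ob(2)]] k[OF ob(1)]])
        fix A x assume A: "A \<in> Obj E" "x \<in> fobj (fobj D (Dom J u)) A"
        show "Comp C (Comp C (k (Cod J u)) (farr F u)) (t (Dom J u) A x) =
            Comp C (k (Dom J u)) (t (Dom J u) A x)"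
          using C.Comp_assoc[OF th[OF ob(1) A] Fu k[OF ob(2)]] nat[OF u' A]
            kt[OF ob(2) A(1) elt_in[OF Du[OF u'] A]] kt[OF ob(1) A] ln'[OF u' A] by simp
      qed
    qed
    then show "is_cocone C J F X k" using F k weighted_cocone_Obj[OF sc] by (auto simp: is_cocone_def)
    fix T g assume g: "is_cocone C J F T g"
    then have gh: "\<And>i. i \<in> Obj J \<Longrightarrow> g i \<in> hom C (fobj F i) T" and T: "T \<in> Obj C"
      and gn: "\<And>u. u \<in> Arr J \<Longrightarrow> Comp C (g (Cod J u)) (farr F u) = g (Dom J u)"
      by (auto simp: is_cocone_def)
    have w: "weighted_cocone N (fobj D i) T (\<lambda>A x. Comp C (g i) (t i A x))" if "i \<in> Obj J" for i
      by (rule weighted_cocone_post[OF N' tc[OF that] gh[OF that]])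
    have wn: "Comp C (g j) (t j A (elt (farr D u) A x)) = Comp C (g i) (t i A x)"
      if u: "u \<in> hom J i j" and i: "i \<in> Obj J" and j: "j \<in> Obj J"
        and A: "A \<in> Obj E" "x \<in> fobj (fobj D i) A" for u i j A x
      using C.Comp_assoc[OF th[OF i A] functor_hom[OF F u] gh[OF j]] nat[OF u A]
        gn[OF homD(1)[OF u]] homD[OF u] by simp
    obtain r where r: "weighted_cocone N M T r"
      and rl: "\<And>i A x. i \<in> Obj J \<Longrightarrow> A \<in> Obj E \<Longrightarrow> x \<in> fobj (fobj D i) A \<Longrightarrow>
        r A (elt (l i) A x) = Comp C (g i) (t i A x)"
      using weighted_cocone_colimit_ex[OF col J N T w wn] by blast
    have "\<exists>!h. h \<in> hom C X T \<and> (\<forall>A\<in>Obj E. \<forall>x\<in>fobj M A. Comp C h (s A x) = r A x)"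
      by (rule universal_ex1[OF s r])
    then show "\<exists>!h. h \<in> hom C X T \<and> (\<forall>i\<in>Obj J. Comp C h (k i) = g i)"
      using cocone_iff[OF _ sc r gh rl[symmetric]] by (simp cong: conj_cong)
  qed
qed

text \<open>
  A small model is a colimit of representables \<open>Hom(a i, -)\<close>, so the colimit in \<open>C\<close> of the objects
  \<open>N (a i)\<close> is a tensor product.
\<close>

lemma ex_universal:
  assumes cc: "cocomplete TYPE('u) C" and N: "N \<in> Obj (Mod_op E S C)" and M: "small_model E S M"
  obtains X t where "universal N M X t"
proof -
  note N' = Mod_op_functor[OF N]
  obtain J :: "('u, 'u) cat" and D l where J: "small_category J"
    and rep: "\<forall>i\<in>Obj J. \<exists>A\<in>Obj E. fobj D i = hom_ftr E A"
    and col: "is_colimit (Mod E S) J D M l"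
    using M unfolding small_model_def by blast
  have J': "category J" using J by (simp add: small_category_def)
  interpret J: category J by fact
  obtain a where a: "\<And>i. i \<in> Obj J \<Longrightarrow> a i \<in> Obj E" "\<And>i. i \<in> Obj J \<Longrightarrow> fobj D i = hom_ftr E (a i)"
    using rep by metis
  have D: "is_functor J (Mod E S) D"
    and l: "\<And>i. i \<in> Obj J \<Longrightarrow> l i \<in> hom PSh (fobj D i) M"
    using col hom_Mod by (auto simp: is_colimit_def is_cocone_def)
  have D': "is_functor J PSh D"
    using D J' unfolding Mod_def by (simp add: is_functor_full_sub)
  have t: "universal N (fobj D i) (fobj N (a i)) (\<lambda>B y. farr N (dec E (a i) B y))"
    if "i \<in> Obj J" for i
    using universal_representable[OF N' a(1)[OF that]] a(2)[OF that] by simp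
  obtain F where F: "is_functor J C F" and FO: "\<And>i. i \<in> Obj J \<Longrightarrow> fobj F i = fobj N (a i)"
    and nat: "\<And>u i j A x. u \<in> hom J i j \<Longrightarrow> A \<in> Obj E \<Longrightarrow> x \<in> fobj (fobj D i) A \<Longrightarrow>
      Comp C (farr F u) (farr N (dec E (a i) A x)) = farr N (dec E (a j) A (elt (farr D u) A x))"
    using ex_functor_by_universality[OF J' D' N' t] by blast
  have t': "universal N (fobj D i) (fobj F i) (\<lambda>B y. farr N (dec E (a i) B y))"
    if "i \<in> Obj J" for i
    using t[OF that] FO[OF that] by simp
  obtain X k where F_col: "is_colimit C J F X k"
    using cc J F unfolding cocomplete_def by blast
  then have k: "\<And>i. i \<in> Obj J \<Longrightarrow> k i \<in> hom C (fobj F i) X" and X: "X \<in> Obj C"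
    and kn: "\<And>u. u \<in> Arr J \<Longrightarrow> Comp C (k (Cod J u)) (farr F u) = k (Dom J u)"
    by (auto simp: is_colimit_def is_cocone_def)
  have w: "weighted_cocone N (fobj D i) X (\<lambda>A x. Comp C (k i) (farr N (dec E (a i) A x)))"
    if "i \<in> Obj J" for i
    by (rule weighted_cocone_post[OF N' universal_cocone[OF t'[OF that]] k[OF that]])
  have wn: "Comp C (k j) (farr N (dec E (a j) A (elt (farr D u) A x))) =
      Comp C (k i) (farr N (dec E (a i) A x))"
    if u: "u \<in> hom J i j" and i: "i \<in> Obj J" and j: "j \<in> Obj J"
      and A: "A \<in> Obj E" "x \<in> fobj (fobj D i) A" for u i j A x
    using C.Comp_assoc[OF weighted_cocone_hom[OF universal_cocone[OF t'[OF i]] A] functor_hom[OF F u] k[OF j]]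
      nat[OF u A] kn[OF homD(1)[OF u]] homD[OF u] by simp
  obtain s where s: "weighted_cocone N M X s"
    and sl: "\<And>i A x. i \<in> Obj J \<Longrightarrow> A \<in> Obj E \<Longrightarrow> x \<in> fobj (fobj D i) A \<Longrightarrow>
      s A (elt (l i) A x) = Comp C (k i) (farr N (dec E (a i) A x))"
    using weighted_cocone_colimit_ex[OF col J' N X w wn] by blast
  show ?thesis
    by (rule that, rule universal_of_colimit[OF col J' N t' F nat k sl[symmetric] s F_col])
qed

end

section \<open>Weakly cocontinuous functors\<close>

context sketch_setting
begin

lemma Hom_wc_simps [simp]:
  "Comp (Hom_wc E S C) = Comp (fun_cat (Mod_small E S) C)"
  "Ident (Hom_wc E S C) = Ident (fun_cat (Mod_small E S) C)"
  "Dom (Hom_wc E S C) = fst" "Cod (Hom_wc E S C) = (\<lambda>\<eta>. fst (snd \<eta>))"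
  "Obj (Hom_wc E S C) = {F. is_functor (Mod_small E S) C F \<and> weakly_cocontinuous E S C F}"
  by (auto simp: Hom_wc_def fun_eq_iff)

lemma category_Hom_wc: "category (Hom_wc E S C)"
  unfolding Hom_wc_def
  by (intro category_full_sub category_fun_cat category_Mod_small C.category_axioms)

lemma hom_Hom_wc: "\<eta> \<in> hom (Hom_wc E S C) F F' \<longleftrightarrow> \<eta> \<in> hom (fun_cat (Mod_small E S) C) F F' \<and>
    weakly_cocontinuous E S C F \<and> weakly_cocontinuous E S C F'"
  by (auto simp: Hom_wc_def hom_full_sub)

lemma category_Mod_op: "category (Mod_op E S C)"
  unfolding Mod_op_def
  by (intro category_full_sub category_fun_cat category_op E.category_axioms C.category_axioms)

lemma hom_Mod_op: "\<eta> \<in> hom (Mod_op E S C) N N' \<Longrightarrow> \<eta> \<in> hom (fun_cat (op E) C) N N'"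
  by (simp add: Mod_op_def hom_full_sub split: if_splits)

lemma hom_Mod_opI: "\<eta> \<in> hom (fun_cat (op E) C) N N' \<Longrightarrow> N \<in> Obj (Mod_op E S C) \<Longrightarrow>
    N' \<in> Obj (Mod_op E S C) \<Longrightarrow> \<eta> \<in> hom (Mod_op E S C) N N'"
  by (simp add: Mod_op_def hom_full_sub)

lemma Mod_small_functor: "M \<in> Obj (Mod_small E S) \<Longrightarrow> is_functor E Sets M"
  by (simp add: Mod_functor)

lemma hom_Mod_smallD: "\<mu> \<in> hom (Mod_small E S) M M' \<Longrightarrow> \<mu> \<in> hom PSh M M'"
  by (auto simp: hom_Mod_small hom_Mod split: if_splits)

lemma hom_Mod_smallI: "\<mu> \<in> hom PSh M M' \<Longrightarrow> M \<in> Obj (Mod_small E S) \<Longrightarrow>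
    M' \<in> Obj (Mod_small E S) \<Longrightarrow> \<mu> \<in> hom (Mod_small E S) M M'"
  by (simp add: hom_Mod_small hom_ModI)

lemma yo_hom_small:
  assumes "M \<in> Obj (Mod_small E S)" "A \<in> Obj E" "x \<in> fobj M A"
  shows "E.yo M A x \<in> hom (Mod_small E S) (hom_ftr E A) M"
  using assms Mod_small_functor
  by (intro hom_Mod_smallI E.yo_hom representable_small) auto

lemma yoneda_functor_small: "is_functor (op E) (Mod_small E S) (yoneda E)"
  unfolding Mod_small_def Mod_def
  using E.yoneda_functor representable_small E.category_axioms
  by (simp add: is_functor_full_sub Mod_def)

abbreviation R :: "(('e, 'a, 'u) model, ('e, 'a, 'u) model_arr, 'c, 'd) ftr \<Rightarrow> ('e, 'a, 'c, 'd) ftr"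
  where "R F \<equiv> comp_ftr (op E) F (yoneda E)"

lemma R_functor: "is_functor (Mod_small E S) C F \<Longrightarrow> is_functor (op E) C (R F)"
  by (rule comp_functor[OF category_op[OF E.category_axioms] yoneda_functor_small])

text \<open>
  The Yoneda functor sends distinguished cones to colimits in \<open>Mod\<close> that lie in \<open>Mod_small\<close>, and
  these are among the colimits that a weakly cocontinuous functor must preserve.
\<close>

lemma R_model:
  assumes F: "is_functor (Mod_small E S) C F" and wc: "weakly_cocontinuous E S C F"
  shows "R F \<in> Obj (Mod_op E S C)"
proof -
  have "is_colimit C (op (cindex c)) (comp_ftr (op (cindex c)) (R F) (cdiagram c))
      (fobj (R F) (capex c)) (\<lambda>i. farr (R F) (cleg c i))" if c: "c \<in> S" for c
  proof -
    note J = cone_index(2)[OF c] and sJ = cone_index(1)[OF c]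
    have D: "is_functor (cindex c) E (cdiagram c)" and A: "capex c \<in> Obj E"
      and l: "\<And>i. i \<in> Obj (cindex c) \<Longrightarrow> cleg c i \<in> Arr E"
      using cone[OF c] by (auto simp: is_cone_def hom_def)
    note col = yoneda_sends_cones_to_colimits[OF c]
    have "is_colimit (Mod_small E S) (op (cindex c)) (comp_ftr (op (cindex c)) (yoneda E) (cdiagram c))
        (hom_ftr E (capex c)) (\<lambda>i. farr (yoneda E) (cleg c i))"
      unfolding Mod_small_def
      by (rule is_colimit_full_sub[OF col category_op[OF J]])
        (use representable_small A functor_Obj[OF D] in auto)
    then have "is_colimit C (op (cindex c))
        (comp_ftr (op (cindex c)) F (comp_ftr (op (cindex c)) (yoneda E) (cdiagram c)))
        (fobj F (hom_ftr E (capex c))) (\<lambda>i. farr F (farr (yoneda E) (cleg c i)))"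
      using wc col sJ unfolding weakly_cocontinuous_def by (metis small_category_op)
    moreover have "fobj (R F) (capex c) = fobj F (hom_ftr E (capex c))"
      using A by simp
    ultimately show ?thesis
      unfolding comp_ftr_assoc[OF category_op[OF J] functor_op_op[OF D]]
      by (auto intro!: is_colimit_cong[where l = "\<lambda>i. farr F (farr (yoneda E) (cleg c i))"]
        simp: l J)
  qed
  then show ?thesis using R_functor[OF F] by (simp add: Mod_op_def)
qed

lemma restrict_functor: "is_functor (Hom_wc E S C) (Mod_op E S C) (restrict_yoneda E S C)"
  unfolding restrict_yoneda_def
  using R_model unfolding Hom_wc_def Mod_op_def
  by (intro precomp_functor[OF category_op[OF E.category_axioms] category_Mod_small
        C.category_axioms yoneda_functor_small]) auto

lemma restrict_Obj: "F \<in> Obj (Hom_wc E S C) \<Longrightarrow> fobj (restrict_yoneda E S C) F = R F"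
  unfolding restrict_yoneda_def by (rule precomp_Obj)

lemma at_restrict: "\<eta> \<in> hom (Hom_wc E S C) F F' \<Longrightarrow> A \<in> Obj E \<Longrightarrow>
    at (farr (restrict_yoneda E S C) \<eta>) A = at \<eta> (hom_ftr E A)"
  unfolding restrict_yoneda_def by (drule homD(1)) (simp add: precomp_arr)

lemma universal_cong:
  assumes "universal N M X t" and "\<And>A x. A \<in> Obj E \<Longrightarrow> x \<in> fobj M A \<Longrightarrow> t A x = t' A x"
    and M: "is_functor E Sets M"
  shows "universal N M X t'"
proof -
  have "act M f x \<in> fobj M (Cod E f)" if "f \<in> Arr E" "x \<in> fobj M (Dom E f)" for f x
    by (rule act_in[OF M arr_hom[OF that(1)] that(2)])
  then have "weighted_cocone N M T t = weighted_cocone N M T t'" for T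
    using assms(2) E.Dom_Obj E.Cod_Obj by (simp add: weighted_cocone_def)
  then show ?thesis using assms(1,2) by (simp add: universal_def)
qed

text \<open>
  Every functor \<open>F\<close> on small models yields a weighted cocone to \<open>F M\<close>, for the restriction of \<open>F\<close>
  along Yoneda: an element \<open>x \<in> M A\<close> is an arrow \<open>Hom(A, -) \<rightarrow> M\<close>, to which \<open>F\<close> applies.
\<close>

lemma yo_weighted_cocone:
  assumes F: "is_functor (Mod_small E S) C F" and M: "M \<in> Obj (Mod_small E S)"
  shows "weighted_cocone (R F) M (fobj F M) (\<lambda>A x. farr F (E.yo M A x))"
proof (rule weighted_coconeI)
  show "fobj F M \<in> Obj C" by (rule functor_Obj[OF F M])
next
  fix A x assume "A \<in> Obj E" "x \<in> fobj M A"
  then show "farr F (E.yo M A x) \<in> hom C (fobj (R F) A) (fobj F M)"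
    using functor_hom[OF F yo_hom_small[OF M]] by simp
next
  fix f A B x assume f: "f \<in> hom E A B" and A: "A \<in> Obj E" "B \<in> Obj E" and x: "x \<in> fobj M A"
  have Yf: "farr (yoneda E) f \<in> hom (Mod_small E S) (hom_ftr E B) (hom_ftr E A)"
    using functor_hom[OF yoneda_functor_small, of f B A] f A by simp
  show "Comp C (farr F (E.yo M A x)) (farr (R F) f) = farr F (E.yo M B (act M f x))"
    using functor_Comp[OF F Yf yo_hom_small[OF M A(1) x]] E.yo_pre[OF Mod_small_functor[OF M] f x]
      homD(1)[OF f] by simp
qed

text \<open>
  For weakly cocontinuous \<open>F\<close> this weighted cocone is universal, so that \<open>F M\<close> is a tensor product
  of \<open>F \<circ> Y\<close> and \<open>M\<close>. It is so for representable \<open>M\<close>, where it is evaluation, and \<open>F\<close> preserves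
  the presentation of a small model as a colimit of representables: this is a colimit in \<open>Mod\<close>
  by definition, and then also in the full subcategory \<open>Mod_small\<close>.
\<close>

lemma weakly_cocontinuous_universal:
  assumes F: "is_functor (Mod_small E S) C F" and wc: "weakly_cocontinuous E S C F"
    and M: "M \<in> Obj (Mod_small E S)"
  shows "universal (R F) M (fobj F M) (\<lambda>A x. farr F (E.yo M A x))"
proof -
  obtain J :: "('u, 'u) cat" and D l where sJ: "small_category J"
    and rep: "\<forall>i\<in>Obj J. \<exists>A\<in>Obj E. fobj D i = hom_ftr E A"
    and col: "is_colimit (Mod E S) J D M l"
    using M by (auto simp: small_model_def)
  have J: "category J" using sJ by (simp add: small_category_def)
  interpret J: category J by fact
  have DO: "fobj D i \<in> Obj (Mod_small E S)" if "i \<in> Obj J" for i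
    using rep that representable_small by metis
  have col': "is_colimit (Mod_small E S) J D M l"
    unfolding Mod_small_def by (rule is_colimit_full_sub[OF col J]) (use DO M in auto)
  then have D: "is_functor J (Mod_small E S) D"
    and l: "\<And>i. i \<in> Obj J \<Longrightarrow> l i \<in> hom (Mod_small E S) (fobj D i) M"
    by (auto simp: is_colimit_def is_cocone_def)
  have F_post: "Comp C (farr F \<mu>) (farr F (E.yo L A x)) = farr F (E.yo L' A (elt \<mu> A x))"
    if \<mu>: "\<mu> \<in> hom (Mod_small E S) L L'" and L: "L \<in> Obj (Mod_small E S)"
      and A: "A \<in> Obj E" "x \<in> fobj L A" for \<mu> L L' A x
    using functor_Comp[OF F yo_hom_small[OF L A] \<mu>] E.yo_post[OF hom_Mod_smallD[OF \<mu>] A] by simp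
  show ?thesis
  proof (rule universal_of_colimit[OF col J R_model[OF F wc]])
    show "weighted_cocone (R F) M (fobj F M) (\<lambda>A x. farr F (E.yo M A x))"
      by (rule yo_weighted_cocone[OF F M])
    show "is_functor J C (comp_ftr J F D)" by (rule comp_functor[OF J D F])
    show "is_colimit C J (comp_ftr J F D) (fobj F M) (\<lambda>i. farr F (l i))"
      using wc sJ col col' unfolding weakly_cocontinuous_def by blast
    fix i assume i: "i \<in> Obj J"
    show "farr F (l i) \<in> hom C (fobj (comp_ftr J F D) i) (fobj F M)"
      using functor_hom[OF F l[OF i]] i by simp
    obtain B where B: "B \<in> Obj E" "fobj D i = hom_ftr E B" using rep i by blast
    have "universal (R F) (hom_ftr E B) (fobj (R F) B) (\<lambda>A y. farr F (E.yo (hom_ftr E B) A y))"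
    proof (rule universal_cong[OF universal_representable[OF R_functor[OF F] B(1)]])
      fix A and y :: 'u assume A: "A \<in> Obj E" "y \<in> fobj (hom_ftr E B) A"
      then have y: "y \<in> Hset E B A" by simp
      note d = E.dec_hom'[OF B(1) A(1) y]
      show "farr (R F) (dec E B A y) = farr F (E.yo (hom_ftr E B) A y)"
        using E.yoneda_arr[OF d] homD(1)[OF d] A B y by (simp add: E.enc_simps)
    qed (rule E.hom_ftr_functor[OF B(1)])
    then show "universal (R F) (fobj D i) (fobj (comp_ftr J F D) i)
        (\<lambda>A y. farr F (E.yo (fobj D i) A y))"
      using B i by simp
    fix A x assume A: "A \<in> Obj E" "x \<in> fobj (fobj D i) A"
    show "Comp C (farr F (l i)) (farr F (E.yo (fobj D i) A x)) = farr F (E.yo M A (elt (l i) A x))"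
      by (rule F_post[OF l[OF i] DO[OF i] A])
  next
    fix u i j A x assume u: "u \<in> hom J i j" and A: "A \<in> Obj E" "x \<in> fobj (fobj D i) A"
    show "Comp C (farr (comp_ftr J F D) u) (farr F (E.yo (fobj D i) A x)) =
        farr F (E.yo (fobj D j) A (elt (farr D u) A x))"
      using F_post[OF functor_hom[OF D u] DO[OF J.hom_Obj(1)[OF u]] A] homD(1)[OF u] by simp
  qed
qed

end

section \<open>The functor of tensor products\<close>

locale tensor_setting = sketch_setting E C U S
  for E :: "('e, 'a) cat" and C :: "('c, 'd) cat" and U :: "'u itself"
    and S :: "('e, 'a, 'u) cone set" +
  fixes P :: "('e, 'a, 'c, 'd) ftr \<Rightarrow> ('e, 'a, 'u) model \<Rightarrow> 'c"
    and \<phi> :: "('e, 'a, 'c, 'd) ftr \<Rightarrow> ('e, 'a, 'u) model \<Rightarrow> 'c \<Rightarrow> 'd \<Rightarrow> ('e, 'a, 'u) model_arr"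
  assumes tensors: "tensor_products E S C P \<phi>"
begin

abbreviation TL where "TL N \<equiv> tensor_left E S C P \<phi> N"
abbreviation T where "T \<equiv> tensor E S C P \<phi>"

text \<open>
  The universal weighted cocone of the chosen tensor product; it corresponds to the identity.
\<close>

definition insertion :: "('e, 'a, 'c, 'd) ftr \<Rightarrow> ('e, 'a, 'u) model \<Rightarrow> 'e \<Rightarrow> 'u \<Rightarrow> 'd" where
  "insertion N M = leg N (P N M) (\<phi> N M (P N M) (Ident C (P N M)))"

lemma
  assumes N: "N \<in> Obj (Mod_op E S C)" and M: "M \<in> Obj (Mod_small E S)"
  shows insertion_universal: "universal N M (P N M) (insertion N M)"
    and \<phi>_hom: "h \<in> hom C (P N M) X \<Longrightarrow> \<phi> N M X h \<in> hom PSh M (K N X)"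
    and leg_\<phi>: "h \<in> hom C (P N M) X \<Longrightarrow> A \<in> Obj E \<Longrightarrow> x \<in> fobj M A \<Longrightarrow>
      leg N X (\<phi> N M X h) A x = Comp C h (insertion N M A x)"
proof -
  have t: "is_tensor E C N M (P N M) (\<phi> N M)"
    using tensors N M unfolding tensor_products_def by blast
  note N' = Mod_op_functor[OF N]
  show "universal N M (P N M) (insertion N M)" unfolding insertion_def by (rule tensor_universal[OF N' t])
  show "h \<in> hom C (P N M) X \<Longrightarrow> \<phi> N M X h \<in> hom PSh M (K N X)" by (rule tensor_hom[OF N' t])
  show "h \<in> hom C (P N M) X \<Longrightarrow> A \<in> Obj E \<Longrightarrow> x \<in> fobj M A \<Longrightarrow>
      leg N X (\<phi> N M X h) A x = Comp C h (insertion N M A x)"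
    unfolding insertion_def by (rule tensor_leg[OF N' t])
qed

lemma insertion_hom: "N \<in> Obj (Mod_op E S C) \<Longrightarrow> M \<in> Obj (Mod_small E S) \<Longrightarrow> A \<in> Obj E \<Longrightarrow>
    x \<in> fobj M A \<Longrightarrow> insertion N M A x \<in> hom C (fobj N A) (P N M)"
  by (rule weighted_cocone_hom[OF universal_cocone[OF insertion_universal]])

lemma P_Obj: "N \<in> Obj (Mod_op E S C) \<Longrightarrow> M \<in> Obj (Mod_small E S) \<Longrightarrow> P N M \<in> Obj C"
  by (rule weighted_cocone_Obj[OF universal_cocone[OF insertion_universal]])

lemma TL_Obj [simp]: "M \<in> Obj (Mod_small E S) \<Longrightarrow> fobj (TL N) M = P N M"
  by (simp add: tensor_left_def)

text \<open>
  The arrows \<open>N \<otimes> \<mu>\<close> and \<open>\<nu> \<otimes> M\<close> are both defined by compatibility with the bijections \<open>\<phi>\<close> for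
  all \<open>T\<close>. It suffices to test this at the identity of the target \<open>X\<close>, that is, on the insertions.
\<close>

lemma arr_classifier:
  assumes N: "N \<in> Obj (Mod_op E S C)" and M: "M \<in> Obj (Mod_small E S)"
    and h: "h \<in> hom C (P N M) X"
    and \<theta>: "\<And>T g. g \<in> hom C X T \<Longrightarrow> \<theta> T g \<in> hom PSh M (K N T)"
    and leg_\<theta>: "\<And>T g A x. g \<in> hom C X T \<Longrightarrow> A \<in> Obj E \<Longrightarrow> x \<in> fobj M A \<Longrightarrow>
      leg N T (\<theta> T g) A x = Comp C g (s A x)"
    and s: "\<And>A x. A \<in> Obj E \<Longrightarrow> x \<in> fobj M A \<Longrightarrow> s A x \<in> hom C (fobj N A) X"
  shows "(\<forall>T\<in>Obj C. \<forall>g\<in>hom C X T. \<phi> N M T (Comp C g h) = \<theta> T g) \<longleftrightarrow>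
    (\<forall>A\<in>Obj E. \<forall>x\<in>fobj M A. Comp C h (insertion N M A x) = s A x)"
proof (intro iffI ballI)
  note X = C.hom_Obj(2)[OF h]
  note id = C.Ident_hom[OF X]
  fix A x assume *: "\<forall>T\<in>Obj C. \<forall>g\<in>hom C X T. \<phi> N M T (Comp C g h) = \<theta> T g"
    and A: "A \<in> Obj E" "x \<in> fobj M A"
  have "\<phi> N M X (Comp C (Ident C X) h) = \<theta> X (Ident C X)" using * X id by blast
  then show "Comp C h (insertion N M A x) = s A x"
    using leg_\<phi>[OF N M h A] leg_\<theta>[OF id A] C.Ident_Comp[OF h] C.Ident_Comp[OF s[OF A]] by simp
next
  fix T g assume *: "\<forall>A\<in>Obj E. \<forall>x\<in>fobj M A. Comp C h (insertion N M A x) = s A x"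
    and T: "T \<in> Obj C" and g: "g \<in> hom C X T"
  show "\<phi> N M T (Comp C g h) = \<theta> T g"
  proof (rule leg_eqI[OF Mod_op_functor[OF N] T \<phi>_hom[OF N M C.Comp_hom[OF h g]] \<theta>[OF g]])
    fix A x assume A: "A \<in> Obj E" "x \<in> fobj M A"
    show "leg N T (\<phi> N M T (Comp C g h)) A x = leg N T (\<theta> T g) A x"
      using leg_\<phi>[OF N M C.Comp_hom[OF h g] A] leg_\<theta>[OF g A] * A
        C.Comp_assoc[OF insertion_hom[OF N M A] h g] by simp
  qed
qed

lemma
  assumes N: "N \<in> Obj (Mod_op E S C)" and \<mu>: "\<mu> \<in> hom (Mod_small E S) M M'"
  shows TL_hom: "farr (TL N) \<mu> \<in> hom C (P N M) (P N M')"
    and TL_insertion: "A \<in> Obj E \<Longrightarrow> x \<in> fobj M A \<Longrightarrow>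
      Comp C (farr (TL N) \<mu>) (insertion N M A x) = insertion N M' A (elt \<mu> A x)"
proof -
  note M = category.hom_Obj[OF category_Mod_small \<mu>]
  note \<mu>' = hom_Mod_smallD[OF \<mu>]
  let ?Q = "\<lambda>h. h \<in> hom C (P N M) (P N M') \<and> (\<forall>T\<in>Obj C. \<forall>g\<in>hom C (P N M') T.
     \<phi> N M T (Comp C g h) = Comp PSh (\<phi> N M' T g) \<mu>)"
  let ?R = "\<lambda>h. h \<in> hom C (P N M) (P N M') \<and>
     (\<forall>A\<in>Obj E. \<forall>x\<in>fobj M A. Comp C h (insertion N M A x) = insertion N M' A (elt \<mu> A x))"
  have "?Q h \<longleftrightarrow> ?R h" for h
    by (intro conj_cong refl arr_classifier[OF N M(1)])
      (auto simp: leg_pre[OF \<mu>'] leg_\<phi>[OF N M(2)] elt_in[OF \<mu>'] insertion_hom[OF N M(2)]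
        simp del: Mod_small_simps intro: psh.Comp_hom[OF \<mu>' \<phi>_hom[OF N M(2)]])
  moreover have "\<exists>!h. ?R h"
    by (rule universal_ex1[OF insertion_universal[OF N M(1)]
        weighted_cocone_pre[OF universal_cocone[OF insertion_universal[OF N M(2)]] \<mu>']])
  moreover have "farr (TL N) \<mu> = (THE h. ?Q h)"
    using \<mu> by (simp add: tensor_left_def hom_def Let_def)
  ultimately have "?R (farr (TL N) \<mu>)"
    using theI'[of ?R] by simp
  then show "farr (TL N) \<mu> \<in> hom C (P N M) (P N M')" "A \<in> Obj E \<Longrightarrow> x \<in> fobj M A \<Longrightarrow>
      Comp C (farr (TL N) \<mu>) (insertion N M A x) = insertion N M' A (elt \<mu> A x)" by blast+
qed

lemma TL_functor:
  assumes N: "N \<in> Obj (Mod_op E S C)"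
  shows "is_functor (Mod_small E S) C (TL N)"
proof (rule functor_by_universality[OF category_Mod_small _ Mod_op_functor[OF N]])
  let ?I = "id_ftr (Mod_small E S)"
  show "is_functor (Mod_small E S) PSh ?I"
    using id_functor[OF category_Mod_small] category_Mod_small
    unfolding Mod_small_def Mod_def by (simp add: is_functor_full_sub)
  show "fobj (TL N) \<in> extensional (Obj (Mod_small E S))"
    "farr (TL N) \<in> extensional (Arr (Mod_small E S))"
    unfolding tensor_left_def by auto
  fix M assume M: "M \<in> Obj (Mod_small E S)"
  show "universal N (fobj ?I M) (P N M) (insertion N M)" using insertion_universal[OF N M] M
    by (simp del: Mod_small_simps)
  show "fobj (TL N) M = P N M" using M by (rule TL_Obj)
next
  fix \<mu> M M' assume \<mu>: "\<mu> \<in> hom (Mod_small E S) M M'"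
  show "farr (TL N) \<mu> \<in> hom C (P N M) (P N M')" by (rule TL_hom[OF N \<mu>])
  fix A x assume "A \<in> Obj E" "x \<in> fobj (fobj (id_ftr (Mod_small E S)) M) A"
  then show "Comp C (farr (TL N) \<mu>) (insertion N M A x) =
      insertion N M' A (elt (farr (id_ftr (Mod_small E S)) \<mu>) A x)"
    using TL_insertion[OF N \<mu>] homD(1)[OF \<mu>] category.hom_Obj[OF category_Mod_small \<mu>]
    by (simp del: Mod_small_simps)
qed

text \<open>
  The colimits to be preserved are colimits in \<open>Mod\<close>, so \<open>colimit_of_universal\<close> applies.
\<close>

lemma TL_wc:
  assumes N: "N \<in> Obj (Mod_op E S C)"
  shows "weakly_cocontinuous E S C (TL N)"
  unfolding weakly_cocontinuous_def
proof (intro allI impI, elim conjE)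
  fix J :: "('u, 'u) cat" and D M l
  assume sJ: "small_category J" and col': "is_colimit (Mod_small E S) J D M l"
    and col: "is_colimit (Mod E S) J D M l"
  have J: "category J" using sJ by (simp add: small_category_def)
  interpret J: category J by fact
  have D: "is_functor J (Mod_small E S) D" and M: "M \<in> Obj (Mod_small E S)"
    and l: "\<And>i. i \<in> Obj J \<Longrightarrow> l i \<in> hom (Mod_small E S) (fobj D i) M"
    using col' by (auto simp: is_colimit_def is_cocone_def)
  note DO = functor_Obj[OF D]
  show "is_colimit C J (comp_ftr J (TL N) D) (fobj (TL N) M) (\<lambda>i. farr (TL N) (l i))"
  proof (rule colimit_of_universal[OF col J N])
    show "is_functor J C (comp_ftr J (TL N) D)" by (rule comp_functor[OF J D TL_functor[OF N]])
    show "universal N M (fobj (TL N) M) (insertion N M)"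
      using insertion_universal[OF N M] TL_Obj[OF M] by simp
    fix i assume i: "i \<in> Obj J"
    show "universal N (fobj D i) (fobj (comp_ftr J (TL N) D) i) (insertion N (fobj D i))"
      using insertion_universal[OF N DO[OF i]] TL_Obj[OF DO[OF i]] i by simp
    show "farr (TL N) (l i) \<in> hom C (fobj (comp_ftr J (TL N) D) i) (fobj (TL N) M)"
      using functor_hom[OF TL_functor[OF N] l[OF i]] i by simp
    fix A x assume "A \<in> Obj E" "x \<in> fobj (fobj D i) A"
    then show "Comp C (farr (TL N) (l i)) (insertion N (fobj D i) A x) = insertion N M A (elt (l i) A x)"
      by (rule TL_insertion[OF N l[OF i]])
  next
    fix u i j A x assume u: "u \<in> hom J i j" and A: "A \<in> Obj E" "x \<in> fobj (fobj D i) A"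
    show "Comp C (farr (comp_ftr J (TL N) D) u) (insertion N (fobj D i) A x) =
        insertion N (fobj D j) A (elt (farr D u) A x)"
      using TL_insertion[OF N functor_hom[OF D u] A] homD(1)[OF u] by simp
  qed
qed

lemma TL_Hom_wc: "N \<in> Obj (Mod_op E S C) \<Longrightarrow> TL N \<in> Obj (Hom_wc E S C)"
  using TL_functor TL_wc by simp

lemma
  assumes \<nu>: "\<nu> \<in> hom (Mod_op E S C) N N'"
  shows T_hom: "farr T \<nu> \<in> hom (Hom_wc E S C) (TL N) (TL N')"
    and T_at_hom: "M \<in> Obj (Mod_small E S) \<Longrightarrow> at (farr T \<nu>) M \<in> hom C (P N M) (P N' M)"
    and T_insertion: "M \<in> Obj (Mod_small E S) \<Longrightarrow> A \<in> Obj E \<Longrightarrow> x \<in> fobj M A \<Longrightarrow>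
      Comp C (at (farr T \<nu>) M) (insertion N M A x) = Comp C (insertion N' M A x) (at \<nu> A)"
proof -
  note N = category.hom_Obj[OF category_Mod_op \<nu>]
  note \<nu>' = hom_Mod_op[OF \<nu>]
  have \<nu>A: "at \<nu> A \<in> hom C (fobj N A) (fobj N' A)" if "A \<in> Obj E" for A
    using at_hom[OF \<nu>'] that by simp
  let ?Q = "\<lambda>M h. h \<in> hom C (P N M) (P N' M) \<and> (\<forall>X\<in>Obj C. \<forall>g\<in>hom C (P N' M) X.
     \<phi> N M X (Comp C g h) = Comp PSh (hom_from_pre E C \<nu> X) (\<phi> N' M X g))"
  let ?R = "\<lambda>M h. h \<in> hom C (P N M) (P N' M) \<and>
     (\<forall>A\<in>Obj E. \<forall>x\<in>fobj M A. Comp C h (insertion N M A x) = Comp C (insertion N' M A x) (at \<nu> A))"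
  have eq: "farr T \<nu> = (TL N, TL N', \<lambda>M\<in>Obj (Mod_small E S). THE h. ?Q M h)"
    using \<nu> by (simp add: tensor_def hom_def Let_def)
  have R: "?R M (at (farr T \<nu>) M)" if M: "M \<in> Obj (Mod_small E S)" for M
  proof -
    have "?Q M h \<longleftrightarrow> ?R M h" for h
    proof (intro conj_cong refl arr_classifier[OF N(1) M])
      fix X g assume g: "g \<in> hom C (P N' M) X"
      note X = C.hom_Obj(2)[OF g]
      show "Comp PSh (hom_from_pre E C \<nu> X) (\<phi> N' M X g) \<in> hom PSh M (K N X)"
        by (rule psh.Comp_hom[OF \<phi>_hom[OF N(2) M g] pre_hom[OF \<nu>' X]])
      fix A x assume A: "A \<in> Obj E" "x \<in> fobj M A"
      show "leg N X (Comp PSh (hom_from_pre E C \<nu> X) (\<phi> N' M X g)) A x =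
          Comp C g (Comp C (insertion N' M A x) (at \<nu> A))"
        using leg_diagram[OF \<nu>' X \<phi>_hom[OF N(2) M g] A] leg_\<phi>[OF N(2) M g A]
          C.Comp_assoc[OF \<nu>A[OF A(1)] insertion_hom[OF N(2) M A] g] by simp
    next
      fix A x assume A: "A \<in> Obj E" "x \<in> fobj M A"
      show "Comp C (insertion N' M A x) (at \<nu> A) \<in> hom C (fobj N A) (P N' M)"
        by (rule C.Comp_hom[OF \<nu>A[OF A(1)] insertion_hom[OF N(2) M A]])
    qed
    moreover have "\<exists>!h. ?R M h"
      by (rule universal_ex1[OF insertion_universal[OF N(1) M]
          weighted_cocone_diagram[OF universal_cocone[OF insertion_universal[OF N(2) M]] \<nu>']])
    moreover have "at (farr T \<nu>) M = (THE h. ?Q M h)" using M by (simp add: eq del: Mod_small_simps)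
    ultimately show ?thesis using theI'[of "?R M"] by simp
  qed
  then show h: "at (farr T \<nu>) M \<in> hom C (P N M) (P N' M)" if "M \<in> Obj (Mod_small E S)" for M
    using that by blast
  show u: "Comp C (at (farr T \<nu>) M) (insertion N M A x) = Comp C (insertion N' M A x) (at \<nu> A)"
    if "M \<in> Obj (Mod_small E S)" "A \<in> Obj E" "x \<in> fobj M A" for M A x
    using R that by blast
  have "(TL N, TL N', \<lambda>M\<in>Obj (Mod_small E S). at (farr T \<nu>) M) \<in>
      hom (fun_cat (Mod_small E S) C) (TL N) (TL N')"
  proof (rule ntI[OF TL_functor[OF N(1)] TL_functor[OF N(2)] _ _ category_Mod_small])
    fix M assume "M \<in> Obj (Mod_small E S)"
    then show "at (farr T \<nu>) M \<in> hom C (fobj (TL N) M) (fobj (TL N') M)"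
      using h TL_Obj by metis
  next
    fix \<mu> M M' assume \<mu>: "\<mu> \<in> hom (Mod_small E S) M M'"
      and M: "M \<in> Obj (Mod_small E S)" and M': "M' \<in> Obj (Mod_small E S)"
    note tl = TL_hom[OF N(1) \<mu>] and tl' = TL_hom[OF N(2) \<mu>]
    show "Comp C (at (farr T \<nu>) M') (farr (TL N) \<mu>) = Comp C (farr (TL N') \<mu>) (at (farr T \<nu>) M)"
    proof (rule universal_eqI[OF Mod_op_functor[OF N(1)] insertion_universal[OF N(1) M]
          C.Comp_hom[OF tl h[OF M']] C.Comp_hom[OF h[OF M] tl']])
      fix A x assume A: "A \<in> Obj E" "x \<in> fobj M A"
      note \<mu>x = elt_in[OF hom_Mod_smallD[OF \<mu>] A]
      show "Comp C (Comp C (at (farr T \<nu>) M') (farr (TL N) \<mu>)) (insertion N M A x) =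
          Comp C (Comp C (farr (TL N') \<mu>) (at (farr T \<nu>) M)) (insertion N M A x)"
        using C.Comp_assoc[OF insertion_hom[OF N(1) M A] tl h[OF M']] TL_insertion[OF N(1) \<mu> A]
          C.Comp_assoc[OF insertion_hom[OF N(1) M A] h[OF M] tl'] TL_insertion[OF N(2) \<mu> A]
          u[OF M A] u[OF M' A(1) \<mu>x]
          C.Comp_assoc[OF \<nu>A[OF A(1)] insertion_hom[OF N(2) M A] tl']
        by simp
    qed
  qed
  moreover have "(\<lambda>M\<in>Obj (Mod_small E S). at (farr T \<nu>) M) = at (farr T \<nu>)"
    unfolding eq by (simp add: fun_eq_iff del: Mod_small_simps)
  ultimately have "farr T \<nu> \<in> hom (fun_cat (Mod_small E S) C) (TL N) (TL N')"
    using eq by simp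
  then show "farr T \<nu> \<in> hom (Hom_wc E S C) (TL N) (TL N')"
    using TL_wc N by (simp add: hom_Hom_wc)
qed

lemma T_Obj: "N \<in> Obj (Mod_op E S C) \<Longrightarrow> fobj T N = TL N"
  by (simp add: tensor_def)

lemma T_functor: "is_functor (Mod_op E S C) (Hom_wc E S C) T"
proof (rule is_functorI)
  interpret Mo: category "Mod_op E S C" by (rule category_Mod_op)
  interpret H: category "Hom_wc E S C" by (rule category_Hom_wc)
  show "fobj T \<in> extensional (Obj (Mod_op E S C))" "farr T \<in> extensional (Arr (Mod_op E S C))"
    unfolding tensor_def by auto
  fix N assume N: "N \<in> Obj (Mod_op E S C)"
  note N' = Mod_op_functor[OF N]
  show "fobj T N \<in> Obj (Hom_wc E S C)" using T_Obj[OF N] TL_Hom_wc[OF N] by simp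
  note id = Mo.Ident_hom[OF N]
  have "farr T (Ident (Mod_op E S C) N) = Ident (Hom_wc E S C) (TL N)"
  proof (rule nt_eqI)
    show "farr T (Ident (Mod_op E S C) N) \<in> hom (fun_cat (Mod_small E S) C) (TL N) (TL N)"
      "Ident (Hom_wc E S C) (TL N) \<in> hom (fun_cat (Mod_small E S) C) (TL N) (TL N)"
      using T_hom[OF id] H.Ident_hom[OF TL_Hom_wc[OF N]] by (auto simp: hom_Hom_wc)
    fix M assume M: "M \<in> Obj (Mod_small E S)"
    note PO = P_Obj[OF N M]
    have "at (farr T (Ident (Mod_op E S C) N)) M = Ident C (P N M)"
    proof (rule universal_eqI[OF N' insertion_universal[OF N M] T_at_hom[OF id M] C.Ident_hom[OF PO]])
      fix A x assume A: "A \<in> Obj E" "x \<in> fobj M A"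
      show "Comp C (at (farr T (Ident (Mod_op E S C) N)) M) (insertion N M A x) =
          Comp C (Ident C (P N M)) (insertion N M A x)"
        using T_insertion[OF id M A] C.Comp_Ident[OF insertion_hom[OF N M A]]
          C.Ident_Comp[OF insertion_hom[OF N M A]] A by (simp add: fun_cat_simps(5))
    qed
    then show "at (farr T (Ident (Mod_op E S C) N)) M = at (Ident (Hom_wc E S C) (TL N)) M"
      using M TL_Obj[OF M] by (simp add: fun_cat_simps(5))
  qed
  then show "farr T (Ident (Mod_op E S C) N) = Ident (Hom_wc E S C) (fobj T N)"
    using T_Obj[OF N] by simp
next
  interpret Mo: category "Mod_op E S C" by (rule category_Mod_op)
  interpret H: category "Hom_wc E S C" by (rule category_Hom_wc)
  fix \<nu> N N' assume \<nu>: "\<nu> \<in> hom (Mod_op E S C) N N'"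
  note N = Mo.hom_Obj[OF \<nu>]
  show "farr T \<nu> \<in> hom (Hom_wc E S C) (fobj T N) (fobj T N')"
    using T_hom[OF \<nu>] T_Obj N by simp
  fix \<nu>' N'' assume \<nu>': "\<nu>' \<in> hom (Mod_op E S C) N' N''"
  note N'' = Mo.hom_Obj(2)[OF \<nu>']
  note \<nu>\<nu> = Mo.Comp_hom[OF \<nu> \<nu>']
  show "farr T (Comp (Mod_op E S C) \<nu>' \<nu>) = Comp (Hom_wc E S C) (farr T \<nu>') (farr T \<nu>)"
  proof (rule nt_eqI)
    show "farr T (Comp (Mod_op E S C) \<nu>' \<nu>) \<in> hom (fun_cat (Mod_small E S) C) (TL N) (TL N'')"
      "Comp (Hom_wc E S C) (farr T \<nu>') (farr T \<nu>) \<in> hom (fun_cat (Mod_small E S) C) (TL N) (TL N'')"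
      using T_hom[OF \<nu>\<nu>] H.Comp_hom[OF T_hom[OF \<nu>] T_hom[OF \<nu>']] by (auto simp: hom_Hom_wc)
    fix M assume M: "M \<in> Obj (Mod_small E S)"
    note h = T_at_hom[OF \<nu> M] and h' = T_at_hom[OF \<nu>' M]
    have "at (farr T (Comp (Mod_op E S C) \<nu>' \<nu>)) M = Comp C (at (farr T \<nu>') M) (at (farr T \<nu>) M)"
    proof (rule universal_eqI[OF Mod_op_functor[OF N(1)] insertion_universal[OF N(1) M]
          T_at_hom[OF \<nu>\<nu> M] C.Comp_hom[OF h h']])
      fix A x assume A: "A \<in> Obj E" "x \<in> fobj M A"
      have \<nu>A: "at \<nu> A \<in> hom C (fobj N A) (fobj N' A)" "at \<nu>' A \<in> hom C (fobj N' A) (fobj N'' A)"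
        using at_hom[OF hom_Mod_op[OF \<nu>]] at_hom[OF hom_Mod_op[OF \<nu>']] A by auto
      show "Comp C (at (farr T (Comp (Mod_op E S C) \<nu>' \<nu>)) M) (insertion N M A x) =
          Comp C (Comp C (at (farr T \<nu>') M) (at (farr T \<nu>) M)) (insertion N M A x)"
        using T_insertion[OF \<nu>\<nu> M A] T_insertion[OF \<nu> M A] T_insertion[OF \<nu>' M A] A
          C.Comp_assoc[OF insertion_hom[OF N(1) M A] h h']
          C.Comp_assoc[OF \<nu>A(1) insertion_hom[OF N(2) M A] h']
          C.Comp_assoc[OF \<nu>A insertion_hom[OF N'' M A]]
        by (simp add: at_Comp)
    qed
    then show "at (farr T (Comp (Mod_op E S C) \<nu>' \<nu>)) M =
        at (Comp (Hom_wc E S C) (farr T \<nu>') (farr T \<nu>)) M"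
      using M by (simp add: at_Comp del: Mod_small_simps)
  qed
qed

end

section \<open>The equivalence\<close>

context tensor_setting
begin

abbreviation RY where "RY \<equiv> restrict_yoneda E S C"

text \<open>
  Universal weighted cocones are unique up to isomorphism, so \<open>N \<otimes> Hom(A, -)\<close> is \<open>N A\<close>. Naturality
  of this isomorphism in \<open>A\<close> and \<open>N\<close> is checked on insertions in the next lemma.
\<close>

lemma tensor_representable:
  assumes N: "N \<in> Obj (Mod_op E S C)"
  obtains \<epsilon> where "\<And>A. A \<in> Obj E \<Longrightarrow> iso C (P N (hom_ftr E A)) (fobj N A) (\<epsilon> A)"
    "\<And>A B y. A \<in> Obj E \<Longrightarrow> B \<in> Obj E \<Longrightarrow> y \<in> Hset E A B \<Longrightarrow>
       Comp C (\<epsilon> A) (insertion N (hom_ftr E A) B y) = farr N (dec E A B y)"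
proof -
  note N' = Mod_op_functor[OF N]
  have "\<exists>h. iso C (P N (hom_ftr E A)) (fobj N A) h \<and> (\<forall>B\<in>Obj E. \<forall>y\<in>Hset E A B.
      Comp C h (insertion N (hom_ftr E A) B y) = farr N (dec E A B y))" if A: "A \<in> Obj E" for A
  proof -
    note u = insertion_universal[OF N representable_small[OF A]]
    note r = universal_representable[OF N' A]
    obtain h where h: "h \<in> hom C (P N (hom_ftr E A)) (fobj N A)"
      and hu: "\<And>B y. B \<in> Obj E \<Longrightarrow> y \<in> fobj (hom_ftr E A) B \<Longrightarrow>
        Comp C h (insertion N (hom_ftr E A) B y) = farr N (dec E A B y)"
      using universal_arr[OF u universal_cocone[OF r]] by blast
    then show ?thesis using universal_iso[OF N' u r h hu] by auto
  qed
  then show ?thesis using that by metis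
qed

lemma restrict_tensor_iso: "isomorphic (fun_cat (Mod_op E S C) (Mod_op E S C))
    (comp_ftr (Mod_op E S C) RY T) (id_ftr (Mod_op E S C))"
proof -
  interpret Mo: category "Mod_op E S C" by (rule category_Mod_op)
  have "\<forall>N. \<exists>\<epsilon>. N \<in> Obj (Mod_op E S C) \<longrightarrow>
      (\<forall>A\<in>Obj E. iso C (P N (hom_ftr E A)) (fobj N A) (\<epsilon> A) \<and>
        (\<forall>B\<in>Obj E. \<forall>y\<in>Hset E A B.
           Comp C (\<epsilon> A) (insertion N (hom_ftr E A) B y) = farr N (dec E A B y)))"
    using tensor_representable by metis
  then obtain \<epsilon> where \<epsilon>: "\<And>N A. N \<in> Obj (Mod_op E S C) \<Longrightarrow> A \<in> Obj E \<Longrightarrow>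
        iso C (P N (hom_ftr E A)) (fobj N A) (\<epsilon> N A)"
    and \<epsilon>u: "\<And>N A B y. N \<in> Obj (Mod_op E S C) \<Longrightarrow> A \<in> Obj E \<Longrightarrow> B \<in> Obj E \<Longrightarrow> y \<in> Hset E A B \<Longrightarrow>
        Comp C (\<epsilon> N A) (insertion N (hom_ftr E A) B y) = farr N (dec E A B y)"
    by metis
  have \<epsilon>h: "\<epsilon> N A \<in> hom C (P N (hom_ftr E A)) (fobj N A)"
    if "N \<in> Obj (Mod_op E S C)" "A \<in> Obj E" for N A
    using \<epsilon>[OF that] by (simp add: iso_def)
  have RO: "fobj (R (TL N)) A = P N (hom_ftr E A)" if A: "A \<in> Obj E" for N A
    using TL_Obj[OF representable_small[OF A]] A by simp
  let ?\<alpha> = "\<lambda>N. (R (TL N), N, \<lambda>A\<in>Obj (op E). \<epsilon> N A)"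
  have RTL: "R (TL N) \<in> Obj (Mod_op E S C)" if "N \<in> Obj (Mod_op E S C)" for N
    by (rule R_model[OF TL_functor[OF that] TL_wc[OF that]])
  have \<alpha>: "?\<alpha> N \<in> hom (fun_cat (op E) C) (R (TL N)) N" if N: "N \<in> Obj (Mod_op E S C)" for N
  proof (rule ntI[OF R_functor[OF TL_functor[OF N]] Mod_op_functor[OF N] _ _
        category_op[OF E.category_axioms]])
    fix A assume "A \<in> Obj (op E)"
    then have A: "A \<in> Obj E" by simp
    show "\<epsilon> N A \<in> hom C (fobj (R (TL N)) A) (fobj N A)" using \<epsilon>h[OF N A] RO[OF A] by simp
  next
    fix f A B assume f': "f \<in> hom (op E) A B" and "A \<in> Obj (op E)" "B \<in> Obj (op E)"
    then have f: "f \<in> hom E B A" and A: "A \<in> Obj E" and B: "B \<in> Obj E" by auto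
    note Yf = functor_hom[OF yoneda_functor_small f']
    have Yf: "farr (yoneda E) f \<in> hom (Mod_small E S) (hom_ftr E A) (hom_ftr E B)"
      using Yf A B by simp
    note tl = TL_hom[OF N Yf] and Nf = functor_hom[OF Mod_op_functor[OF N] f']
    have "Comp C (\<epsilon> N B) (farr (TL N) (farr (yoneda E) f)) = Comp C (farr N f) (\<epsilon> N A)"
    proof (rule universal_eqI[OF Mod_op_functor[OF N] insertion_universal[OF N representable_small[OF A]]
          C.Comp_hom[OF tl \<epsilon>h[OF N B]] C.Comp_hom[OF \<epsilon>h[OF N A] Nf]])
      fix X and y :: 'u assume X: "X \<in> Obj E" and "y \<in> fobj (hom_ftr E A) X"
      then have y': "y \<in> fobj (hom_ftr E A) X" and y: "y \<in> Hset E A X" by auto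
      note u = insertion_hom[OF N representable_small[OF A] X y']
      note d = E.dec_hom'[OF A X y]
      note e = E.elt_yoneda[OF f X y]
      have in': "elt (farr (yoneda E) f) X y \<in> Hset E B X"
        unfolding e by (rule E.enc_in'[OF E.Comp_hom[OF f d]])
      have "dec E B X (elt (farr (yoneda E) f) X y) = Comp E (dec E A X y) f"
        unfolding e using E.Comp_hom[OF f d] B X by (simp add: E.enc_simps)
      moreover have "farr N (Comp E (dec E A X y) f) = Comp C (farr N f) (farr N (dec E A X y))"
        using functor_Comp[OF Mod_op_functor[OF N], of "dec E A X y" X A f B] f d by simp
      ultimately show "Comp C (Comp C (\<epsilon> N B) (farr (TL N) (farr (yoneda E) f))) (insertion N (hom_ftr E A) X y) =
          Comp C (Comp C (farr N f) (\<epsilon> N A)) (insertion N (hom_ftr E A) X y)"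
        using C.Comp_assoc[OF u tl \<epsilon>h[OF N B]] C.Comp_assoc[OF u \<epsilon>h[OF N A] Nf]
          TL_insertion[OF N Yf X y'] \<epsilon>u[OF N B X in'] \<epsilon>u[OF N A X y] by simp
    qed
    then show "Comp C (\<epsilon> N B) (farr (R (TL N)) f) = Comp C (farr N f) (\<epsilon> N A)"
      using homD(1)[OF f] by simp
  qed
  show ?thesis
  proof (rule isomorphic_functorsI[OF category_Mod_op category_Mod_op
        comp_functor[OF category_Mod_op T_functor restrict_functor] id_functor[OF category_Mod_op]])
    fix N assume N: "N \<in> Obj (Mod_op E S C)"
    have "iso (fun_cat (op E) C) (R (TL N)) N (?\<alpha> N)"
      by (rule iso_fun_cat[OF category_op[OF E.category_axioms] C.category_axioms \<alpha>[OF N]])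
        (use \<epsilon>[OF N] RO in auto)
    then have "iso (Mod_op E S C) (R (TL N)) N (?\<alpha> N)"
      using RTL[OF N] N unfolding Mod_op_def by (intro iso_full_sub) auto
    then show "iso (Mod_op E S C) (fobj (comp_ftr (Mod_op E S C) RY T) N)
        (fobj (id_ftr (Mod_op E S C)) N) (?\<alpha> N)"
      using N T_Obj[OF N] restrict_Obj[OF TL_Hom_wc[OF N]] by simp
  next
    fix \<nu> N N' assume \<nu>: "\<nu> \<in> hom (Mod_op E S C) N N'"
      and N: "N \<in> Obj (Mod_op E S C)" and N': "N' \<in> Obj (Mod_op E S C)"
    note \<alpha>M = hom_Mod_opI[OF \<alpha>[OF N] RTL[OF N] N] hom_Mod_opI[OF \<alpha>[OF N'] RTL[OF N'] N']
    have RT: "farr RY (farr T \<nu>) \<in> hom (Mod_op E S C) (R (TL N)) (R (TL N'))"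
      using functor_hom[OF restrict_functor T_hom[OF \<nu>]] restrict_Obj[OF TL_Hom_wc] N N' by simp
    have "Comp (Mod_op E S C) (?\<alpha> N') (farr RY (farr T \<nu>)) = Comp (Mod_op E S C) \<nu> (?\<alpha> N)"
    proof (rule nt_eqI[OF hom_Mod_op[OF Mo.Comp_hom[OF RT \<alpha>M(2)]]
          hom_Mod_op[OF Mo.Comp_hom[OF \<alpha>M(1) \<nu>]]])
      fix A assume "A \<in> Obj (op E)"
      then have A: "A \<in> Obj E" by simp
      note Y = representable_small[OF A]
      note t = T_at_hom[OF \<nu> Y]
      have \<nu>A: "at \<nu> B \<in> hom C (fobj N B) (fobj N' B)" if "B \<in> Obj E" for B
        using at_hom[OF hom_Mod_op[OF \<nu>]] that by simp
      have "Comp C (\<epsilon> N' A) (at (farr T \<nu>) (hom_ftr E A)) = Comp C (at \<nu> A) (\<epsilon> N A)"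
      proof (rule universal_eqI[OF Mod_op_functor[OF N] insertion_universal[OF N Y]
            C.Comp_hom[OF t \<epsilon>h[OF N' A]] C.Comp_hom[OF \<epsilon>h[OF N A] \<nu>A[OF A]]])
        fix X and y :: 'u assume X: "X \<in> Obj E" and "y \<in> fobj (hom_ftr E A) X"
        then have y': "y \<in> fobj (hom_ftr E A) X" and y: "y \<in> Hset E A X" by auto
        note u = insertion_hom[OF N Y X y'] and u' = insertion_hom[OF N' Y X y']
        have d: "dec E A X y \<in> hom (op E) X A" using E.dec_hom'[OF A X y] by simp
        show "Comp C (Comp C (\<epsilon> N' A) (at (farr T \<nu>) (hom_ftr E A))) (insertion N (hom_ftr E A) X y) =
            Comp C (Comp C (at \<nu> A) (\<epsilon> N A)) (insertion N (hom_ftr E A) X y)"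
          using C.Comp_assoc[OF u t \<epsilon>h[OF N' A]] C.Comp_assoc[OF u \<epsilon>h[OF N A] \<nu>A[OF A]]
            T_insertion[OF \<nu> Y X y'] \<epsilon>u[OF N A X y] \<epsilon>u[OF N' A X y]
            C.Comp_assoc[OF \<nu>A[OF X] u' \<epsilon>h[OF N' A]] at_natural[OF hom_Mod_op[OF \<nu>] d]
          by simp
      qed
      then show "at (Comp (Mod_op E S C) (?\<alpha> N') (farr RY (farr T \<nu>))) A =
          at (Comp (Mod_op E S C) \<nu> (?\<alpha> N)) A"
        using A at_restrict[OF T_hom[OF \<nu>] A] by (simp add: at_Comp)
    qed
    then show "Comp (Mod_op E S C) (?\<alpha> N') (farr (comp_ftr (Mod_op E S C) RY T) \<nu>) =
        Comp (Mod_op E S C) (farr (id_ftr (Mod_op E S C)) \<nu>) (?\<alpha> N)"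
      using homD(1)[OF \<nu>] by simp
  qed
qed

text \<open>
  Likewise \<open>(F \<circ> Y) \<otimes> M\<close> and \<open>F M\<close> both carry universal weighted cocones. The comparison \<open>\<delta> F M\<close>
  sends the insertion at \<open>x\<close> to \<open>F\<close> applied to \<open>yo x\<close>, which is natural in \<open>M\<close> and \<open>F\<close> by the
  naturality of \<open>yo\<close> and of transformations \<open>F \<rightarrow> F'\<close>.
\<close>

lemma tensor_restrict_iso: "isomorphic (fun_cat (Hom_wc E S C) (Hom_wc E S C))
    (comp_ftr (Hom_wc E S C) T RY) (id_ftr (Hom_wc E S C))"
proof -
  interpret H: category "Hom_wc E S C" by (rule category_Hom_wc)
  have F: "is_functor (Mod_small E S) C F" "weakly_cocontinuous E S C F"
    "R F \<in> Obj (Mod_op E S C)" if "F \<in> Obj (Hom_wc E S C)" for F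
    using that R_model by auto
  have "\<exists>h. iso C (P (R F) M) (fobj F M) h \<and> (\<forall>A\<in>Obj E. \<forall>x\<in>fobj M A.
      Comp C h (insertion (R F) M A x) = farr F (E.yo M A x))"
    if "F \<in> Obj (Hom_wc E S C)" and M: "M \<in> Obj (Mod_small E S)" for F M
  proof -
    note F = F[OF that(1)]
    note u = insertion_universal[OF F(3) M] and w = weakly_cocontinuous_universal[OF F(1,2) M]
    obtain h where h: "h \<in> hom C (P (R F) M) (fobj F M)"
      and hu: "\<And>A x. A \<in> Obj E \<Longrightarrow> x \<in> fobj M A \<Longrightarrow>
        Comp C h (insertion (R F) M A x) = farr F (E.yo M A x)"
      using universal_arr[OF u universal_cocone[OF w]] by blast
    then show ?thesis using universal_iso[OF R_functor[OF F(1)] u w h hu] by auto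
  qed
  then obtain \<delta> where \<delta>: "\<And>F M. F \<in> Obj (Hom_wc E S C) \<Longrightarrow> M \<in> Obj (Mod_small E S) \<Longrightarrow>
        iso C (P (R F) M) (fobj F M) (\<delta> F M)"
    and \<delta>u: "\<And>F M A x. F \<in> Obj (Hom_wc E S C) \<Longrightarrow> M \<in> Obj (Mod_small E S) \<Longrightarrow> A \<in> Obj E \<Longrightarrow>
        x \<in> fobj M A \<Longrightarrow> Comp C (\<delta> F M) (insertion (R F) M A x) = farr F (E.yo M A x)"
    by metis
  have \<delta>h: "\<delta> F M \<in> hom C (P (R F) M) (fobj F M)"
    if "F \<in> Obj (Hom_wc E S C)" "M \<in> Obj (Mod_small E S)" for F M
    using \<delta>[OF that] by (simp add: iso_def)
  let ?\<alpha> = "\<lambda>F. (TL (R F), F, \<lambda>M\<in>Obj (Mod_small E S). \<delta> F M)"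
  have \<alpha>: "?\<alpha> F \<in> hom (fun_cat (Mod_small E S) C) (TL (R F)) F"
    if FO: "F \<in> Obj (Hom_wc E S C)" for F
  proof (rule ntI[OF TL_functor[OF F(3)[OF FO]] F(1)[OF FO] _ _ category_Mod_small])
    fix M assume M: "M \<in> Obj (Mod_small E S)"
    then show "\<delta> F M \<in> hom C (fobj (TL (R F)) M) (fobj F M)" using \<delta>h[OF FO M] TL_Obj[OF M] by simp
  next
    fix \<mu> M M' assume \<mu>: "\<mu> \<in> hom (Mod_small E S) M M'"
      and M: "M \<in> Obj (Mod_small E S)" and M': "M' \<in> Obj (Mod_small E S)"
    note F = F[OF FO]
    note tl = TL_hom[OF F(3) \<mu>] and F\<mu> = functor_hom[OF F(1) \<mu>]
    show "Comp C (\<delta> F M') (farr (TL (R F)) \<mu>) = Comp C (farr F \<mu>) (\<delta> F M)"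
    proof (rule universal_eqI[OF R_functor[OF F(1)] insertion_universal[OF F(3) M]
          C.Comp_hom[OF tl \<delta>h[OF FO M']] C.Comp_hom[OF \<delta>h[OF FO M] F\<mu>]])
      fix A x assume A: "A \<in> Obj E" "x \<in> fobj M A"
      note u = insertion_hom[OF F(3) M A] and \<mu>x = elt_in[OF hom_Mod_smallD[OF \<mu>] A]
      show "Comp C (Comp C (\<delta> F M') (farr (TL (R F)) \<mu>)) (insertion (R F) M A x) =
          Comp C (Comp C (farr F \<mu>) (\<delta> F M)) (insertion (R F) M A x)"
        using C.Comp_assoc[OF u tl \<delta>h[OF FO M']] C.Comp_assoc[OF u \<delta>h[OF FO M] F\<mu>]
          TL_insertion[OF F(3) \<mu> A] \<delta>u[OF FO M A] \<delta>u[OF FO M' A(1) \<mu>x]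
          functor_Comp[OF F(1) yo_hom_small[OF M A] \<mu>] E.yo_post[OF hom_Mod_smallD[OF \<mu>] A]
        by simp
    qed
  qed
  have \<alpha>H: "?\<alpha> F \<in> hom (Hom_wc E S C) (TL (R F)) F" if FO: "F \<in> Obj (Hom_wc E S C)" for F
    using \<alpha>[OF FO] F[OF FO] TL_wc by (simp add: hom_Hom_wc)
  show ?thesis
  proof (rule isomorphic_functorsI[OF category_Hom_wc category_Hom_wc
        comp_functor[OF category_Hom_wc restrict_functor T_functor] id_functor[OF category_Hom_wc]])
    fix F assume FO: "F \<in> Obj (Hom_wc E S C)"
    have "iso (fun_cat (Mod_small E S) C) (TL (R F)) F (?\<alpha> F)"
    proof (rule iso_fun_cat[OF category_Mod_small C.category_axioms \<alpha>[OF FO]])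
      fix M assume M: "M \<in> Obj (Mod_small E S)"
      show "iso C (fobj (TL (R F)) M) (fobj F M) (at (?\<alpha> F) M)"
        using \<delta>[OF FO M] TL_Obj[OF M] M by (simp del: Mod_small_simps)
    qed
    then have "iso (Hom_wc E S C) (TL (R F)) F (?\<alpha> F)"
      using F[OF FO] TL_wc unfolding Hom_wc_def by (intro iso_full_sub) auto
    then show "iso (Hom_wc E S C) (fobj (comp_ftr (Hom_wc E S C) T RY) F)
        (fobj (id_ftr (Hom_wc E S C)) F) (?\<alpha> F)"
      using FO T_Obj[OF F(3)[OF FO]] restrict_Obj[OF FO] by (simp del: Hom_wc_simps)
  next
    fix \<eta> F F' assume \<eta>: "\<eta> \<in> hom (Hom_wc E S C) F F'"
      and FO: "F \<in> Obj (Hom_wc E S C)" and FO': "F' \<in> Obj (Hom_wc E S C)"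
    note F = F[OF FO] and F' = F[OF FO']
    have R\<eta>: "farr RY \<eta> \<in> hom (Mod_op E S C) (R F) (R F')"
      using functor_hom[OF restrict_functor \<eta>] restrict_Obj FO FO' by simp
    note T\<eta> = T_hom[OF R\<eta>]
    have \<eta>': "\<eta> \<in> hom (fun_cat (Mod_small E S) C) F F'" using \<eta> by (simp add: hom_Hom_wc)
    have "Comp (Hom_wc E S C) (?\<alpha> F') (farr T (farr RY \<eta>)) = Comp (Hom_wc E S C) \<eta> (?\<alpha> F)"
    proof (rule nt_eqI[OF conjunct1[OF hom_Hom_wc[THEN iffD1, OF H.Comp_hom[OF T\<eta> \<alpha>H[OF FO']]]]
          conjunct1[OF hom_Hom_wc[THEN iffD1, OF H.Comp_hom[OF \<alpha>H[OF FO] \<eta>]]]])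
      fix M assume M: "M \<in> Obj (Mod_small E S)"
      note t = T_at_hom[OF R\<eta> M] and \<eta>M = at_hom[OF \<eta>' M]
      have "Comp C (\<delta> F' M) (at (farr T (farr RY \<eta>)) M) = Comp C (at \<eta> M) (\<delta> F M)"
      proof (rule universal_eqI[OF R_functor[OF F(1)] insertion_universal[OF F(3) M]
            C.Comp_hom[OF t \<delta>h[OF FO' M]] C.Comp_hom[OF \<delta>h[OF FO M] \<eta>M]])
        fix A x assume A: "A \<in> Obj E" "x \<in> fobj M A"
        note u = insertion_hom[OF F(3) M A] and u' = insertion_hom[OF F'(3) M A]
        have R\<eta>A: "at (farr RY \<eta>) A \<in> hom C (fobj (R F) A) (fobj (R F') A)"
          using at_hom[OF hom_Mod_op[OF R\<eta>]] A by simp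
        show "Comp C (Comp C (\<delta> F' M) (at (farr T (farr RY \<eta>)) M)) (insertion (R F) M A x) =
            Comp C (Comp C (at \<eta> M) (\<delta> F M)) (insertion (R F) M A x)"
          using C.Comp_assoc[OF u t \<delta>h[OF FO' M]] C.Comp_assoc[OF u \<delta>h[OF FO M] \<eta>M]
            T_insertion[OF R\<eta> M A] \<delta>u[OF FO M A] \<delta>u[OF FO' M A]
            C.Comp_assoc[OF R\<eta>A u' \<delta>h[OF FO' M]] at_restrict[OF \<eta> A(1)]
            at_natural[OF \<eta>' yo_hom_small[OF M A]]
          by simp
      qed
      then show "at (Comp (Hom_wc E S C) (?\<alpha> F') (farr T (farr RY \<eta>))) M =
          at (Comp (Hom_wc E S C) \<eta> (?\<alpha> F)) M"
        using M by (simp add: at_Comp del: Mod_small_simps)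
    qed
    then show "Comp (Hom_wc E S C) (?\<alpha> F') (farr (comp_ftr (Hom_wc E S C) T RY) \<eta>) =
        Comp (Hom_wc E S C) (farr (id_ftr (Hom_wc E S C)) \<eta>) (?\<alpha> F)"
      using homD(1)[OF \<eta>] by simp
  qed
qed

lemma restrict_tensor_equivalence:
  "inverse_equivalences (Hom_wc E S C) (Mod_op E S C) RY T"
  unfolding inverse_equivalences_def
  using category_Hom_wc category_Mod_op restrict_functor T_functor tensor_restrict_iso restrict_tensor_iso by blast

end

context sketch_setting
begin

lemma ex_tensor_products:
  assumes "cocomplete TYPE('u) C"
  shows "\<exists>P \<phi>. tensor_products E S C P \<phi>"
proof -
  have "\<exists>X \<psi>. N \<in> Obj (Mod_op E S C) \<and> M \<in> Obj (Mod_small E S) \<longrightarrow> is_tensor E C N M X \<psi>" for N M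
  proof (cases "N \<in> Obj (Mod_op E S C) \<and> M \<in> Obj (Mod_small E S)")
    case True
    then obtain X t where "universal N M X t" using ex_universal[OF assms, of N M] by auto
    then show ?thesis
      using universal_is_tensor Mod_op_functor Mod_small_functor True by blast
  qed blast
  then show ?thesis unfolding tensor_products_def by metis
qed

end

section \<open>Naturality in the target category\<close>

context sketch_setting
begin

lemma postcomp_wc:
  assumes C': "category C'" and G: "cocontinuous TYPE('u) C C' G"
    and F: "is_functor (Mod_small E S) C F" and wc: "weakly_cocontinuous E S C F"
  shows "weakly_cocontinuous E S C' (comp_ftr (Mod_small E S) G F)"
  unfolding weakly_cocontinuous_def
proof (intro allI impI, elim conjE)
  fix J :: "('u, 'u) cat" and D M l
  assume sJ: "small_category J" and col: "is_colimit (Mod_small E S) J D M l"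
    "is_colimit (Mod E S) J D M l"
  have J: "category J" using sJ by (simp add: small_category_def)
  have D: "is_functor J (Mod_small E S) D" and M: "M \<in> Obj (Mod_small E S)"
    and l: "\<And>i. i \<in> Obj J \<Longrightarrow> l i \<in> Arr (Mod_small E S)"
    using col(1) by (auto simp: is_colimit_def is_cocone_def hom_def)
  have "is_colimit C J (comp_ftr J F D) (fobj F M) (\<lambda>i. farr F (l i))"
    using wc sJ col unfolding weakly_cocontinuous_def by blast
  then have c: "is_colimit C' J (comp_ftr J G (comp_ftr J F D)) (fobj G (fobj F M))
      (\<lambda>i. farr G (farr F (l i)))"
    using G sJ unfolding cocontinuous_def by blast
  have "fobj (comp_ftr (Mod_small E S) G F) M = fobj G (fobj F M)" using M by (rule comp_ftr_simps)
  then show "is_colimit C' J (comp_ftr J (comp_ftr (Mod_small E S) G F) D)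
      (fobj (comp_ftr (Mod_small E S) G F) M) (\<lambda>i. farr (comp_ftr (Mod_small E S) G F) (l i))"
    unfolding comp_ftr_assoc[OF J D] using l
    by (auto intro!: is_colimit_cong[OF c _ J])
qed

lemma postcomp_Mod_op:
  assumes C': "category C'" and G: "cocontinuous TYPE('u) C C' G" and N: "N \<in> Obj (Mod_op E S C)"
  shows "comp_ftr (op E) G N \<in> Obj (Mod_op E S C')"
proof -
  have G': "is_functor C C' G" using G by (simp add: cocontinuous_def)
  have "is_colimit C' (op (cindex c)) (comp_ftr (op (cindex c)) (comp_ftr (op E) G N) (cdiagram c))
      (fobj (comp_ftr (op E) G N) (capex c)) (\<lambda>i. farr (comp_ftr (op E) G N) (cleg c i))"
    if c: "c \<in> S" for c
  proof -
    note J = category_op[OF cone_index(2)[OF c]]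
    have D: "is_functor (cindex c) E (cdiagram c)" and A: "capex c \<in> Obj E"
      and l: "\<And>i. i \<in> Obj (cindex c) \<Longrightarrow> cleg c i \<in> Arr E"
      using cone[OF c] by (auto simp: is_cone_def hom_def)
    have "is_colimit C (op (cindex c)) (comp_ftr (op (cindex c)) N (cdiagram c))
        (fobj N (capex c)) (\<lambda>i. farr N (cleg c i))"
      using N c by (simp add: Mod_op_def)
    then have "is_colimit C' (op (cindex c)) (comp_ftr (op (cindex c)) G (comp_ftr (op (cindex c)) N (cdiagram c)))
        (fobj G (fobj N (capex c))) (\<lambda>i. farr G (farr N (cleg c i)))"
      using G small_category_op[OF cone_index(1)[OF c]] unfolding cocontinuous_def by blast
    note c = this
    have "fobj (comp_ftr (op E) G N) (capex c) = fobj G (fobj N (capex c))"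
      using A by simp
    then show ?thesis
      unfolding comp_ftr_assoc[OF J functor_op_op[OF D]] using l
      by (auto intro!: is_colimit_cong[OF c _ J])
  qed
  then show ?thesis
    using comp_functor[OF category_op[OF E.category_axioms] Mod_op_functor[OF N] G']
    by (simp add: Mod_op_def)
qed

lemma postcomp_natural:
  assumes C': "category C'" and G: "cocontinuous TYPE('u) C C' G"
  shows "is_functor (Hom_wc E S C) (Hom_wc E S C') (postcomp (Mod_small E S) G (Hom_wc E S C))"
    and "is_functor (Mod_op E S C) (Mod_op E S C') (postcomp (op E) G (Mod_op E S C))"
    and "comp_ftr (Hom_wc E S C)
         (restrict_yoneda E S C') (postcomp (Mod_small E S) G (Hom_wc E S C)) =
       comp_ftr (Hom_wc E S C)
         (postcomp (op E) G (Mod_op E S C)) (restrict_yoneda E S C)"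
proof -
  have G': "is_functor C C' G" using G by (simp add: cocontinuous_def)
  show H: "is_functor (Hom_wc E S C) (Hom_wc E S C') (postcomp (Mod_small E S) G (Hom_wc E S C))"
    unfolding Hom_wc_def
    using postcomp_wc[OF C' G]
    by (intro postcomp_functor[OF category_Mod_small C.category_axioms C' G']) simp
  show Mo: "is_functor (Mod_op E S C) (Mod_op E S C') (postcomp (op E) G (Mod_op E S C))"
    unfolding Mod_op_def
    using postcomp_Mod_op[OF C' G]
    by (intro postcomp_functor[OF category_op[OF E.category_axioms] C.category_axioms C' G'])
      (simp add: Mod_op_def)
  let ?L = "comp_ftr (Hom_wc E S C)
         (restrict_yoneda E S C') (postcomp (Mod_small E S) G (Hom_wc E S C))"
    and ?R = "comp_ftr (Hom_wc E S C)
         (postcomp (op E) G (Mod_op E S C)) (restrict_yoneda E S C)"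
  have ob: "comp_ftr (op E) (comp_ftr (Mod_small E S) G F) (yoneda E) = comp_ftr (op E) G (R F)" for F
    by (rule comp_ftr_assoc[OF category_op[OF E.category_axioms] yoneda_functor_small])
  have "fobj ?L F = fobj ?R F" if F: "F \<in> Obj (Hom_wc E S C)" for F
  proof -
    have "fobj ?L F = comp_ftr (op E) (comp_ftr (Mod_small E S) G F) (yoneda E)"
      using functor_Obj[OF H F] F by (simp add: restrict_yoneda_def precomp_Obj postcomp_Obj
        del: Hom_wc_simps)
    moreover have "fobj ?R F = comp_ftr (op E) G (R F)"
      using functor_Obj[OF restrict_functor F] F restrict_Obj[OF F]
      by (simp add: postcomp_Obj del: Hom_wc_simps)
    ultimately show ?thesis using ob by simp
  qed
  moreover have "farr ?L \<eta> = farr ?R \<eta>" if \<eta>: "\<eta> \<in> Arr (Hom_wc E S C)" for \<eta>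
  proof -
    note h = arr_hom[OF \<eta>]
    have "farr (postcomp (Mod_small E S) G (Hom_wc E S C)) \<eta> \<in> Arr (Hom_wc E S C')"
      using functor_hom[OF H h] by (rule homD(1))
    moreover have "farr (restrict_yoneda E S C) \<eta> \<in> Arr (Mod_op E S C)"
      using functor_hom[OF restrict_functor h] by (rule homD(1))
    ultimately show ?thesis
      using \<eta> representable_small
      by (simp add: restrict_yoneda_def precomp_arr postcomp_arr ob fun_eq_iff del: Mod_small_simps)
  qed
  ultimately show "?L = ?R"
    unfolding comp_ftr_def by (auto simp: fun_eq_iff restrict_def)
qed

end

theorem theorem5p6:
  fixes E :: "('e, 'a) cat" and S :: "('e, 'a, 'u) cone set" and C :: "('c, 'd) cat"
  assumes "universe TYPE('u)"
    and "limit_sketch E S" and "realized E S"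
    and "category C" and "locally_small TYPE('u) C" and "cocomplete TYPE('u) C"
  shows "(\<exists>P \<phi>. tensor_products E S C P \<phi>) \<and>
    (\<forall>P \<phi>. tensor_products E S C P \<phi> \<longrightarrow>
       inverse_equivalences (Hom_wc E S C) (Mod_op E S C)
         (restrict_yoneda E S C) (tensor E S C P \<phi>)) \<and>
    (\<forall>(C' :: ('c1, 'd1) cat) G.
       category C' \<and> locally_small TYPE('u) C' \<and> cocomplete TYPE('u) C' \<and>
       cocontinuous TYPE('u) C C' G \<longrightarrow>
       is_functor (Hom_wc E S C) (Hom_wc E S C') (postcomp (Mod_small E S) G (Hom_wc E S C)) \<and>
       is_functor (Mod_op E S C) (Mod_op E S C') (postcomp (op E) G (Mod_op E S C)) \<and>
       comp_ftr (Hom_wc E S C)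
         (restrict_yoneda E S C') (postcomp (Mod_small E S) G (Hom_wc E S C)) =
       comp_ftr (Hom_wc E S C)
         (postcomp (op E) G (Mod_op E S C)) (restrict_yoneda E S C))"
proof -
  have "infinite (UNIV :: 'u set)" using assms(1) by (simp add: universe_def)
  moreover have "category E" "locally_small TYPE('u) E"
    using assms(2) by (simp_all add: limit_sketch_def)
  ultimately interpret sketch_setting E C "TYPE('u)" S
    using assms by (intro sketch_setting.intro weighted_setting.intro locally_small_category.intro
      locally_small_category_axioms.intro sketch_setting_axioms.intro)
  have "inverse_equivalences (Hom_wc E S C) (Mod_op E S C) (restrict_yoneda E S C) (tensor E S C P \<phi>)"
    if "tensor_products E S C P \<phi>" for P \<phi>
  proof -
    interpret tensor_setting E C "TYPE('u)" S P \<phi> by unfold_locales (rule that)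
    show ?thesis by (rule restrict_tensor_equivalence)
  qed
  then show ?thesis
    using ex_tensor_products[OF assms(6)] postcomp_natural by blast
qed

end
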